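(* Let $\mathcal{C}$ be a monotone graph class. Then $\mathcal{C}$ has bounded tree rank if and only if there is $k\in\mathbb{N}$ such that every first-order formula is equivalent on $\mathcal{C}$ to a first-order formula of alternation rank at most $k$.
   Context: Graphs are finite, simple, undirected; monotone means closed under subgraphs; formulas are first-order over the signature with one binary edge relation, and two formulas are equivalent on $\mathcal{C}$ if they are satisfied by the same tuples in every $G\in\mathcal{C}$. A rooted tree has depth equal to the maximum number of vertices on a root-to-leaf path; $\mathcal{T}_d$ is the class of trees of depth $d$. For $r\in\mathbb{N}$, $H$ is an $r$-shallow topological minor of $G$ if $G$ contains as a subgraph a graph obtained from $H$ by replacing each edge $uv$ by a $u$–$v$ path with at most $r$ internal vertices; $\mathrm{TopMinors}_r(\mathcal{C})$ is the class of these for $G\in\mathcal{C}$. $\mathcal{C}$ has bounded tree rank if $\max\{d\in\mathbb{N}:\exists r,\ \mathcal{T}_d\subseteq\mathrm{TopMinors}_r(\mathcal{C})\}$ exists. Alternation rank: convert the formula to negation normal form; along each branch of the syntax tree, ignoring $\wedge,\vee$, count consecutive pairs $\exists\forall$ or $\forall\exists$; take the maximum over branches. *)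

theory Defs
  imports "Graph_Theory.Graph_Theory"
begin

section \<open>Graph classes\<close>

text \<open>
  A finite simple undirected graph is a \<^const>\<open>pair_graph\<close>: a finite loop-free symmetric
  digraph without parallel arcs, the edge \<open>uv\<close> being the two arcs \<open>(u,v)\<close> and \<open>(v,u)\<close>.
  The empty graph is allowed. Vertices are natural numbers, so that a class of graphs is a set;
  as every finite graph has an isomorphic copy on natural numbers, an isomorphism-closed set of
  such graphs represents an arbitrary graph class.
\<close>

type_synonym ngraph = "nat pair_pre_digraph"

definition graph_class :: "ngraph set \<Rightarrow> bool" where
  "graph_class C \<longleftrightarrow>
     (\<forall>G\<in>C. pair_graph G) \<and>
     (\<forall>G\<in>C. \<forall>H :: ngraph. pair_graph H \<and> digraph_iso (with_proj G) (with_proj H) \<longrightarrow> H \<in> C)"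

definition monotone_class :: "ngraph set \<Rightarrow> bool" where
  "monotone_class C \<longleftrightarrow>
     (\<forall>G\<in>C. \<forall>H :: ngraph. pair_graph H \<and> subgraph (with_proj H) (with_proj G) \<longrightarrow> H \<in> C)"


section \<open>Trees of a given depth\<close>

text \<open>
  The library's \<^const>\<open>forest\<close> is meant for digraphs: it counts the closed walk \<open>u, v, u\<close> along an
  undirected edge as a cycle. A cycle of an undirected graph has at least three vertices.
\<close>

definition undirected_cycle :: "'a pair_pre_digraph \<Rightarrow> 'a list \<Rightarrow> bool" where
  "undirected_cycle G p \<longleftrightarrow>
     vpath p (with_proj G) \<and> length p \<ge> 3 \<and> (last p, hd p) \<in> parcs G"

definition undirected_tree :: "'a pair_pre_digraph \<Rightarrow> bool" where
  "undirected_tree T \<longleftrightarrow>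
     pair_graph T \<and> Digraph_Component.connected (with_proj T) \<and> (\<nexists>p. undirected_cycle T p)"

text \<open>In the tree \<open>T\<close> rooted at \<open>r\<close>, \<open>u\<close> is a child of \<open>v\<close> if \<open>v\<close> precedes \<open>u\<close> on the path from \<open>r\<close>
  to \<open>u\<close>. In particular, the root of the one-vertex tree is a leaf, so this tree has depth 1.\<close>

definition tree_child :: "'a pair_pre_digraph \<Rightarrow> 'a \<Rightarrow> 'a \<Rightarrow> 'a \<Rightarrow> bool" where
  "tree_child T r v u \<longleftrightarrow> (\<exists>p. vpath (p @ [v, u]) (with_proj T) \<and> hd (p @ [v, u]) = r)"

definition tree_leaf :: "'a pair_pre_digraph \<Rightarrow> 'a \<Rightarrow> 'a \<Rightarrow> bool" where
  "tree_leaf T r v \<longleftrightarrow> v \<in> pverts T \<and> (\<nexists>u. tree_child T r v u)"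

definition root_leaf_path :: "'a pair_pre_digraph \<Rightarrow> 'a \<Rightarrow> 'a list \<Rightarrow> bool" where
  "root_leaf_path T r p \<longleftrightarrow> vpath p (with_proj T) \<and> hd p = r \<and> tree_leaf T r (last p)"

definition rooted_depth :: "'a pair_pre_digraph \<Rightarrow> 'a \<Rightarrow> nat" where
  "rooted_depth T r = Max {length p | p. root_leaf_path T r p}"

definition trees_of_depth :: "nat \<Rightarrow> ngraph set" where
  "trees_of_depth d = {T. undirected_tree T \<and> (\<exists>r\<in>pverts T. rooted_depth T r = d)}"


section \<open>Shallow topological minors and tree rank\<close>

definition internal_verts :: "'a list \<Rightarrow> 'a list" where
  "internal_verts p = butlast (tl p)"

text \<open>
  \<open>S\<close> arises from \<open>H\<close>, up to the renaming \<open>f\<close> of the vertices of \<open>H\<close>, by replacing each edge \<open>uv\<close>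
  with the path \<open>P u v\<close>; the two orientations of an edge yield the same path, reversed, and the
  internal vertices of the paths are new and pairwise distinct.
\<close>

definition shallow_subdivision :: "nat \<Rightarrow> 'a pair_pre_digraph \<Rightarrow> 'b pair_pre_digraph \<Rightarrow> bool" where
  "shallow_subdivision r H S \<longleftrightarrow> (\<exists>f P.
     inj_on f (pverts H) \<and>
     (\<forall>(u, v) \<in> parcs H.
        vpath (P u v) (with_proj S) \<and> hd (P u v) = f u \<and> last (P u v) = f v \<and>
        P v u = rev (P u v) \<and>
        length (internal_verts (P u v)) \<le> r \<and>
        set (internal_verts (P u v)) \<inter> f ` pverts H = {}) \<and>
     (\<forall>(u, v) \<in> parcs H. \<forall>(x, y) \<in> parcs H. {u, v} \<noteq> {x, y} \<longrightarrow>
        set (internal_verts (P u v)) \<inter> set (internal_verts (P x y)) = {}) \<and>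
     pverts S = f ` pverts H \<union> (\<Union>(u, v) \<in> parcs H. set (internal_verts (P u v))) \<and>
     parcs S = (\<Union>(u, v) \<in> parcs H. set (vwalk_arcs (P u v))))"

definition shallow_top_minor :: "nat \<Rightarrow> 'a pair_pre_digraph \<Rightarrow> 'b pair_pre_digraph \<Rightarrow> bool" where
  "shallow_top_minor r H G \<longleftrightarrow>
     (\<exists>S. pair_graph S \<and> subgraph (with_proj S) (with_proj G) \<and> shallow_subdivision r H S)"

definition TopMinors :: "nat \<Rightarrow> ngraph set \<Rightarrow> ngraph set" where
  "TopMinors r C = {H. pair_graph H \<and> (\<exists>G\<in>C. shallow_top_minor r H G)}"

definition tree_rank_set :: "ngraph set \<Rightarrow> nat set" where
  "tree_rank_set C = {d. \<exists>r. trees_of_depth d \<subseteq> TopMinors r C}"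

text \<open>The maximum exists. (\<^const>\<open>Max\<close> is unspecified on infinite sets.)\<close>

definition bounded_tree_rank :: "ngraph set \<Rightarrow> bool" where
  "bounded_tree_rank C \<longleftrightarrow> (\<exists>m \<in> tree_rank_set C. \<forall>d \<in> tree_rank_set C. d \<le> m)"


section \<open>First-order logic of graphs\<close>

datatype fo =
    Eq nat nat
  | Adj nat nat
  | Neg fo
  | Conj fo fo
  | Disj fo fo
  | Exi nat fo
  | Uni nat fo

primrec fv :: "fo \<Rightarrow> nat set" where
  "fv (Eq x y) = {x, y}"
| "fv (Adj x y) = {x, y}"
| "fv (Neg \<phi>) = fv \<phi>"
| "fv (Conj \<phi> \<psi>) = fv \<phi> \<union> fv \<psi>"
| "fv (Disj \<phi> \<psi>) = fv \<phi> \<union> fv \<psi>"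
| "fv (Exi x \<phi>) = fv \<phi> - {x}"
| "fv (Uni x \<phi>) = fv \<phi> - {x}"

primrec sat :: "'a pair_pre_digraph \<Rightarrow> (nat \<Rightarrow> 'a) \<Rightarrow> fo \<Rightarrow> bool" where
  "sat G s (Eq x y) \<longleftrightarrow> s x = s y"
| "sat G s (Adj x y) \<longleftrightarrow> (s x, s y) \<in> parcs G"
| "sat G s (Neg \<phi>) \<longleftrightarrow> \<not> sat G s \<phi>"
| "sat G s (Conj \<phi> \<psi>) \<longleftrightarrow> sat G s \<phi> \<and> sat G s \<psi>"
| "sat G s (Disj \<phi> \<psi>) \<longleftrightarrow> sat G s \<phi> \<or> sat G s \<psi>"
| "sat G s (Exi x \<phi>) \<longleftrightarrow> (\<exists>v\<in>pverts G. sat G (s(x := v)) \<phi>)"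
| "sat G s (Uni x \<phi>) \<longleftrightarrow> (\<forall>v\<in>pverts G. sat G (s(x := v)) \<phi>)"

text \<open>The tuples range over the free variables of both formulas; the values of an assignment at
  other variables are irrelevant.\<close>

definition equivalent_on :: "ngraph set \<Rightarrow> fo \<Rightarrow> fo \<Rightarrow> bool" where
  "equivalent_on C \<phi> \<psi> \<longleftrightarrow>
     (\<forall>G\<in>C. \<forall>s. (\<forall>x \<in> fv \<phi> \<union> fv \<psi>. s x \<in> pverts G) \<longrightarrow> sat G s \<phi> = sat G s \<psi>)"

fun nnf :: "fo \<Rightarrow> fo" where
  "nnf (Eq x y) = Eq x y"
| "nnf (Adj x y) = Adj x y"
| "nnf (Conj \<phi> \<psi>) = Conj (nnf \<phi>) (nnf \<psi>)"
| "nnf (Disj \<phi> \<psi>) = Disj (nnf \<phi>) (nnf \<psi>)"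
| "nnf (Exi x \<phi>) = Exi x (nnf \<phi>)"
| "nnf (Uni x \<phi>) = Uni x (nnf \<phi>)"
| "nnf (Neg (Eq x y)) = Neg (Eq x y)"
| "nnf (Neg (Adj x y)) = Neg (Adj x y)"
| "nnf (Neg (Neg \<phi>)) = nnf \<phi>"
| "nnf (Neg (Conj \<phi> \<psi>)) = Disj (nnf (Neg \<phi>)) (nnf (Neg \<psi>))"
| "nnf (Neg (Disj \<phi> \<psi>)) = Conj (nnf (Neg \<phi>)) (nnf (Neg \<psi>))"
| "nnf (Neg (Exi x \<phi>)) = Uni x (nnf (Neg \<phi>))"
| "nnf (Neg (Uni x \<phi>)) = Exi x (nnf (Neg \<phi>))"

datatype quantifier = Exists | Forall

text \<open>The quantifier sequences along the branches of the syntax tree. This is applied to formulas in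
  negation normal form only, where \<^const>\<open>Neg\<close> has an atomic argument.\<close>

primrec branches :: "fo \<Rightarrow> quantifier list set" where
  "branches (Eq x y) = {[]}"
| "branches (Adj x y) = {[]}"
| "branches (Neg \<phi>) = branches \<phi>"
| "branches (Conj \<phi> \<psi>) = branches \<phi> \<union> branches \<psi>"
| "branches (Disj \<phi> \<psi>) = branches \<phi> \<union> branches \<psi>"
| "branches (Exi x \<phi>) = (#) Exists ` branches \<phi>"
| "branches (Uni x \<phi>) = (#) Forall ` branches \<phi>"

fun alternations :: "quantifier list \<Rightarrow> nat" where
  "alternations (p # q # qs) = (if p \<noteq> q then 1 else 0) + alternations (q # qs)"
| "alternations _ = 0"

definition alternation_rank :: "fo \<Rightarrow> nat" where
  "alternation_rank \<phi> = Max (alternations ` branches (nnf \<phi>))"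

end

theory Submission
  imports Defs "HOL-Library.Countable"
begin

text \<open>
  Assume bounded tree rank. Call a vertex of rank at least \<open>i + 1\<close> if no small set separates it, over
  short distances, from the other vertices of rank at least \<open>i\<close>. A vertex of large rank is the root of
  a subdivision of any given tree, so ranks are bounded. In the subgraph of the vertices of rank at
  most \<open>i\<close> every ball contains boundedly many vertices of rank exactly \<open>i\<close>. By induction on the
  number of ranks and by Gaifman's locality argument, a game with a bounded number of blocks of many
  moves determines the game with single moves of any given length: the vertices of the largest rank in a
  ball become constants, and the rest of the ball has fewer ranks. Hintikka formulas of the block game
  have bounded alternation rank.

  Conversely, if the tree rank is unbounded, the pigeonhole principle yields subdivided trees of large depth
  and arbitrary branching in which edges on the same level are subdivided equally often. By
  monotonicity their subtrees belong to the class. Two such trees, defined by alternately requiring a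
  child with and without the previous property, are separated by a fixed formula, but not by formulas
  with fewer alternations than levels and few quantifiers.
\<close>

section \<open>Games on a labelled structure\<close>

text \<open>For the first direction the order of choices is decisive. A formula fixes a number
  \<open>Q\<close> of single moves; \<open>Q\<close> and the number of ranks fix a radius
  \<open>r\<close>; only then is a tree picked that has the forbidden depth and is no
  \<open>r\<close>-shallow minor. Its size fixes the separator size \<open>N\<close>, hence the
  number of top vertices per ball, hence the block size \<open>q\<close>. So \<open>r\<close> must
  not depend on \<open>N\<close>, and the number of rounds must not depend on the formula at all.
  Gaifman's argument by itself costs a number of moves that grows with \<open>Q\<close>; large
  blocks absorb this. A whole path or a whole scattered set is played in one block, so a rank costs
  four rounds whatever \<open>Q\<close> is. Two more rounds per rank (a separator, then a path
  avoiding it) recover the ranks from adjacency, which gives six rounds per rank.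

  In the converse, the separating formula depends only on the sequence of subdivided levels, so this
  sequence must be fixed before the branching. The branching is then chosen larger than the number
  of quantifiers of the supposed equivalent, so that every block of moves leaves some child
  untouched.\<close>

definition piso :: "('a \<Rightarrow> 'a \<Rightarrow> 'l) \<Rightarrow> 'a rel \<Rightarrow> bool" where
  "piso e P \<longleftrightarrow> (\<forall>a b a' b'. (a, b) \<in> P \<longrightarrow> (a', b') \<in> P \<longrightarrow>
    (a = a' \<longleftrightarrow> b = b') \<and> e a a' = e b b')"

text \<open>
  In each of the \<open>k\<close> rounds the spoiler picks at most \<open>q\<close> elements of \<open>X\<close> or of \<open>Y\<close>; \<open>P\<close> collects the
  matched pairs. The pairs in \<open>P\<close> need not lie in the carriers \<open>X\<close> and \<open>Y\<close>: those outside act as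
  constants. For \<open>q = 1\<close> this is the usual game of length \<open>k\<close>.
\<close>

primrec bf :: "('a \<Rightarrow> 'a \<Rightarrow> 'l) \<Rightarrow> nat \<Rightarrow> nat \<Rightarrow> 'a set \<Rightarrow> 'a set \<Rightarrow> 'a rel \<Rightarrow> bool" where
  "bf e q 0 X Y P \<longleftrightarrow> piso e P"
| "bf e q (Suc k) X Y P \<longleftrightarrow>
    (\<forall>A\<subseteq>X. finite A \<and> card A \<le> q \<longrightarrow> (\<exists>R\<subseteq>X \<times> Y. A \<subseteq> Domain R \<and> bf e q k X Y (P \<union> R))) \<and>
    (\<forall>B\<subseteq>Y. finite B \<and> card B \<le> q \<longrightarrow> (\<exists>R\<subseteq>X \<times> Y. B \<subseteq> Range R \<and> bf e q k X Y (P \<union> R)))"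

declare bf.simps(2) [simp del]

lemma bf_SucE1:
  assumes "bf e q (Suc k) X Y P" "A \<subseteq> X" "finite A \<and> card A \<le> q"
  obtains R where "R \<subseteq> X \<times> Y" "A \<subseteq> Domain R" "bf e q k X Y (P \<union> R)"
  using assms(1)[unfolded bf.simps(2)] assms(2,3) by meson

lemma bf_SucE2:
  assumes "bf e q (Suc k) X Y P" "B \<subseteq> Y" "finite B \<and> card B \<le> q"
  obtains R where "R \<subseteq> X \<times> Y" "B \<subseteq> Range R" "bf e q k X Y (P \<union> R)"
  using assms(1)[unfolded bf.simps(2)] assms(2,3) by meson

lemma bf_SucI:
  assumes "\<And>A. A \<subseteq> X \<Longrightarrow> finite A \<and> card A \<le> q \<Longrightarrow>
      \<exists>R. R \<subseteq> X \<times> Y \<and> A \<subseteq> Domain R \<and> bf e q k X Y (P \<union> R)"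
    and "\<And>B. B \<subseteq> Y \<Longrightarrow> finite B \<and> card B \<le> q \<Longrightarrow>
      \<exists>R. R \<subseteq> X \<times> Y \<and> B \<subseteq> Range R \<and> bf e q k X Y (P \<union> R)"
  shows "bf e q (Suc k) X Y P"
  unfolding bf.simps(2) using assms by meson

lemma pisoD:
  assumes "piso e P" "(a, b) \<in> P" "(a', b') \<in> P"
  shows "a = a' \<longleftrightarrow> b = b'" "e a a' = e b b'"
  using assms unfolding piso_def by blast+

lemma piso_antimono: "piso e P \<Longrightarrow> P' \<subseteq> P \<Longrightarrow> piso e P'"
  unfolding piso_def by blast

lemma piso_converse [simp]: "piso e (P\<inverse>) \<longleftrightarrow> piso e P"
  unfolding piso_def by auto

lemma piso_relcomp:
  assumes "piso e P" "piso e P'"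
  shows "piso e (P O P')"
  unfolding piso_def
proof clarify
  fix a b c a' b' c'
  assume "(a, b) \<in> P" "(b, c) \<in> P'" "(a', b') \<in> P" "(b', c') \<in> P'"
  then show "(a = a' \<longleftrightarrow> c = c') \<and> e a a' = e c c'"
    using pisoD[OF assms(1), of a b a' b'] pisoD[OF assms(2), of b c b' c'] by auto
qed

lemma piso_Un:
  assumes "piso e P" "piso e Q"
    and "\<And>a b c d. (a, b) \<in> P \<Longrightarrow> (c, d) \<in> Q \<Longrightarrow> (a = c \<longleftrightarrow> b = d) \<and> e a c = e b d \<and> e c a = e d b"
  shows "piso e (P \<union> Q)"
  unfolding piso_def
proof clarify
  fix a b a' b'
  assume "(a, b) \<in> P \<union> Q" "(a', b') \<in> P \<union> Q"
  then show "(a = a' \<longleftrightarrow> b = b') \<and> e a a' = e b b'"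
    using assms(3)[of a b a' b'] assms(3)[of a' b' a b]
      pisoD[OF assms(1), of a b a' b'] pisoD[OF assms(2), of a b a' b'] by blast
qed

text \<open>One round of a simulation. Since the transformed answer covers both its domain and its
  range within the new carriers, a single verification serves the moves on both sides.\<close>

lemma bf_Suc_transfer:
  assumes bf: "bf e q (Suc k) X Y P" and sub: "X' \<subseteq> X" "Y' \<subseteq> Y" "q' \<le> q"
    and step: "\<And>R. R \<subseteq> X \<times> Y \<Longrightarrow> bf e q k X Y (P \<union> R) \<Longrightarrow>
      \<exists>R'. R' \<subseteq> X' \<times> Y' \<and> X' \<inter> Domain R \<subseteq> Domain R' \<and> Y' \<inter> Range R \<subseteq> Range R' \<and>
        bf e' q' k' X' Y' (P' \<union> R')"
  shows "bf e' q' (Suc k') X' Y' P'"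
proof (rule bf_SucI)
  fix A assume A: "A \<subseteq> X'" "finite A \<and> card A \<le> q'"
  then have "A \<subseteq> X" "finite A \<and> card A \<le> q" using sub by auto
  then obtain R where R: "R \<subseteq> X \<times> Y" "A \<subseteq> Domain R" "bf e q k X Y (P \<union> R)"
    by (rule bf_SucE1[OF bf])
  from step[OF R(1,3)] R(2) A(1)
  show "\<exists>R'. R' \<subseteq> X' \<times> Y' \<and> A \<subseteq> Domain R' \<and> bf e' q' k' X' Y' (P' \<union> R')"
    by (elim exE conjE, intro exI conjI) auto
next
  fix A assume A: "A \<subseteq> Y'" "finite A \<and> card A \<le> q'"
  then have "A \<subseteq> Y" "finite A \<and> card A \<le> q" using sub by auto
  then obtain R where R: "R \<subseteq> X \<times> Y" "A \<subseteq> Range R" "bf e q k X Y (P \<union> R)"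
    by (rule bf_SucE2[OF bf])
  from step[OF R(1,3)] R(2) A(1)
  show "\<exists>R'. R' \<subseteq> X' \<times> Y' \<and> A \<subseteq> Range R' \<and> bf e' q' k' X' Y' (P' \<union> R')"
    by (elim exE conjE, intro exI conjI) auto
qed

lemma bf_antimono: "bf e q k X Y P \<Longrightarrow> P' \<subseteq> P \<Longrightarrow> bf e q k X Y P'"
proof (induction k arbitrary: P P')
  case 0
  then show ?case using piso_antimono[of e P P'] by simp
next
  case (Suc k)
  have "bf e q k X Y (P' \<union> R)" if "bf e q k X Y (P \<union> R)" for R
    by (rule Suc.IH[OF that]) (use Suc.prems(2) in blast)
  then show ?case by (intro bf_Suc_transfer[OF Suc.prems(1)]) auto
qed

lemma bf_Suc_imp:
  assumes "bf e q (Suc k) X Y P"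
  shows "bf e q k X Y P"
  by (rule bf_SucE1[OF assms, of "{}"]) (auto intro: bf_antimono)

lemma bf_le_rounds: "bf e q k X Y P \<Longrightarrow> k' \<le> k \<Longrightarrow> bf e q k' X Y P"
  by (induction k) (use bf_Suc_imp le_Suc_eq in \<open>blast+\<close>)

lemma bf_imp_piso: "bf e q k X Y P \<Longrightarrow> piso e P"
  using bf_le_rounds[of e q k X Y P 0] by simp

lemma bf_le_size: "bf e q k X Y P \<Longrightarrow> q' \<le> q \<Longrightarrow> bf e q' k X Y P"
proof (induction k arbitrary: P)
  case (Suc k)
  show ?case by (rule bf_Suc_transfer[OF Suc.prems(1)]) (use Suc in auto)
qed simp

lemma bf_mono: "bf e q k X Y P \<Longrightarrow> q' \<le> q \<Longrightarrow> k' \<le> k \<Longrightarrow> P' \<subseteq> P \<Longrightarrow> bf e q' k' X Y P'"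
  by (meson bf_antimono bf_le_rounds bf_le_size)

lemma bf_converse: "bf e q k X Y P \<Longrightarrow> bf e q k Y X (P\<inverse>)"
proof (induction k arbitrary: P)
  case (Suc k)
  show ?case
  proof (rule bf_SucI)
    fix A assume "A \<subseteq> Y" "finite A \<and> card A \<le> q"
    then obtain R where "R \<subseteq> X \<times> Y" "A \<subseteq> Range R" "bf e q k X Y (P \<union> R)"
      using bf_SucE2[OF Suc.prems] by metis
    then show "\<exists>R. R \<subseteq> Y \<times> X \<and> A \<subseteq> Domain R \<and> bf e q k Y X (P\<inverse> \<union> R)"
      using Suc.IH[of "P \<union> R"] by (intro exI[of _ "R\<inverse>"]) (auto simp: converse_Un)
  next
    fix A assume "A \<subseteq> X" "finite A \<and> card A \<le> q"
    then obtain R where "R \<subseteq> X \<times> Y" "A \<subseteq> Domain R" "bf e q k X Y (P \<union> R)"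
      using bf_SucE1[OF Suc.prems] by metis
    then show "\<exists>R. R \<subseteq> Y \<times> X \<and> A \<subseteq> Range R \<and> bf e q k Y X (P\<inverse> \<union> R)"
      using Suc.IH[of "P \<union> R"] by (intro exI[of _ "R\<inverse>"]) (auto simp: converse_Un)
  qed
qed simp

text \<open>An answer can be thinned to a function on the picked set. Its image then has at most
  \<open>q\<close> elements and is itself a legal move, which is what composing strategies
  requires.\<close>

lemma bf_move:
  assumes "bf e q (Suc k) X Y P" "A \<subseteq> X" "finite A" "card A \<le> q"
  obtains h where "h ` A \<subseteq> Y" "bf e q k X Y (P \<union> (\<lambda>a. (a, h a)) ` A)"
proof -
  obtain R where R: "R \<subseteq> X \<times> Y" "A \<subseteq> Domain R" "bf e q k X Y (P \<union> R)"
    using bf_SucE1[OF assms(1,2)] assms(3,4) by metis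
  then have "\<forall>a\<in>A. \<exists>b. (a, b) \<in> R" by blast
  then obtain h where h: "\<forall>a\<in>A. (a, h a) \<in> R" by metis
  show thesis
  proof
    show "h ` A \<subseteq> Y" using h R by auto
    show "bf e q k X Y (P \<union> (\<lambda>a. (a, h a)) ` A)"
      by (rule bf_antimono[OF R(3)]) (use h in auto)
  qed
qed

lemma bf_move_one:
  assumes "bf e q (Suc k) X Y P" "x \<in> X" "q \<ge> 1"
  obtains y where "y \<in> Y" "bf e q k X Y (insert (x, y) P)"
  using bf_move[OF assms(1), of "{x}"] assms(2,3) by auto

lemma bf_relcomp:
  "bf e q k X Y P \<Longrightarrow> bf e q k Y Z P' \<Longrightarrow> bf e q k X Z (P O P')"
proof (induction k arbitrary: P P')
  case 0
  then show ?case using piso_relcomp by auto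
next
  case (Suc k)
  \<comment> \<open>The carriers and the induction hypothesis are generalised here, so that moves on
    the other side follow by applying the same fact to the converses.\<close>
  have one: "\<exists>R. R \<subseteq> X \<times> Z \<and> A \<subseteq> Domain R \<and> bf e q k X Z (P O P' \<union> R)"
    if prems: "bf e q (Suc k) X Y P" "bf e q (Suc k) Y Z P'"
      and A: "A \<subseteq> X" "finite A" "card A \<le> q"
      and IH: "\<And>P P'. bf e q k X Y P \<Longrightarrow> bf e q k Y Z P' \<Longrightarrow> bf e q k X Z (P O P')"
    for X Z P P' A
  proof -
    obtain h where h: "h ` A \<subseteq> Y" "bf e q k X Y (P \<union> (\<lambda>a. (a, h a)) ` A)"
      using bf_move[OF prems(1) A] by blast
    obtain g where g: "g ` h ` A \<subseteq> Z" "bf e q k Y Z (P' \<union> (\<lambda>a. (a, g a)) ` h ` A)"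
      using bf_move[OF prems(2) h(1)] A card_image_le le_trans by (metis finite_imageI)
    let ?R = "(\<lambda>a. (a, g (h a))) ` A"
    have "bf e q k X Z (P O P' \<union> ?R)"
      by (rule bf_antimono[OF IH[OF h(2) g(2)]]) auto
    then show ?thesis using A(1) g(1) by (intro exI[of _ ?R]) auto
  qed
  show ?case
  proof (rule bf_SucI)
    fix A assume A: "A \<subseteq> X" "finite A \<and> card A \<le> q"
    then show "\<exists>R. R \<subseteq> X \<times> Z \<and> A \<subseteq> Domain R \<and> bf e q k X Z (P O P' \<union> R)"
      using one Suc by meson
  next
    fix A assume A: "A \<subseteq> Z" "finite A \<and> card A \<le> q"
    have IH: "bf e q k Z X (P O P')" if "bf e q k Z Y P" "bf e q k Y X P'" for P P'
      using bf_converse[OF Suc.IH[OF bf_converse[OF that(2)] bf_converse[OF that(1)]]]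
      by (simp add: converse_relcomp)
    obtain R where "R \<subseteq> Z \<times> X" "A \<subseteq> Domain R" "bf e q k Z X (P'\<inverse> O P\<inverse> \<union> R)"
      using one[OF bf_converse[OF Suc.prems(2)] bf_converse[OF Suc.prems(1)]] A IH by meson
    then show "\<exists>R. R \<subseteq> X \<times> Z \<and> A \<subseteq> Range R \<and> bf e q k X Z (P O P' \<union> R)"
      using bf_converse[of e q k Z X "P'\<inverse> O P\<inverse> \<union> R"]
      by (intro exI[of _ "R\<inverse>"]) (auto simp: converse_Un converse_relcomp)
  qed
qed

lemma bf_empty: "piso e P \<Longrightarrow> bf e q k {} {} P"
  by (induction k) (auto intro!: bf_SucI exI[of _ "{}"])

lemma bf_one_SucI:
  assumes "piso e P"
    and "\<And>x. x \<in> X \<Longrightarrow> \<exists>y\<in>Y. bf e 1 k X Y (insert (x, y) P)"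
    and "\<And>y. y \<in> Y \<Longrightarrow> \<exists>x\<in>X. bf e 1 k X Y (insert (x, y) P)"
  shows "bf e 1 (Suc k) X Y P"
proof -
  \<comment> \<open>The empty block is a legal move too; any answer to a single move settles it
    unless both carriers are empty.\<close>
  have base: "bf e 1 k X Y P"
  proof (cases "X = {} \<and> Y = {}")
    case True
    then show ?thesis using assms(1) bf_empty by auto
  next
    case False
    then obtain x y where "bf e 1 k X Y (insert (x, y) P)" using assms(2,3) by blast
    then show ?thesis using bf_antimono by blast
  qed
  have card1: "A = {} \<or> (\<exists>a. A = {a})" if "finite A \<and> card A \<le> 1" for A :: "'a set"
    using that by (metis One_nat_def card_1_singletonE card_0_eq le_Suc_eq le_zero_eq)
  show ?thesis
  proof (rule bf_SucI)
    fix A assume A: "A \<subseteq> X" "finite A \<and> card A \<le> 1"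
    then consider "A = {}" | a where "A = {a}" using card1 by blast
    then show "\<exists>R. R \<subseteq> X \<times> Y \<and> A \<subseteq> Domain R \<and> bf e 1 k X Y (P \<union> R)"
    proof cases
      case 1
      then show ?thesis using base by auto
    next
      case 2
      then obtain y where "y \<in> Y" "bf e 1 k X Y (insert (a, y) P)" using assms(2) A by blast
      then show ?thesis using 2 A by (intro exI[of _ "{(a, y)}"]) auto
    qed
  next
    fix A assume A: "A \<subseteq> Y" "finite A \<and> card A \<le> 1"
    then consider "A = {}" | a where "A = {a}" using card1 by blast
    then show "\<exists>R. R \<subseteq> X \<times> Y \<and> A \<subseteq> Range R \<and> bf e 1 k X Y (P \<union> R)"
    proof cases
      case 1
      then show ?thesis using base by auto
    next
      case 2
      then obtain x where "x \<in> X" "bf e 1 k X Y (insert (x, a) P)" using assms(3) A by blast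
      then show ?thesis using 2 A by (intro exI[of _ "{(x, a)}"]) auto
    qed
  qed
qed

text \<open>Relativisation: if \<open>j\<close> further rounds suffice to detect membership in the
  subsets, the subsets may serve as carriers at a price of \<open>j\<close> rounds. Pairs outside
  them are dropped from the answers; no pair can be half inside.\<close>

lemma bf_restrict:
  assumes "bf e q (k + j) X Y P" "X' \<subseteq> X" "Y' \<subseteq> Y"
    and "\<And>x y. x \<in> X \<Longrightarrow> y \<in> Y \<Longrightarrow> bf e q j X Y (insert (x, y) P) \<Longrightarrow> x \<in> X' \<longleftrightarrow> y \<in> Y'"
  shows "bf e q k X' Y' P"
  using assms(1,4)
proof (induction k arbitrary: P)
  case 0
  then show ?case using bf_imp_piso by auto
next
  case (Suc k)
  have step: "bf e q k X' Y' (P \<union> R \<inter> X' \<times> Y') \<and> (\<forall>(x, y)\<in>R. x \<in> X' \<longleftrightarrow> y \<in> Y')"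
    if R: "R \<subseteq> X \<times> Y" "bf e q (k + j) X Y (P \<union> R)" for R
  proof (intro conjI)
    have "bf e q (k + j) X Y (P \<union> R \<inter> X' \<times> Y')" by (rule bf_antimono[OF R(2)]) auto
    moreover have "x \<in> X' \<longleftrightarrow> y \<in> Y'"
      if "x \<in> X" "y \<in> Y" "bf e q j X Y (insert (x, y) (P \<union> R \<inter> X' \<times> Y'))" for x y
      by (rule Suc.prems(2)[OF that(1,2)]) (rule bf_antimono[OF that(3)], auto)
    ultimately show "bf e q k X' Y' (P \<union> R \<inter> X' \<times> Y')" by (rule Suc.IH)
    show "\<forall>(x, y)\<in>R. x \<in> X' \<longleftrightarrow> y \<in> Y'"
    proof clarify
      fix x y assume xy: "(x, y) \<in> R"
      show "x \<in> X' \<longleftrightarrow> y \<in> Y'"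
        by (rule Suc.prems(2)) (use xy R in \<open>auto intro: bf_mono\<close>)
    qed
  qed
  have "bf e q (Suc (k + j)) X Y P" using Suc.prems(1) by simp
  then show ?case
  proof (rule bf_Suc_transfer[OF _ assms(2,3) order_refl])
    fix R assume R: "R \<subseteq> X \<times> Y" "bf e q (k + j) X Y (P \<union> R)"
    show "\<exists>R'. R' \<subseteq> X' \<times> Y' \<and> X' \<inter> Domain R \<subseteq> Domain R' \<and> Y' \<inter> Range R \<subseteq> Range R' \<and>
        bf e q k X' Y' (P \<union> R')"
      using step[OF R] by (intro exI[of _ "R \<inter> X' \<times> Y'"]) blast
  qed
qed

text \<open>Both strategies run side by side. They never interact, so compatibility across the two
  parts has to be checked only for final positions.\<close>

lemma bf_Un:
  assumes "bf e q k X1 Y1 P1" "bf e q k X2 Y2 P2"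
    and "\<And>R1 R2. R1 \<subseteq> X1 \<times> Y1 \<Longrightarrow> R2 \<subseteq> X2 \<times> Y2 \<Longrightarrow>
      piso e (P1 \<union> R1) \<Longrightarrow> piso e (P2 \<union> R2) \<Longrightarrow> piso e (P1 \<union> R1 \<union> (P2 \<union> R2))"
  shows "bf e q k (X1 \<union> X2) (Y1 \<union> Y2) (P1 \<union> P2)"
  using assms
proof (induction k arbitrary: P1 P2)
  case 0
  then show ?case using "0.prems"(3)[of "{}" "{}"] by auto
next
  case (Suc k)
  have step: "bf e q k (X1 \<union> X2) (Y1 \<union> Y2) (P1 \<union> P2 \<union> (R1 \<union> R2))"
    if R: "R1 \<subseteq> X1 \<times> Y1" "bf e q k X1 Y1 (P1 \<union> R1)"
      "R2 \<subseteq> X2 \<times> Y2" "bf e q k X2 Y2 (P2 \<union> R2)" for R1 R2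
  proof -
    have "bf e q k (X1 \<union> X2) (Y1 \<union> Y2) ((P1 \<union> R1) \<union> (P2 \<union> R2))"
    proof (rule Suc.IH[OF R(2,4)])
      fix S1 S2
      assume "S1 \<subseteq> X1 \<times> Y1" "S2 \<subseteq> X2 \<times> Y2" "piso e (P1 \<union> R1 \<union> S1)" "piso e (P2 \<union> R2 \<union> S2)"
      then show "piso e (P1 \<union> R1 \<union> S1 \<union> (P2 \<union> R2 \<union> S2))"
        using Suc.prems(3)[of "R1 \<union> S1" "R2 \<union> S2"] R by (simp add: Un_assoc)
    qed
    then show ?thesis by (simp add: Un_ac)
  qed
  have card: "card (A \<inter> B) \<le> q" if "finite A \<and> card A \<le> q" for A B :: "'a set"
    using that by (meson card_mono inf_le1 le_trans)
  show ?case
  proof (rule bf_SucI)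
    fix A assume A: "A \<subseteq> X1 \<union> X2" "finite A \<and> card A \<le> q"
    obtain R1 where R1: "R1 \<subseteq> X1 \<times> Y1" "A \<inter> X1 \<subseteq> Domain R1" "bf e q k X1 Y1 (P1 \<union> R1)"
      using bf_SucE1[OF Suc.prems(1), of "A \<inter> X1"] A(2) card[OF A(2), of X1] by auto
    obtain R2 where R2: "R2 \<subseteq> X2 \<times> Y2" "A \<inter> X2 \<subseteq> Domain R2" "bf e q k X2 Y2 (P2 \<union> R2)"
      using bf_SucE1[OF Suc.prems(2), of "A \<inter> X2"] A(2) card[OF A(2), of X2] by auto
    show "\<exists>R. R \<subseteq> (X1 \<union> X2) \<times> (Y1 \<union> Y2) \<and> A \<subseteq> Domain R \<and>
        bf e q k (X1 \<union> X2) (Y1 \<union> Y2) (P1 \<union> P2 \<union> R)"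
      using step[OF R1(1,3) R2(1,3)] R1(1,2) R2(1,2) A(1) by (intro exI[of _ "R1 \<union> R2"]) blast
  next
    fix A assume A: "A \<subseteq> Y1 \<union> Y2" "finite A \<and> card A \<le> q"
    obtain R1 where R1: "R1 \<subseteq> X1 \<times> Y1" "A \<inter> Y1 \<subseteq> Range R1" "bf e q k X1 Y1 (P1 \<union> R1)"
      using bf_SucE2[OF Suc.prems(1), of "A \<inter> Y1"] A(2) card[OF A(2), of Y1] by auto
    obtain R2 where R2: "R2 \<subseteq> X2 \<times> Y2" "A \<inter> Y2 \<subseteq> Range R2" "bf e q k X2 Y2 (P2 \<union> R2)"
      using bf_SucE2[OF Suc.prems(2), of "A \<inter> Y2"] A(2) card[OF A(2), of Y2] by auto
    show "\<exists>R. R \<subseteq> (X1 \<union> X2) \<times> (Y1 \<union> Y2) \<and> A \<subseteq> Range R \<and>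
        bf e q k (X1 \<union> X2) (Y1 \<union> Y2) (P1 \<union> P2 \<union> R)"
      using step[OF R1(1,3) R2(1,3)] R1(1,2) R2(1,2) A(1) by (intro exI[of _ "R1 \<union> R2"]) blast
  qed
qed

text \<open>Matched elements are answered by their partners, so constants return to the carriers
  without loss of rounds. This undoes their removal by \<open>bf_restrict\<close>.\<close>

lemma bf_extend:
  assumes "bf e q k X Y P" "R \<subseteq> P"
  shows "bf e q k (X \<union> Domain R) (Y \<union> Range R) P"
  using assms
proof (induction k arbitrary: P)
  case (Suc k)
  have step: "bf e q k (X \<union> Domain R) (Y \<union> Range R) (P \<union> (S \<union> R))"
    if "bf e q k X Y (P \<union> S)" for S
    using Suc.IH[OF that] Suc.prems(2) by (simp add: Un_absorb2 Un_assoc[symmetric] le_supI1)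
  have card: "card (A \<inter> B) \<le> q" if "finite A \<and> card A \<le> q" for A B :: "'a set"
    using that by (meson card_mono inf_le1 le_trans)
  show ?case
  proof (rule bf_SucI)
    fix A assume A: "A \<subseteq> X \<union> Domain R" "finite A \<and> card A \<le> q"
    obtain S where S: "S \<subseteq> X \<times> Y" "A \<inter> X \<subseteq> Domain S" "bf e q k X Y (P \<union> S)"
      using bf_SucE1[OF Suc.prems(1), of "A \<inter> X"] A(2) card[OF A(2), of X] by auto
    show "\<exists>S. S \<subseteq> (X \<union> Domain R) \<times> (Y \<union> Range R) \<and> A \<subseteq> Domain S \<and>
        bf e q k (X \<union> Domain R) (Y \<union> Range R) (P \<union> S)"
      using step[OF S(3)] S(1,2) A(1)
      by (intro exI[of _ "S \<union> R"] conjI) (auto simp: Domain_Un_eq Range_Un_eq)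
  next
    fix A assume A: "A \<subseteq> Y \<union> Range R" "finite A \<and> card A \<le> q"
    obtain S where S: "S \<subseteq> X \<times> Y" "A \<inter> Y \<subseteq> Range S" "bf e q k X Y (P \<union> S)"
      using bf_SucE2[OF Suc.prems(1), of "A \<inter> Y"] A(2) card[OF A(2), of Y] by auto
    show "\<exists>S. S \<subseteq> (X \<union> Domain R) \<times> (Y \<union> Range R) \<and> A \<subseteq> Range S \<and>
        bf e q k (X \<union> Domain R) (Y \<union> Range R) (P \<union> S)"
      using step[OF S(3)] S(1,2) A(1)
      by (intro exI[of _ "S \<union> R"] conjI) (auto simp: Domain_Un_eq Range_Un_eq)
  qed
qed simp

lemma bf_converse_insert:
  assumes "bf e q k X Y (insert (x, y) P)"
  shows "bf e q k Y X (insert (y, x) (P\<inverse>))"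
proof -
  have "(insert (x, y) P)\<inverse> = insert (y, x) (P\<inverse>)" by auto
  then show ?thesis using bf_converse[OF assms] by simp
qed

lemma bf_refl: "P \<subseteq> Id \<Longrightarrow> bf e q k X X P"
proof (induction k arbitrary: P)
  case 0
  then show ?case unfolding bf.simps piso_def by blast
next
  case (Suc k)
  show ?case
  proof (rule bf_SucI)
    fix A assume "A \<subseteq> X"
    then show "\<exists>R. R \<subseteq> X \<times> X \<and> A \<subseteq> Domain R \<and> bf e q k X X (P \<union> R)"
      using Suc.IH[of "P \<union> Id_on A"] Suc.prems by (intro exI[of _ "Id_on A"]) auto
    show "\<exists>R. R \<subseteq> X \<times> X \<and> A \<subseteq> Range R \<and> bf e q k X X (P \<union> R)"
      using Suc.IH[of "P \<union> Id_on A"] Suc.prems \<open>A \<subseteq> X\<close>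
      by (intro exI[of _ "Id_on A"]) auto
  qed
qed

lemma bf_one_moves:
  assumes "bf e 1 (m + k) X Y P" "finite A" "A \<subseteq> X" "card A \<le> m"
  shows "\<exists>h. h ` A \<subseteq> Y \<and> bf e 1 k X Y (P \<union> (\<lambda>a. (a, h a)) ` A)"
  using assms(2,1,3,4)
proof (induction A arbitrary: m P rule: finite_induct)
  case empty
  then show ?case by (auto intro: bf_le_rounds)
next
  case (insert x A)
  then obtain m' where m: "m = Suc m'" by (cases m) auto
  obtain y where y: "y \<in> Y" "bf e 1 (m' + k) X Y (insert (x, y) P)"
    using bf_move_one[of e 1 "m' + k" X Y P x] insert.prems m by auto
  obtain h where h: "h ` A \<subseteq> Y" "bf e 1 k X Y (insert (x, y) P \<union> (\<lambda>a. (a, h a)) ` A)"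
    using insert.IH[OF y(2)] insert.prems insert.hyps m by auto
  have eq: "P \<union> (\<lambda>a. (a, (h(x := y)) a)) ` insert x A = insert (x, y) P \<union> (\<lambda>a. (a, h a)) ` A"
    using insert.hyps(2) by (auto simp: image_iff)
  show ?case
    using h y(1) insert.hyps(2) eq by (intro exI[of _ "h(x := y)"]) auto
qed

section \<open>Bounded distance and balls in the subgraph induced by a set\<close>

primrec near :: "('a \<Rightarrow> 'a \<Rightarrow> bool) \<Rightarrow> 'a set \<Rightarrow> nat \<Rightarrow> 'a \<Rightarrow> 'a \<Rightarrow> bool" where
  "near adj X 0 x y \<longleftrightarrow> x = y \<and> x \<in> X"
| "near adj X (Suc n) x y \<longleftrightarrow> near adj X n x y \<or> x \<in> X \<and> (\<exists>z. adj x z \<and> near adj X n z y)"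

lemma near_in: "near adj X n x y \<Longrightarrow> x \<in> X \<and> y \<in> X"
  by (induction n arbitrary: x) auto

lemma near_refl: "x \<in> X \<Longrightarrow> near adj X n x x"
  by (induction n) auto

lemma near_mono: "near adj X n x y \<Longrightarrow> n \<le> m \<Longrightarrow> X \<subseteq> X' \<Longrightarrow> near adj X' m x y"
proof (induction m arbitrary: n x)
  case 0
  then show ?case by auto
next
  case (Suc m)
  then show ?case by (cases n) (auto intro: near_refl)
qed

lemma near_trans: "near adj X n x y \<Longrightarrow> near adj X m y z \<Longrightarrow> near adj X (n + m) x z"
proof (induction n arbitrary: x)
  case (Suc n)
  then show ?case by auto
qed simp

lemma near_adj: "adj x y \<Longrightarrow> x \<in> X \<Longrightarrow> y \<in> X \<Longrightarrow> near adj X 1 x y"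
  by auto

lemma near_path: "near adj X n x y \<Longrightarrow> \<exists>A\<subseteq>X. finite A \<and> card A \<le> n + 1 \<and> near adj A n x y"
proof (induction n arbitrary: x)
  case 0
  then show ?case by (intro exI[of _ "{x}"]) auto
next
  case (Suc n)
  from Suc.prems consider "near adj X n x y" | z where "x \<in> X" "adj x z" "near adj X n z y" by auto
  then show ?case
  proof cases
    case 1
    with Suc.IH obtain A where "A \<subseteq> X" "finite A" "card A \<le> n + 1" "near adj A n x y" by blast
    then show ?thesis by (intro exI[of _ A]) auto
  next
    case 2
    with Suc.IH obtain A where "A \<subseteq> X" "finite A" "card A \<le> n + 1" "near adj A n z y" by blast
    then show ?thesis using 2 near_mono[of adj A n z y n "insert x A"]
      by (intro exI[of _ "insert x A"]) (auto simp: card_insert_if)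
  qed
qed

definition bal :: "('a \<Rightarrow> 'a \<Rightarrow> bool) \<Rightarrow> 'a set \<Rightarrow> nat \<Rightarrow> 'a set \<Rightarrow> 'a set" where
  "bal adj X n S = {y \<in> X. \<exists>x\<in>S. near adj X n x y}"

lemma bal_subset: "bal adj X n S \<subseteq> X"
  by (auto simp: bal_def)

lemma bal_mono: "n \<le> m \<Longrightarrow> S \<subseteq> S' \<Longrightarrow> bal adj X n S \<subseteq> bal adj X m S'"
  by (auto simp: bal_def intro: near_mono)

lemma bal_self: "S \<subseteq> X \<Longrightarrow> S \<subseteq> bal adj X n S"
  by (auto simp: bal_def intro: near_refl)

lemma bal_empty [simp]: "bal adj X n {} = {}"
  by (auto simp: bal_def)

lemma bal_insert: "bal adj X n (insert x S) = bal adj X n S \<union> bal adj X n {x}"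
  by (auto simp: bal_def)

text \<open>A walk of length \<open>n\<close> that starts within \<open>m\<close> of
  \<open>S\<close> cannot leave the ball of radius \<open>m + n\<close>. Short distances measured
  inside a large ball are therefore true distances.\<close>

lemma near_imp_near_bal:
  "near adj X n x y \<Longrightarrow> x \<in> bal adj X m S \<Longrightarrow> m + n \<le> k \<Longrightarrow> near adj (bal adj X k S) n x y"
proof (induction n arbitrary: x m)
  case 0
  then show ?case using bal_mono[of m k S S adj X] by auto
next
  case (Suc n)
  have xk: "x \<in> bal adj X k S" using Suc.prems bal_mono[of m k S S adj X] by auto
  from Suc.prems(1) consider "near adj X n x y" | z where "adj x z" "near adj X n z y" by auto
  then show ?case
  proof cases
    case 1
    then show ?thesis using Suc.IH[OF 1 Suc.prems(2)] Suc.prems(3) by simp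
  next
    case 2
    obtain s where s: "s \<in> S" "near adj X m s x" using Suc.prems(2) by (auto simp: bal_def)
    have "near adj X (m + 1) s z"
      using near_trans[OF s(2) near_adj[of adj, OF 2(1)]] near_in[OF s(2)] near_in[OF 2(2)] by simp
    then have "z \<in> bal adj X (m + 1) S" using s(1) near_in[OF 2(2)] unfolding bal_def by blast
    then show ?thesis using Suc.IH[OF 2(2), of "m + 1"] Suc.prems(3) 2(1) xk by auto
  qed
qed

section \<open>Distances and balls preserved by games on a graph with levels\<close>

locale lev_graph =
  fixes adj :: "'a \<Rightarrow> 'a \<Rightarrow> bool" and lev :: "'a \<Rightarrow> nat"
  assumes adj_sym: "adj x y \<Longrightarrow> adj y x"
begin

abbreviation nr where "nr \<equiv> near adj"
abbreviation ball where "ball \<equiv> bal adj"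
text \<open>The level of the first argument suffices, because \<open>piso\<close> also compares each
  element with itself.\<close>

abbreviation lab where "lab \<equiv> \<lambda>a b. (adj a b, lev a)"

lemma nr_sym: "nr X n x y \<Longrightarrow> nr X n y x"
proof (induction n arbitrary: x y)
  case (Suc n)
  from Suc.prems consider "nr X n x y" | z where "x \<in> X" "adj x z" "nr X n z y" by auto
  then show ?case
  proof cases
    case 1
    then show ?thesis using Suc.IH by auto
  next
    case 2
    then have "nr X (n + 1) y x"
      using near_trans[of adj X n y z 1 x] Suc.IH adj_sym near_in[of adj X n z y] by auto
    then show ?thesis by simp
  qed
qed auto

text \<open>The walk is followed vertex by vertex, which costs one round per step even with single
  moves.\<close>

lemma nr_bf:
  "bf lab q n X Y P \<Longrightarrow> q \<ge> 1 \<Longrightarrow> nr X n x y \<Longrightarrow> (x, x') \<in> P \<Longrightarrow> (y, y') \<in> P \<Longrightarrow>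
    x' \<in> Y \<Longrightarrow> nr Y n x' y'"
proof (induction n arbitrary: P x x')
  case 0
  then show ?case using pisoD[of lab P x x' y y'] by auto
next
  case (Suc n)
  from Suc.prems(3) consider "nr X n x y" | z where "adj x z" "nr X n z y" by auto
  then show ?case
  proof cases
    case 1
    have "nr Y n x' y'"
      by (rule Suc.IH[OF bf_Suc_imp[OF Suc.prems(1)] Suc.prems(2) 1 Suc.prems(4,5,6)])
    then show ?thesis by simp
  next
    case 2
    then obtain z' where z': "z' \<in> Y" "bf lab q n X Y (insert (z, z') P)"
      using bf_move_one[OF Suc.prems(1) _ Suc.prems(2)] near_in[of adj X n z y] by blast
    have "adj x' z'"
      using pisoD(2)[OF bf_imp_piso[OF z'(2)], of x x' z z'] Suc.prems(4) 2(1) by auto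
    moreover have "nr Y n z' y'"
      by (rule Suc.IH[OF z'(2) Suc.prems(2) 2(2) _ _ z'(1)]) (use Suc.prems(5) in auto)
    ultimately show ?thesis using Suc.prems(6) by auto
  qed
qed

lemma nr_map:
  "nr A n x y \<Longrightarrow> piso lab P \<Longrightarrow> (\<And>a. a \<in> A \<Longrightarrow> (a, h a) \<in> P) \<Longrightarrow> h ` A \<subseteq> Y \<Longrightarrow> nr Y n (h x) (h y)"
proof (induction n arbitrary: x)
  case 0
  then show ?case by auto
next
  case (Suc n)
  from Suc.prems(1) consider "nr A n x y" | z where "x \<in> A" "adj x z" "nr A n z y" by auto
  then show ?case
  proof cases
    case 1
    then show ?thesis using Suc.IH[OF 1 Suc.prems(2,3,4)] by auto
  next
    case 2
    have "z \<in> A" using near_in[OF 2(3)] by simp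
    then have "adj (h x) (h z)"
      using pisoD(2)[OF Suc.prems(2) Suc.prems(3)[OF 2(1)] Suc.prems(3)[of z]] 2(2) by auto
    then show ?thesis using Suc.IH[OF 2(3) Suc.prems(2,3,4)] 2(1) Suc.prems(4) by auto
  qed
qed

text \<open>All vertices of the walk are played in one block. One round thus settles a distance of
  any size that fits into the block, so the radius never influences the number of rounds.\<close>

lemma nr_bf_block:
  assumes "bf lab q 1 X Y P" "n + 1 \<le> q" "nr X n x y" "(x, x') \<in> P" "(y, y') \<in> P"
  shows "nr Y n x' y'"
proof -
  obtain A where A: "A \<subseteq> X" "finite A" "card A \<le> n + 1" "nr A n x y"
    using near_path[OF assms(3)] by blast
  obtain h where h: "h ` A \<subseteq> Y" "bf lab q 0 X Y (P \<union> (\<lambda>a. (a, h a)) ` A)"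
    using bf_move[of lab q 0 X Y P A] assms(1,2) A by auto
  have p: "piso lab (P \<union> (\<lambda>a. (a, h a)) ` A)" using h(2) by simp
  have "nr Y n (h x) (h y)" by (rule nr_map[OF A(4) p _ h(1)]) auto
  moreover have "h x = x'" "h y = y'"
    using pisoD(1)[OF p, of x x' x "h x"] pisoD(1)[OF p, of y y' y "h y"] assms(4,5)
      near_in[OF A(4)] by auto
  ultimately show ?thesis by simp
qed

text \<open>Membership in a ball around matched centres is detected by \<open>r\<close> single
  rounds, so \<open>bf_restrict\<close> applies. The condition \<open>t + r \<le> s\<close> keeps
  the walks from the centres inside the carriers.\<close>

lemma bf_ball:
  assumes bf: "bf lab q (n + r) (ball X s S) (ball Y s T) P" and q: "q \<ge> 1" and R: "R \<subseteq> P"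
    and DR: "Domain R \<subseteq> ball X t S" "Range R \<subseteq> ball Y t T" and le: "t + r \<le> s"
  shows "bf lab q n (ball X r (Domain R)) (ball Y r (Range R)) P"
proof (rule bf_restrict[OF bf])
  have sub: "ball X r A \<subseteq> ball X s S" if "A \<subseteq> ball X t S" for X A S
  proof
    fix y assume "y \<in> ball X r A"
    then obtain a where "a \<in> A" "nr X r a y" unfolding bal_def by blast
    then have "nr (ball X s S) r a y" using near_imp_near_bal[of adj X r a y t S s] that le by blast
    then show "y \<in> ball X s S" by (simp add: near_in)
  qed
  show "ball X r (Domain R) \<subseteq> ball X s S" "ball Y r (Range R) \<subseteq> ball Y s T"
    using sub DR by auto
  have one: "y \<in> ball Y r (Range R)"
    if asm: "bf lab q r (ball X s S) (ball Y s T) (insert (x, y) P)" "x \<in> ball X r (Domain R)"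
      "Domain R \<subseteq> ball X t S" "Range R \<subseteq> ball Y t T" "R \<subseteq> P" for X Y S T x y R P
  proof -
    obtain a b where ab: "(a, b) \<in> R" "nr X r a x" using asm(2) by (auto simp: bal_def)
    have "nr (ball X s S) r a x" by (rule near_imp_near_bal[OF ab(2) _ le]) (use ab asm in auto)
    moreover have "b \<in> ball Y s T" using ab(1) asm(4) bal_mono[of t s T T adj Y] le by auto
    ultimately have "nr (ball Y s T) r b y"
      using nr_bf[OF asm(1) q, of a x b y] ab(1) asm(5) by auto
    then have "nr Y r b y" 
      using near_mono[of adj "ball Y s T" r b y r Y] bal_subset[of adj Y s T] by simp
    then show ?thesis using ab(1) near_in[of adj Y r b y] unfolding bal_def by blast
  qed
  fix x y
  assume xy: "bf lab q r (ball X s S) (ball Y s T) (insert (x, y) P)"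
  show "x \<in> ball X r (Domain R) \<longleftrightarrow> y \<in> ball Y r (Range R)"
  proof
    assume "x \<in> ball X r (Domain R)"
    then show "y \<in> ball Y r (Range R)" using one[OF xy _ DR R] by simp
  next
    assume "y \<in> ball Y r (Range R)"
    then show "x \<in> ball X r (Domain R)"
      using one[of Y T X S y x "P\<inverse>" "R\<inverse>"] DR R bf_converse_insert[OF xy] by simp
  qed
qed

end

section \<open>Locality\<close>

text \<open>
  Points of the next step with radius \<open>r\<close> are apart if their distance exceeds \<open>T = 2 r + 1\<close>. Points at
  distance more than \<open>2 T = 4 r + 2\<close> from each other are pairwise apart and each centre is within
  \<open>T\<close> of at most one of them, and a move is near if it is within \<open>3 T\<close> of an earlier one. Then all
  relevant balls have radius at most \<open>3 T + r = 7 r + 3\<close>.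
\<close>

primrec rad :: "nat \<Rightarrow> nat" where
  "rad 0 = 0"
| "rad (Suc j) = 7 * rad j + 3"

primrec rnd :: "nat \<Rightarrow> nat \<Rightarrow> nat" where
  "rnd Q 0 = 0"
| "rnd Q (Suc j) = rnd Q j + Q + 2 + rad (Suc j)"

declare near.simps(2) [simp del]

lemma near_from_center:
  "near adj X n s x \<Longrightarrow> s \<in> S \<Longrightarrow> n \<le> k \<Longrightarrow> near adj (bal adj X k S) n s x"
  using near_imp_near_bal[of adj X n s x 0 S k] near_in[of adj X n s x]
  by (auto simp: bal_def)

lemma near_balD: "near adj (bal adj X k S) n x y \<Longrightarrow> near adj X n x y"
  using near_mono[of adj "bal adj X k S" n x y n X] bal_subset[of adj X k S] by simp

context lev_graph
begin

text \<open>This takes the place of agreement on Gaifman's basic local sentences: scattered points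
  of given local types can be found on the other side. A single map \<open>h\<close> serves all
  radii. Only one direction is stated, the other is \<open>glob\<close> for the converse.\<close>

definition glob :: "nat \<Rightarrow> 'a set \<Rightarrow> 'a set \<Rightarrow> 'a rel \<Rightarrow> bool" where
  "glob Q X Y P \<longleftrightarrow> (\<forall>A\<subseteq>X. finite A \<longrightarrow> card A \<le> Q \<longrightarrow> (\<exists>h. h ` A \<subseteq> Y \<and>
    (\<forall>a\<in>A. \<forall>j<Q. bf lab 1 (rnd Q j) (ball X (rad j) {a}) (ball Y (rad j) {h a}) (insert (a, h a) P)) \<and>
    (\<forall>a\<in>A. \<forall>a'\<in>A. \<forall>j<Q. nr Y (4 * rad j + 2) (h a) (h a') \<longrightarrow> nr X (4 * rad j + 2) a a')))"

text \<open>The invariant with \<open>j\<close> moves left, \<open>R\<close> being the moves made so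
  far. The bound on \<open>card R + j\<close> guarantees that a scattered set with at most
  \<open>card R + 1\<close> points is small enough for \<open>glob\<close>.\<close>

definition locinv :: "nat \<Rightarrow> nat \<Rightarrow> 'a set \<Rightarrow> 'a set \<Rightarrow> 'a rel \<Rightarrow> 'a rel \<Rightarrow> bool" where
  "locinv Q j X Y P R \<longleftrightarrow> R \<subseteq> X \<times> Y \<and> finite R \<and> card R + j \<le> Q \<and>
    bf lab 1 (rnd Q j) (ball X (rad j) (Domain R)) (ball Y (rad j) (Range R)) (P \<union> R)"

text \<open>Equal or adjacent points of the two balls would join \<open>x\<close> to a centre in at
  most \<open>r + 1 + r\<close> steps.\<close>

lemma ball_far_nonadj:
  assumes "x \<notin> ball X (2 * r + 1) A" "a \<in> ball X r A" "c \<in> ball X r {x}"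
  shows "a \<noteq> c" "\<not> adj a c"
proof -
  obtain s where s: "s \<in> A" "nr X r s a" using assms(2) unfolding bal_def by blast
  have c: "nr X r c x" using assms(3) nr_sym unfolding bal_def by blast
  have aX: "a \<in> X" and cX: "c \<in> X" and xX: "x \<in> X" using near_in[OF s(2)] near_in[OF c] by auto
  have far: "\<not> nr X n s x" if "n \<le> 2 * r + 1" for n
    using assms(1) s(1) xX near_mono[of adj X n s x "2 * r + 1" X] that unfolding bal_def by blast
  show "a \<noteq> c"
  proof
    assume "a = c"
    then show False using near_trans[OF s(2), of r x] c far[of "r + r"] by simp
  qed
  show "\<not> adj a c"
  proof
    assume "adj a c"
    then have "nr X (r + 1) s c" using near_trans[OF s(2) near_adj[of adj a c X]] aX cX by simp
    then show False using near_trans[OF _ c, of "r + 1" s] far[of "r + 1 + r"] by simp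
  qed
qed

text \<open>Balls of radius \<open>r\<close> around distant centres neither meet nor touch, so on
  both sides the two local strategies can be combined by \<open>bf_Un\<close>.\<close>

lemma bf_far_insert:
  assumes R: "R \<subseteq> X \<times> Y" and xy: "x \<in> X" "y \<in> Y"
    and bf1: "bf lab q n (ball X r (Domain R)) (ball Y r (Range R)) (P \<union> R)"
    and bf2: "bf lab q n (ball X r {x}) (ball Y r {y}) (insert (x, y) P)"
    and far: "x \<notin> ball X (2 * r + 1) (Domain R)" "y \<notin> ball Y (2 * r + 1) (Range R)"
  shows "bf lab q n (ball X r (Domain (insert (x, y) R))) (ball Y r (Range (insert (x, y) R)))
    (P \<union> insert (x, y) R)"
proof -
  have "bf lab q n (ball X r (Domain R) \<union> ball X r {x}) (ball Y r (Range R) \<union> ball Y r {y})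
      ((P \<union> R) \<union> insert (x, y) P)"
  proof (rule bf_Un[OF bf1 bf2])
    fix R1 R2
    assume R1: "R1 \<subseteq> ball X r (Domain R) \<times> ball Y r (Range R)"
      and R2: "R2 \<subseteq> ball X r {x} \<times> ball Y r {y}"
      and p1: "piso lab (P \<union> R \<union> R1)" and p2: "piso lab (insert (x, y) P \<union> R2)"
    show "piso lab (P \<union> R \<union> R1 \<union> (insert (x, y) P \<union> R2))"
    proof (rule piso_Un[OF p1 p2])
      fix a b c d
      assume ab: "(a, b) \<in> P \<union> R \<union> R1" and cd: "(c, d) \<in> insert (x, y) P \<union> R2"
      consider "(a, b) \<in> P" | "(c, d) \<in> P" | "(a, b) \<in> R \<union> R1" "(c, d) \<in> insert (x, y) R2"
        using ab cd by blast
      then show "(a = c \<longleftrightarrow> b = d) \<and> lab a c = lab b d \<and> lab c a = lab d b"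
      proof cases
        case 1
        then have ab': "(a, b) \<in> insert (x, y) P \<union> R2" by simp
        show ?thesis using pisoD[OF p2 ab' cd] pisoD[OF p2 cd ab'] by auto
      next
        case 2
        then have cd': "(c, d) \<in> P \<union> R \<union> R1" by simp
        show ?thesis using pisoD[OF p1 ab cd'] pisoD[OF p1 cd' ab] by auto
      next
        case 3
        have "Domain R \<subseteq> X" "Range R \<subseteq> Y" using R by auto
        then have "Domain R \<subseteq> ball X r (Domain R)" "Range R \<subseteq> ball Y r (Range R)"
          using bal_self by metis+
        then have a: "a \<in> ball X r (Domain R)" "b \<in> ball Y r (Range R)" using 3(1) R1 by auto
        have c: "c \<in> ball X r {x}" "d \<in> ball Y r {y}"
          using 3(2) R2 bal_self[of "{x}" X adj r] bal_self[of "{y}" Y adj r] xy by auto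
        have "a \<noteq> c" "b \<noteq> d" "\<not> adj a c" "\<not> adj b d"
          using ball_far_nonadj[OF far(1) a(1) c(1)] ball_far_nonadj[OF far(2) a(2) c(2)] by auto
        moreover have "\<not> adj c a" "\<not> adj d b" using adj_sym calculation by blast+
        moreover have "lev a = lev b" "lev c = lev d"
          using pisoD[OF p1 ab ab] pisoD[OF p2 cd cd] by auto
        ultimately show ?thesis by simp
      qed
    qed
  qed
  moreover have "(P \<union> R) \<union> insert (x, y) P = P \<union> insert (x, y) R" by blast
  ultimately show ?thesis
    using bal_insert[of adj X r x "Domain R"] bal_insert[of adj Y r y "Range R"] by simp
qed

text \<open>
  A spoiler's move \<open>x\<close> far from all earlier ones is answered by counting: take a largest scattered set
  of points near the earlier moves that have the same local game type as \<open>x\<close>. Together with \<open>x\<close> it is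
  mirrored on the other side, where by maximality it does not fit near the earlier moves.
\<close>

lemma gaifman_step:
  assumes inv: "locinv Q (Suc j) X Y P R" and glob: "glob Q X Y P" and x: "x \<in> X"
  shows "\<exists>y\<in>Y. locinv Q j X Y P (insert (x, y) R)"
proof -
  define r where "r = rad j"
  define s where "s = 7 * r + 3"
  let ?A = "Domain R" and ?B = "Range R"
  let ?X = "ball X s ?A" and ?Y = "ball Y s ?B"
  have R: "R \<subseteq> X \<times> Y" "finite R" "card R + Suc j \<le> Q"
    and HB: "bf lab 1 (rnd Q j + Q + 2 + s) ?X ?Y (P \<union> R)"
    using inv unfolding locinv_def s_def r_def by auto
  have AX: "?A \<subseteq> X" and BY: "?B \<subseteq> Y" using R(1) by auto
  have jQ: "j < Q" using R(3) by simp
  have finA: "finite ?A" "card ?A \<le> card R" using R(2) by (auto simp: Domain_fst intro: card_image_le)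
  have reduce: "\<exists>y\<in>Y. locinv Q j X Y P (insert (x, y) R)"
    if "y \<in> Y" "bf lab 1 (rnd Q j) (ball X r (Domain (insert (x, y) R)))
      (ball Y r (Range (insert (x, y) R))) (P \<union> insert (x, y) R)" for y
  proof -
    have "card (insert (x, y) R) \<le> Suc (card R)" by (simp add: R(2) card_insert_if)
    then show ?thesis using that R x unfolding locinv_def r_def by (intro bexI[of _ y]) auto
  qed
  show ?thesis
  proof (cases "x \<in> ball X (6 * r + 3) ?A")
    case True
    then have xX: "x \<in> ?X" using bal_mono[of "6 * r + 3" s ?A ?A adj X] by (auto simp: s_def)
    have HB': "bf lab 1 (Suc (rnd Q j + Q + 1 + s)) ?X ?Y (P \<union> R)" using HB by simp
    obtain y where y: "y \<in> ?Y" "bf lab 1 (rnd Q j + Q + 1 + s) ?X ?Y (insert (x, y) (P \<union> R))"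
      using bf_move_one[OF HB' xX] by blast
    have yY: "y \<in> Y" by (rule subsetD[OF bal_subset y(1)])
    obtain a b where ab: "(a, b) \<in> R" "nr X (6 * r + 3) a x" using True unfolding bal_def by blast
    have "nr ?X (6 * r + 3) a x"
      by (rule near_from_center[OF ab(2)]) (use ab(1) in \<open>auto simp: s_def\<close>)
    moreover have "b \<in> ?Y" using ab(1) bal_self[OF BY] by blast
    ultimately have "nr ?Y (6 * r + 3) b y"
      using nr_bf[OF bf_le_rounds[OF y(2), of "6 * r + 3"], of a x b y] ab(1) by (simp add: s_def)
    then have "nr Y (6 * r + 3) b y" by (rule near_balD)
    then have yT: "y \<in> ball Y (6 * r + 3) ?B" using ab(1) yY unfolding bal_def by blast
    have "bf lab 1 (rnd Q j) (ball X r (Domain (insert (x, y) R)))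
      (ball Y r (Range (insert (x, y) R))) (P \<union> insert (x, y) R)"
    proof (rule bf_ball)
      show "bf lab 1 (rnd Q j + r) ?X ?Y (P \<union> insert (x, y) R)"
        using bf_le_rounds[OF y(2), of "rnd Q j + r"] by (simp add: s_def)
      show "Domain (insert (x, y) R) \<subseteq> ball X (6 * r + 3) ?A"
        using True bal_self[OF AX] by auto
      show "Range (insert (x, y) R) \<subseteq> ball Y (6 * r + 3) ?B"
        using yT bal_self[OF BY] by auto
    qed (auto simp: s_def)
    then show ?thesis using reduce yY by blast
  next
    case False
    define T where "T = 2 * r + 1"
    \<comment> \<open>The local type of \<open>x\<close>, expressed by a game inside
      \<open>X\<close>: the ball of \<open>u\<close> is compared with the ball of \<open>x\<close>,
      the constants being matched with themselves.\<close>
    define \<tau> where "\<tau> u \<longleftrightarrow>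
      bf lab 1 (rnd Q j) (ball X r {x}) (ball X r {u}) (insert (x, u) (Id_on (Domain P)))" for u
    define scat where "scat S \<longleftrightarrow> (\<forall>u\<in>S. \<forall>v\<in>S. u \<noteq> v \<longrightarrow> \<not> nr X (4 * r + 2) u v)" for S
    define good where "good S \<longleftrightarrow> S \<subseteq> ball X T ?A \<and> (\<forall>u\<in>S. \<tau> u) \<and> scat S" for S
    have bound: "finite S \<and> card S \<le> card ?A" if "good S" for S
    proof -
      have "\<forall>u\<in>S. \<exists>a\<in>?A. nr X T a u" using that unfolding good_def bal_def by blast
      then obtain f where f: "\<And>u. u \<in> S \<Longrightarrow> f u \<in> ?A \<and> nr X T (f u) u" by metis
      have "inj_on f S"
      proof (rule inj_onI, rule ccontr)
        fix u v assume uv: "u \<in> S" "v \<in> S" "f u = f v" "u \<noteq> v"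
        have "nr X (T + T) u v" using near_trans[OF nr_sym, of X T "f u" u T v] f uv by metis
        then show False using that uv unfolding good_def scat_def T_def by (simp add: algebra_simps)
      qed
      then show ?thesis using f finA(1) inj_on_finite[of f S ?A] card_inj_on_le[of f S ?A] by auto
    qed
    have good0: "good {}" unfolding good_def scat_def by simp
    have "\<forall>S. good S \<longrightarrow> card S < Suc (card ?A)" using bound by (simp add: less_Suc_eq_le)
    then obtain S where S: "good S" and max: "\<And>S'. good S' \<Longrightarrow> card S' \<le> card S"
      using ex_has_greatest_nat[of good, OF good0] by blast
    have Sfin: "finite S" "card S \<le> card R" using bound[OF S] finA by auto
    have SX: "S \<subseteq> X" using S bal_subset[of adj X T ?A] unfolding good_def by blast
    \<comment> \<open>Otherwise \<open>x\<close> would be within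
      \<open>T + (4 * r + 2) = 6 * r + 3\<close> of an earlier move, which is the near case.\<close>
    have far: "\<not> nr X (4 * r + 2) u x" if uS: "u \<in> S" for u
    proof
      assume ux: "nr X (4 * r + 2) u x"
      obtain a where a: "a \<in> ?A" "nr X T a u" using S uS unfolding good_def bal_def by blast
      have eq: "T + (4 * r + 2) = 6 * r + 3" by (simp add: T_def)
      have "nr X (6 * r + 3) a x" using near_trans[OF a(2) ux] by (simp only: eq)
      then show False using False a(1) x unfolding bal_def by blast
    qed
    have xS: "x \<notin> S" using far near_refl[OF x] by blast
    define S' where "S' = insert x S"
    have S': "S' \<subseteq> X" "finite S'" "card S' = Suc (card S)" "card S' \<le> Q"
      using SX x Sfin xS R(3) by (auto simp: S'_def)
    have scat': "scat S'"
      using S far nr_sym unfolding good_def scat_def S'_def by blast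
    have \<tau>': "\<tau> u" if "u \<in> S'" for u
    proof (cases "u = x")
      case True
      show ?thesis unfolding \<tau>_def True by (rule bf_mono[OF bf_refl[of Id]]) auto
    next
      case False
      then show ?thesis using S that unfolding good_def S'_def by blast
    qed
    obtain h where hh: "h ` S' \<subseteq> Y \<and>
      (\<forall>a\<in>S'. \<forall>j<Q. bf lab 1 (rnd Q j) (ball X (rad j) {a}) (ball Y (rad j) {h a}) (insert (a, h a) P)) \<and>
      (\<forall>a\<in>S'. \<forall>a'\<in>S'. \<forall>j<Q. nr Y (4 * rad j + 2) (h a) (h a') \<longrightarrow> nr X (4 * rad j + 2) a a')"
      using glob[unfolded glob_def, rule_format, OF S'(1,2,4)] by (elim exE)
    have h: "h ` S' \<subseteq> Y" by (rule conjunct1[OF hh])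
    have hloc: "bf lab 1 (rnd Q j) (ball X r {a}) (ball Y r {h a}) (insert (a, h a) P)" if "a \<in> S'" for a
      using hh[THEN conjunct2, THEN conjunct1] that jQ unfolding r_def by simp
    have hsep: "nr X (4 * r + 2) a a'" if "a \<in> S'" "a' \<in> S'" "nr Y (4 * r + 2) (h a) (h a')" for a a'
      using hh[THEN conjunct2, THEN conjunct2] that jQ unfolding r_def by simp
    have hinj: "inj_on h S'"
    proof (rule inj_onI, rule ccontr)
      fix u v assume uv: "u \<in> S'" "v \<in> S'" "h u = h v" "u \<noteq> v"
      then have "nr Y (4 * r + 2) (h u) (h v)" using near_refl[of "h u" Y] h by auto
      then show False using hsep uv scat' unfolding scat_def by blast
    qed
    \<comment> \<open>If all images were near the earlier moves, playing them back into
      \<open>X\<close> would give a good set with more elements than the largest one,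
      \<open>S\<close>.\<close>
    have "\<exists>u\<in>S'. h u \<notin> ball Y T ?B"
    proof (rule ccontr)
      assume "\<not> ?thesis"
      then have hT: "\<And>u. u \<in> S' \<Longrightarrow> h u \<in> ball Y T ?B" by blast
      have sub: "h ` S' \<subseteq> ?Y" using hT bal_mono[of T s ?B ?B adj Y] by (auto simp: T_def s_def)
      have cardh: "card (h ` S') \<le> Q" using card_image_le[OF S'(2), of h] S'(4) by simp
      \<comment> \<open>The summand \<open>Q\<close> of \<open>rnd\<close> pays for playing the at
        most \<open>Q\<close> images back one by one; the remaining rounds still compare distances
        and restrict to the small balls.\<close>
      have "bf lab 1 (Q + (rnd Q j + 2 + s)) ?Y ?X ((P \<union> R)\<inverse>)"
        by (rule bf_le_rounds[OF bf_converse[OF HB]]) simp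
      from bf_one_moves[OF this finite_imageI[OF S'(2)] sub cardh]
      obtain g where gg: "g ` h ` S' \<subseteq> ?X \<and>
        bf lab 1 (rnd Q j + 2 + s) ?Y ?X ((P \<union> R)\<inverse> \<union> (\<lambda>a. (a, g a)) ` h ` S')" by (elim exE)
      note g = conjunct1[OF gg] conjunct2[OF gg]
      let ?P = "(P \<union> R)\<inverse> \<union> (\<lambda>a. (a, g a)) ` h ` S'"
      have p: "piso lab ?P" by (rule bf_imp_piso[OF g(2)])
      define k where "k u = g (h u)" for u
      have kP: "(h u, k u) \<in> ?P" if "u \<in> S'" for u using that by (auto simp: k_def)
      have kinj: "inj_on k S'"
        using pisoD(1)[OF p kP kP] hinj unfolding inj_on_def by metis
      have kX: "k u \<in> ?X" if "u \<in> S'" for u using g(1) that by (auto simp: k_def)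
      have kT: "k u \<in> ball X T ?A" if u: "u \<in> S'" for u
      proof -
        obtain a b where ab: "(a, b) \<in> R" "nr Y T b (h u)"
          using hT[OF u] unfolding bal_def by blast
        have "nr ?Y T b (h u)"
          by (rule near_from_center[OF ab(2)]) (use ab(1) in \<open>auto simp: T_def s_def\<close>)
        moreover have "a \<in> ?X" using ab(1) bal_self[OF AX] by blast
        ultimately have "nr ?X T a (k u)"
          using nr_bf[OF bf_le_rounds[OF g(2), of T], of b "h u" a "k u"] ab(1) kP[OF u]
          by (simp add: T_def s_def)
        then have "nr X T a (k u)" by (rule near_balD)
        then show ?thesis using ab(1) near_in[of adj X T a "k u"] unfolding bal_def by blast
      qed
      have "good (k ` S')"
        unfolding good_def
      proof (intro conjI ballI)
        show "k ` S' \<subseteq> ball X T ?A" using kT by blast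
        show "scat (k ` S')"
          unfolding scat_def
        proof (intro ballI impI notI)
          fix v v' assume "v \<in> k ` S'" "v' \<in> k ` S'" and ne: "v \<noteq> v'"
            and nv: "nr X (4 * r + 2) v v'"
          then obtain u u' where u: "u \<in> S'" "u' \<in> S'" "v = k u" "v' = k u'" by blast
          have "nr ?X (4 * r + 2) v v'"
            by (rule near_imp_near_bal[OF nv, of T]) (use kT u in \<open>auto simp: T_def s_def\<close>)
          moreover have "(v, h u) \<in> ?P\<inverse>" "(v', h u') \<in> ?P\<inverse>"
            unfolding u(3,4) converse_iff by (rule kP[OF u(1)], rule kP[OF u(2)])
          moreover have "h u \<in> ?Y" by (rule subsetD[OF sub imageI[OF u(1)]])
          ultimately have "nr ?Y (4 * r + 2) (h u) (h u')"
            using nr_bf[OF bf_le_rounds[OF bf_converse[OF g(2)], of "4 * r + 2"], of v v' "h u" "h u'"]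
            by (simp add: s_def)
          then have "nr Y (4 * r + 2) (h u) (h u')" by (rule near_balD)
          then have "nr X (4 * r + 2) u u'" by (rule hsep[OF u(1,2)])
          moreover have "u \<noteq> u'" using ne u(3,4) by metis
          ultimately show False using scat'[unfolded scat_def, rule_format, OF u(1,2)] by simp
        qed
        fix v assume "v \<in> k ` S'"
        then obtain u where u: "u \<in> S'" "v = k u" by blast
        have 1: "bf lab 1 (rnd Q j) (ball Y r {h u}) (ball X r {v}) (insert (h u, v) (P\<inverse>))"
        proof -
          have "bf lab 1 (rnd Q j) (ball Y r (Domain {(h u, v)})) (ball X r (Range {(h u, v)})) ?P"
          proof (rule bf_ball)
            show "bf lab 1 (rnd Q j + r) ?Y ?X ?P"
              using bf_le_rounds[OF g(2), of "rnd Q j + r"] by (simp add: s_def)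
            show "Domain {(h u, v)} \<subseteq> ball Y T ?B" "Range {(h u, v)} \<subseteq> ball X T ?A"
              using u hT kT by auto
            show "{(h u, v)} \<subseteq> ?P" using kP u by blast
          qed (auto simp: T_def s_def)
          then have "bf lab 1 (rnd Q j) (ball Y r {h u}) (ball X r {v}) ?P" by simp
          moreover have "insert (h u, v) (P\<inverse>) \<subseteq> ?P" using kP[OF u(1)] u(2) by blast
          ultimately show ?thesis by (rule bf_antimono)
        qed
        \<comment> \<open>Games are chained from \<open>x\<close> to \<open>u\<close>, to its image
          \<open>h u\<close>, and back to \<open>v\<close>. Constants go through \<open>P\<close>
          and its converse and so return to themselves.\<close>
        have "bf lab 1 (rnd Q j) (ball X r {x}) (ball X r {v})
          (insert (x, u) (Id_on (Domain P)) O (insert (u, h u) P O insert (h u, v) (P\<inverse>)))"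
          by (rule bf_relcomp[OF \<tau>'[OF u(1), unfolded \<tau>_def] bf_relcomp[OF hloc[OF u(1)] 1]])
        then show "\<tau> v" unfolding \<tau>_def by (rule bf_mono) auto
      qed
      then show False using max card_image[OF kinj] S'(3) by fastforce
    qed
    then obtain u where u: "u \<in> S'" "h u \<notin> ball Y T ?B" by blast
    define y where "y = h u"
    have yY: "y \<in> Y" using u h by (auto simp: y_def)
    have bf2: "bf lab 1 (rnd Q j) (ball X r {x}) (ball Y r {y}) (insert (x, y) P)"
    proof -
      have "bf lab 1 (rnd Q j) (ball X r {x}) (ball Y r {y})
          (insert (x, u) (Id_on (Domain P)) O insert (u, y) P)"
        using bf_relcomp[OF \<tau>'[OF u(1), unfolded \<tau>_def] hloc[OF u(1)]] by (simp add: y_def)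
      then show ?thesis by (rule bf_mono) auto
    qed
    have bf1: "bf lab 1 (rnd Q j) (ball X r ?A) (ball Y r ?B) (P \<union> R)"
    proof (rule bf_ball)
      show "bf lab 1 (rnd Q j + r) ?X ?Y (P \<union> R)"
        using bf_le_rounds[OF HB, of "rnd Q j + r"] by (simp add: s_def)
      show "?A \<subseteq> ball X 0 ?A" "?B \<subseteq> ball Y 0 ?B" using bal_self[OF AX] bal_self[OF BY] .
    qed (auto simp: s_def)
    have "x \<notin> ball X (2 * r + 1) ?A"
      using False bal_mono[of "2 * r + 1" "6 * r + 3" ?A ?A adj X] by auto
    then show ?thesis
      using bf_far_insert[OF R(1) x yY bf1 bf2] u(2) reduce[OF yY] unfolding y_def T_def by blast
  qed
qed

lemma locinv_converse: "locinv Q j X Y P R \<Longrightarrow> locinv Q j Y X (P\<inverse>) (R\<inverse>)"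
  unfolding locinv_def using bf_converse[of lab 1 "rnd Q j" _ _ "P \<union> R"]
  by (auto simp: converse_Un card_inverse)

theorem gaifman:
  assumes "glob Q X Y P" "glob Q Y X (P\<inverse>)" "piso lab P"
  shows "bf lab 1 Q X Y P"
proof -
  have main: "locinv Q j X Y P R \<Longrightarrow> bf lab 1 j X Y (P \<union> R)" for j R
  proof (induction j arbitrary: R)
    case 0
    then show ?case by (auto simp: locinv_def)
  next
    case (Suc j)
    have p: "piso lab (P \<union> R)" using Suc.prems bf_imp_piso unfolding locinv_def by blast
    show ?case
    proof (rule bf_one_SucI[OF p])
      fix x assume "x \<in> X"
      then obtain y where "y \<in> Y" "locinv Q j X Y P (insert (x, y) R)"
        using gaifman_step[OF Suc.prems assms(1)] by blast
      then show "\<exists>y\<in>Y. bf lab 1 j X Y (insert (x, y) (P \<union> R))" using Suc.IH by fastforce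
    next
      fix y assume "y \<in> Y"
      then obtain x where x: "x \<in> X" "locinv Q j Y X (P\<inverse>) (insert (y, x) (R\<inverse>))"
        using gaifman_step[OF locinv_converse[OF Suc.prems] assms(2)] by blast
      have "(insert (y, x) (R\<inverse>))\<inverse> = insert (x, y) R" by auto
      then have "locinv Q j X Y P (insert (x, y) R)" using locinv_converse[OF x(2)] by simp
      then show "\<exists>x\<in>X. bf lab 1 j X Y (insert (x, y) (P \<union> R))" using Suc.IH x(1) by fastforce
    qed
  qed
  \<comment> \<open>Before the first move there are no centres and all balls are empty, so only the
    constants have to agree.\<close>
  have "locinv Q Q X Y P {}" using bf_empty[OF assms(3)] by (auto simp: locinv_def)
  then show ?thesis using main by fastforce
qed

end

section \<open>Graphs with bounded levels\<close>

text \<open>Distances for level \<open>i\<close> are taken after deleting all higher levels. The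
  condition therefore survives the removal of the top level, which makes induction on
  \<open>d\<close> possible.\<close>

definition level_bounded :: "('a \<Rightarrow> 'a \<Rightarrow> bool) \<Rightarrow> ('a \<Rightarrow> nat) \<Rightarrow> nat \<Rightarrow> nat \<Rightarrow> nat \<Rightarrow> 'a set \<Rightarrow> bool" where
  "level_bounded adj lev d M r X \<longleftrightarrow> finite X \<and> (\<forall>x\<in>X. lev x < d) \<and>
    (\<forall>i<d. \<forall>x\<in>X. lev x \<le> i \<longrightarrow> card {u. lev u = i \<and> near adj {y \<in> X. lev y \<le> i} r x u} \<le> M)"

lemma level_boundedD:
  assumes "level_bounded adj lev d M r X" "x \<in> X"
  shows "lev x < d"
    and "i < d \<Longrightarrow> lev x \<le> i \<Longrightarrow> card {u. lev u = i \<and> near adj {y \<in> X. lev y \<le> i} r x u} \<le> M"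
  using assms unfolding level_bounded_def by simp_all

lemma level_bounded_subset:
  assumes "level_bounded adj lev d M r X" "X' \<subseteq> X" "r' \<le> r" "d' \<le> d" "\<forall>x\<in>X'. lev x < d'"
  shows "level_bounded adj lev d' M r' X'"
proof -
  have "card {u. lev u = i \<and> near adj {y \<in> X'. lev y \<le> i} r' x u} \<le> M"
    if "i < d'" "x \<in> X'" "lev x \<le> i" for i x
  proof -
    have "finite {u. lev u = i \<and> near adj {y \<in> X. lev y \<le> i} r x u}"
      by (rule finite_subset[of _ X]) (use assms(1) near_in in \<open>fastforce simp: level_bounded_def\<close>)+
    moreover have "near adj {y \<in> X. lev y \<le> i} r x u" if "near adj {y \<in> X'. lev y \<le> i} r' x u" for u
      by (rule near_mono[OF that assms(3)]) (use assms(2) in auto)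
    then have "{u. lev u = i \<and> near adj {y \<in> X'. lev y \<le> i} r' x u} \<subseteq>
        {u. lev u = i \<and> near adj {y \<in> X. lev y \<le> i} r x u}" by blast
    ultimately have "card {u. lev u = i \<and> near adj {y \<in> X'. lev y \<le> i} r' x u} \<le>
        card {u. lev u = i \<and> near adj {y \<in> X. lev y \<le> i} r x u}" by (rule card_mono)
    also have "\<dots> \<le> M" using assms that unfolding level_bounded_def by (meson less_le_trans subsetD)
    finally show ?thesis .
  qed
  moreover have "finite X'" using assms(1,2) finite_subset unfolding level_bounded_def by blast
  ultimately show ?thesis using assms(5) unfolding level_bounded_def by blast
qed

context lev_graph
begin

text \<open>
  The ball around \<open>x\<close> contains only boundedly many vertices of the top level. Turned into constants
  by one block of moves, they leave a ball with one level fewer.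
\<close>

lemma bf_local:
  assumes IH: "\<And>X Y P. level_bounded adj lev d M r X \<Longrightarrow> level_bounded adj lev d M r Y \<Longrightarrow>
      Domain P \<inter> X = {} \<Longrightarrow> Range P \<inter> Y = {} \<Longrightarrow> bf lab q k X Y P \<Longrightarrow> bf lab 1 Q X Y P"
    and lbX: "level_bounded adj lev (Suc d) M r X" and lbY: "level_bounded adj lev (Suc d) M r Y"
    and out: "Domain P \<inter> X = {}" "Range P \<inter> Y = {}"
    and xy: "x \<in> X" "y \<in> Y" and rho: "\<rho> \<le> r" and q: "M \<le> q" "\<rho> + 1 \<le> q"
    and bf: "bf lab q (k + 3) X Y (insert (x, y) P)"
  shows "bf lab 1 Q (ball X \<rho> {x}) (ball Y \<rho> {y}) (insert (x, y) P)"
proof -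
  define Ux where "Ux = {u \<in> ball X \<rho> {x}. lev u = d}"
  define Uy where "Uy = {u \<in> ball Y \<rho> {y}. lev u = d}"
  have finX: "finite X" using lbX by (simp add: level_bounded_def)
  have UxX: "Ux \<subseteq> X" using bal_subset[of adj X \<rho> "{x}"] by (auto simp: Ux_def)
  have "card Ux \<le> M"
  proof -
    have Xd: "{y \<in> X. lev y \<le> d} = X" using lbX by (auto simp: level_bounded_def)
    have "lev x \<le> d" using level_boundedD(1)[OF lbX xy(1)] by simp
    then have "card {u. lev u = d \<and> nr X r x u} \<le> M"
      using level_boundedD(2)[OF lbX xy(1), of d] Xd by simp
    moreover have "Ux \<subseteq> {u. lev u = d \<and> nr X r x u}"
    proof
      fix u assume "u \<in> Ux"
      then have "lev u = d" "nr X \<rho> x u" by (simp_all add: Ux_def bal_def)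
      then show "u \<in> {u. lev u = d \<and> nr X r x u}" using near_mono[of adj X \<rho> x u r X] rho by simp
    qed
    moreover have "finite {u. lev u = d \<and> nr X r x u}"
      by (rule finite_subset[OF _ finX]) (use near_in[of adj X] in blast)
    ultimately show ?thesis using card_mono le_trans by blast
  qed
  then have cU: "card Ux \<le> q" and fU: "finite Ux" using q(1) finite_subset[OF UxX finX] by auto
  \<comment> \<open>The three extra rounds: one plays the top level, one shows that its image is the
    whole top level of the other ball, and one tests membership in the ball.\<close>
  have bf': "bf lab q (Suc (k + 2)) X Y (insert (x, y) P)" using bf by (simp add: numeral_3_eq_3)
  obtain h where h: "h ` Ux \<subseteq> Y" "bf lab q (k + 2) X Y (insert (x, y) P \<union> (\<lambda>a. (a, h a)) ` Ux)"
    by (rule bf_move[OF bf' UxX fU cU])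
  define H where "H = (\<lambda>a. (a, h a)) ` Ux"
  define P' where "P' = insert (x, y) P \<union> H"
  have bfP': "bf lab q (k + 2) X Y P'" using h(2) by (simp add: P'_def H_def)
  have pP': "piso lab P'" by (rule bf_imp_piso[OF bfP'])
  have xyP': "(x, y) \<in> P'" by (simp add: P'_def)
  have ball_iff: "u \<in> ball X \<rho> {x} \<longleftrightarrow> v \<in> ball Y \<rho> {y}"
    if uv: "u \<in> X" "v \<in> Y" "bf lab q 1 X Y (insert (u, v) P')" for u v
  proof
    assume "u \<in> ball X \<rho> {x}"
    then have "nr X \<rho> x u" by (simp add: bal_def)
    then have "nr Y \<rho> y v" by (rule nr_bf_block[OF uv(3) q(2)]) (simp_all add: xyP')
    then show "v \<in> ball Y \<rho> {y}" using uv(2) by (simp add: bal_def)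
  next
    assume "v \<in> ball Y \<rho> {y}"
    then have "nr Y \<rho> y v" by (simp add: bal_def)
    then have "nr X \<rho> x u" by (rule nr_bf_block[OF bf_converse[OF uv(3)] q(2)]) (simp_all add: xyP')
    then show "u \<in> ball X \<rho> {x}" using uv(1) by (simp add: bal_def)
  qed
  have lev_iff: "lev u = lev v" if uv: "bf lab q 1 X Y (insert (u, v) P')" for u v
    using pisoD(2)[OF bf_imp_piso[OF uv], of u v u v] by simp
  have U_iff: "u \<in> Ux \<longleftrightarrow> v \<in> Uy" if uv: "u \<in> X" "v \<in> Y" "bf lab q 1 X Y (insert (u, v) P')" for u v
    using ball_iff[OF uv] lev_iff[OF uv(3)] by (simp add: Ux_def Uy_def)
  \<comment> \<open>A vertex of \<open>Uy\<close> missed by \<open>h\<close> would be answered by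
    some \<open>w\<close> in \<open>Ux\<close>, but \<open>w\<close> is already matched with
    \<open>h w\<close>.\<close>
  have hU: "h ` Ux = Uy"
  proof (intro equalityI subsetI)
    fix v assume "v \<in> h ` Ux"
    then obtain u where u: "u \<in> Ux" "v = h u" by blast
    then have "(u, v) \<in> P'" by (simp add: P'_def H_def)
    then have "bf lab q 1 X Y (insert (u, v) P')"
      using bf_le_rounds[OF bfP', of 1] by (simp add: insert_absorb)
    then show "v \<in> Uy" using U_iff[of u v] u UxX h(1) by blast
  next
    fix v assume v: "v \<in> Uy"
    then have vY: "v \<in> Y" by (simp add: Uy_def bal_def)
    have "bf lab q (Suc (k + 1)) Y X (P'\<inverse>)" using bf_converse[OF bfP'] by simp
    then obtain w where w: "w \<in> X" "bf lab q (k + 1) Y X (insert (v, w) (P'\<inverse>))"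
      by (rule bf_move_one[OF _ vY]) (use q in auto)
    have "bf lab q (k + 1) X Y (insert (w, v) P')" using bf_converse_insert[OF w(2)] by simp
    then have bw: "bf lab q 1 X Y (insert (w, v) P')" by (rule bf_le_rounds) simp
    then have "w \<in> Ux" using U_iff[OF w(1) vY] v by simp
    moreover from this have "(w, h w) \<in> insert (w, v) P'" by (simp add: P'_def H_def)
    then have "h w = v" using pisoD(1)[OF bf_imp_piso[OF bw], of w "h w" w v] by simp
    ultimately show "v \<in> h ` Ux" by blast
  qed
  \<comment> \<open>The induction hypothesis wants constants outside the carriers, so
    \<open>x\<close> and the top level are removed here; \<open>bf_extend\<close> puts them back
    afterwards.\<close>
  define X' where "X' = ball X \<rho> {x} - Ux - {x}"
  define Y' where "Y' = ball Y \<rho> {y} - Uy - {y}"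
  have X'X: "X' \<subseteq> X" and Y'Y: "Y' \<subseteq> Y" using bal_subset unfolding X'_def Y'_def by fast+
  have DH: "Domain H = Ux" "Range H = Uy" using hU by (auto simp: H_def)
  have "bf lab q k X' Y' P'"
  proof (rule bf_restrict[OF _ X'X Y'Y, of lab q k 1])
    show "bf lab q (k + 1) X Y P'" by (rule bf_le_rounds[OF bfP']) simp
    fix u v assume uv: "u \<in> X" "v \<in> Y" "bf lab q 1 X Y (insert (u, v) P')"
    have "u = x \<longleftrightarrow> v = y" using pisoD(1)[OF bf_imp_piso[OF uv(3)], of u v x y] xyP' by simp
    then show "u \<in> X' \<longleftrightarrow> v \<in> Y'" using ball_iff[OF uv] U_iff[OF uv] by (simp add: X'_def Y'_def)
  qed
  moreover have "\<forall>u\<in>X'. lev u < d"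
  proof
    fix u assume u: "u \<in> X'"
    then have "lev u < Suc d" using lbX X'X by (auto simp: level_bounded_def)
    moreover have "lev u \<noteq> d" using u by (simp add: X'_def Ux_def)
    ultimately show "lev u < d" by simp
  qed
  then have "level_bounded adj lev d M r X'" using level_bounded_subset[OF lbX X'X, of r d] by simp
  moreover have "\<forall>u\<in>Y'. lev u < d"
  proof
    fix u assume u: "u \<in> Y'"
    then have "lev u < Suc d" using lbY Y'Y by (auto simp: level_bounded_def)
    moreover have "lev u \<noteq> d" using u by (simp add: Y'_def Uy_def)
    ultimately show "lev u < d" by simp
  qed
  then have "level_bounded adj lev d M r Y'" using level_bounded_subset[OF lbY Y'Y, of r d] by simp
  moreover have "Domain P' \<inter> X' = {}"
    using out(1) X'X DH(1) unfolding P'_def Domain_Un_eq Domain_insert X'_def by blast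
  moreover have "Range P' \<inter> Y' = {}"
    using out(2) Y'Y DH(2) unfolding P'_def Range_Un_eq Range_insert Y'_def by blast
  ultimately have "bf lab 1 Q X' Y' P'" using IH by blast
  then have bfE: "bf lab 1 Q (X' \<union> Domain (insert (x, y) H)) (Y' \<union> Range (insert (x, y) H)) P'"
    by (rule bf_extend) (auto simp: P'_def)
  moreover have "x \<in> ball X \<rho> {x}" "y \<in> ball Y \<rho> {y}"
    using bal_self[of "{x}" X adj \<rho>] bal_self[of "{y}" Y adj \<rho>] xy by simp_all
  moreover have "Ux \<subseteq> ball X \<rho> {x}" "Uy \<subseteq> ball Y \<rho> {y}" by (auto simp: Ux_def Uy_def)
  ultimately have "X' \<union> Domain (insert (x, y) H) = ball X \<rho> {x}" "Y' \<union> Range (insert (x, y) H) = ball Y \<rho> {y}"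
    unfolding Domain_insert Range_insert DH X'_def Y'_def by blast+
  with bfE have "bf lab 1 Q (ball X \<rho> {x}) (ball Y \<rho> {y}) P'" by simp
  then show ?thesis by (rule bf_antimono) (simp add: P'_def subset_insertI2 subset_insertI)
qed

text \<open>A fourth round plays all of \<open>A\<close> in one block, and its answer is the map
  that \<open>glob\<close> asks for: \<open>bf_local\<close> supplies the local games of all radii,
  and one path played as a block shows that the answer brings no scattered points together.\<close>

lemma glob_of_bf:
  assumes IH: "\<And>X Y P. level_bounded adj lev d M r X \<Longrightarrow> level_bounded adj lev d M r Y \<Longrightarrow>
      Domain P \<inter> X = {} \<Longrightarrow> Range P \<inter> Y = {} \<Longrightarrow> bf lab q k X Y P \<Longrightarrow> bf lab 1 Q' X Y P"
    and lb: "level_bounded adj lev (Suc d) M r X" "level_bounded adj lev (Suc d) M r Y"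
    and out: "Domain P \<inter> X = {}" "Range P \<inter> Y = {}"
    and bnd: "\<And>j. j < Q \<Longrightarrow> rad j \<le> r" "\<And>j. j < Q \<Longrightarrow> rnd Q j \<le> Q'"
      "M \<le> q" "Q \<le> q" "\<And>j. j < Q \<Longrightarrow> 4 * rad j + 3 \<le> q"
    and bf: "bf lab q (k + 4) X Y P"
  shows "glob Q X Y P"
  unfolding glob_def
proof (intro allI impI)
  fix A assume A: "A \<subseteq> X" "finite A" "card A \<le> Q"
  have bf': "bf lab q (Suc (k + 3)) X Y P" by (rule bf_le_rounds[OF bf]) simp
  have cA: "card A \<le> q" using A(3) bnd(4) by simp
  obtain h where h: "h ` A \<subseteq> Y" "bf lab q (k + 3) X Y (P \<union> (\<lambda>a. (a, h a)) ` A)"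
    by (rule bf_move[OF bf' A(1,2) cA])
  show "\<exists>h. h ` A \<subseteq> Y \<and>
    (\<forall>a\<in>A. \<forall>j<Q. bf lab 1 (rnd Q j) (ball X (rad j) {a}) (ball Y (rad j) {h a}) (insert (a, h a) P)) \<and>
    (\<forall>a\<in>A. \<forall>a'\<in>A. \<forall>j<Q. nr Y (4 * rad j + 2) (h a) (h a') \<longrightarrow> nr X (4 * rad j + 2) a a')"
  proof (intro exI[of _ h] conjI ballI allI impI)
    show "h ` A \<subseteq> Y" by (rule h(1))
    fix a j assume a: "a \<in> A" and j: "j < Q"
    have "bf lab q (k + 3) X Y (insert (a, h a) P)" by (rule bf_antimono[OF h(2)]) (use a in auto)
    then have "bf lab 1 Q' (ball X (rad j) {a}) (ball Y (rad j) {h a}) (insert (a, h a) P)"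
      using bnd(1,5)[OF j] bnd(3) a A(1) h(1)
      by (intro bf_local[OF IH lb out]) auto
    then show "bf lab 1 (rnd Q j) (ball X (rad j) {a}) (ball Y (rad j) {h a}) (insert (a, h a) P)"
      by (rule bf_le_rounds) (rule bnd(2)[OF j])
  next
    fix a a' j assume a: "a \<in> A" "a' \<in> A" and j: "j < Q" and n: "nr Y (4 * rad j + 2) (h a) (h a')"
    have "bf lab q 1 X Y (P \<union> (\<lambda>a. (a, h a)) ` A)" by (rule bf_le_rounds[OF h(2)]) simp
    from nr_bf_block[OF bf_converse[OF this] _ n] show "nr X (4 * rad j + 2) a a'"
      using a bnd(5)[OF j] by simp
  qed
qed

end

lemma rad_mono: "i \<le> j \<Longrightarrow> rad i \<le> rad j"
  by (induction j) (auto simp: le_Suc_eq)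

lemma rnd_mono: "i \<le> j \<Longrightarrow> rnd Q i \<le> rnd Q j"
  by (induction j) (auto simp: le_Suc_eq)

definition levels_collapse :: "'a itself \<Rightarrow> nat \<Rightarrow> nat \<Rightarrow> nat \<Rightarrow> nat \<Rightarrow> nat \<Rightarrow> bool" where
  "levels_collapse TYPE('a) d M r q Q \<longleftrightarrow> (\<forall>(adj :: 'a \<Rightarrow> 'a \<Rightarrow> bool) lev X Y P. lev_graph adj \<longrightarrow>
    level_bounded adj lev d M r X \<longrightarrow> level_bounded adj lev d M r Y \<longrightarrow>
    Domain P \<inter> X = {} \<longrightarrow> Range P \<inter> Y = {} \<longrightarrow>
    bf (\<lambda>a b. (adj a b, lev a)) q (4 * d) X Y P \<longrightarrow> bf (\<lambda>a b. (adj a b, lev a)) 1 Q X Y P)"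

text \<open>The order of quantifiers matters: \<open>r\<close> is determined by \<open>d\<close> and
  \<open>Q\<close>, and \<open>M\<close> influences only the block size. In the application
  \<open>M\<close> is known only after \<open>r\<close> has been used to select a tree.\<close>

theorem level_bounded_collapse: "\<exists>r. \<forall>M. \<exists>q. levels_collapse TYPE('a) d M r q Q"
proof (induction d arbitrary: Q)
  case 0
  have "levels_collapse TYPE('a) 0 M r q Q" for M r q
    unfolding levels_collapse_def
  proof (intro allI impI)
    fix adj :: "'a \<Rightarrow> 'a \<Rightarrow> bool" and lev X Y P
    assume "level_bounded adj lev 0 M r X" "level_bounded adj lev 0 M r Y"
      and bf: "bf (\<lambda>a b. (adj a b, lev a)) q (4 * 0) X Y P"
    then have "X = {}" "Y = {}" by (auto dest: level_boundedD(1))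
    then show "bf (\<lambda>a b. (adj a b, lev a)) 1 Q X Y P" using bf_empty[OF bf_imp_piso[OF bf]] by simp
  qed
  then show ?case by (intro exI allI)
next
  case (Suc d)
  \<comment> \<open>With one level fewer, \<open>rnd Q Q\<close> single moves are needed, since this
    bounds the length of every local game in \<open>gaifman\<close>.\<close>
  obtain r0 where r0: "\<forall>M. \<exists>q. levels_collapse TYPE('a) d M r0 q (rnd Q Q)"
    using Suc.IH[of "rnd Q Q"] by (elim exE)
  define r where "r = max r0 (rad Q)"
  have "\<exists>q. levels_collapse TYPE('a) (Suc d) M r q Q" for M
  proof -
    obtain q0 where q0: "levels_collapse TYPE('a) d M r0 q0 (rnd Q Q)"
      using r0[rule_format, of M] by (elim exE)
    define q where "q = q0 + M + Q + 4 * rad Q + 3"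
    show ?thesis
      unfolding levels_collapse_def
    proof (intro exI[of _ q] allI impI)
      fix adj :: "'a \<Rightarrow> 'a \<Rightarrow> bool" and lev X Y P
      assume lg: "lev_graph adj" and lb: "level_bounded adj lev (Suc d) M r X"
        "level_bounded adj lev (Suc d) M r Y"
        and out: "Domain P \<inter> X = {}" "Range P \<inter> Y = {}"
        and bf: "bf (\<lambda>a b. (adj a b, lev a)) q (4 * Suc d) X Y P"
      interpret lev_graph adj lev by (rule lg)
      have bfq: "bf lab q (4 * d + 4) X Y P" using bf by (simp add: algebra_simps)
      have IH: "bf lab 1 (rnd Q Q) X Y P"
        if "level_bounded adj lev d M r X" "level_bounded adj lev d M r Y"
          "Domain P \<inter> X = {}" "Range P \<inter> Y = {}" "bf lab q (4 * d) X Y P" for X Y P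
      proof -
        have "level_bounded adj lev d M r0 X" "level_bounded adj lev d M r0 Y"
          using level_bounded_subset[OF that(1) subset_refl, of r0 d] level_boundedD(1)[OF that(1)]
            level_bounded_subset[OF that(2) subset_refl, of r0 d] level_boundedD(1)[OF that(2)]
          by (simp_all add: r_def)
        moreover have "bf lab q0 (4 * d) X Y P" by (rule bf_le_size[OF that(5)]) (simp add: q_def)
        ultimately show ?thesis using q0[unfolded levels_collapse_def, rule_format, OF lg _ _ that(3,4)] by simp
      qed
      have bnd: "rad j \<le> r" "rnd Q j \<le> rnd Q Q" "4 * rad j + 3 \<le> q" if "j < Q" for j
        using rad_mono[of j Q] rnd_mono[of j Q Q] that by (auto simp: r_def q_def)
      have bndq: "M \<le> q" "Q \<le> q" by (auto simp: q_def)
      have "glob Q X Y P" by (rule glob_of_bf[OF IH lb out bnd(1,2) bndq bnd(3) bfq])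
      moreover have out': "Domain (P\<inverse>) \<inter> Y = {}" "Range (P\<inverse>) \<inter> X = {}" using out by auto
      have "glob Q Y X (P\<inverse>)"
        by (rule glob_of_bf[OF IH lb(2,1) out' bnd(1,2) bndq bnd(3) bf_converse[OF bfq]])
      ultimately show "bf lab 1 Q X Y P" by (rule gaifman) (rule bf_imp_piso[OF bfq])
    qed
  qed
  then show ?case by (rule exI[of _ r, OF allI])
qed

section \<open>Ranks of vertices\<close>

text \<open>
  Up to the choice of \<open>N\<close>, having rank \<open>i + 1\<close> means being the centre of a large fan of short paths,
  disjoint outside the centre, to vertices of rank \<open>i\<close>. The formulation by separators makes the
  greedy embedding of trees immediate.
\<close>

primrec rk :: "('a \<Rightarrow> 'a \<Rightarrow> bool) \<Rightarrow> nat \<Rightarrow> nat \<Rightarrow> 'a set \<Rightarrow> nat \<Rightarrow> 'a set" where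
  "rk adj N r V 0 = V"
| "rk adj N r V (Suc i) = {v \<in> V. \<forall>S\<subseteq>V. finite S \<longrightarrow> card S \<le> N \<longrightarrow> v \<notin> S \<longrightarrow>
    (\<exists>u\<in>rk adj N r V i. u \<noteq> v \<and> near adj (V - S) r v u)}"

declare rk.simps(2) [simp del]

lemma rk_Suc_iff:
  "v \<in> rk adj N r V (Suc i) \<longleftrightarrow> v \<in> V \<and> (\<forall>S. S \<subseteq> V \<longrightarrow> finite S \<longrightarrow> card S \<le> N \<longrightarrow> v \<notin> S \<longrightarrow>
    (\<exists>u. u \<in> rk adj N r V i \<and> u \<noteq> v \<and> near adj (V - S) r v u))"
  unfolding rk.simps by blast

lemma rk_Suc_subset: "rk adj N r V (Suc i) \<subseteq> rk adj N r V i"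
proof (induction i)
  case 0
  then show ?case by (auto simp: rk_Suc_iff)
next
  case (Suc i)
  show ?case
  proof
    fix v assume "v \<in> rk adj N r V (Suc (Suc i))"
    then have v: "v \<in> V" and *: "\<And>S. S \<subseteq> V \<Longrightarrow> finite S \<Longrightarrow> card S \<le> N \<Longrightarrow> v \<notin> S \<Longrightarrow>
        \<exists>u\<in>rk adj N r V (Suc i). u \<noteq> v \<and> near adj (V - S) r v u"
      unfolding rk.simps(2)[of adj N r V "Suc i"] by simp_all
    show "v \<in> rk adj N r V (Suc i)"
      unfolding rk.simps(2)[of adj N r V i]
    proof (intro CollectI conjI allI impI v)
      fix S assume "S \<subseteq> V" "finite S" "card S \<le> N" "v \<notin> S"
      from *[OF this] show "\<exists>u\<in>rk adj N r V i. u \<noteq> v \<and> near adj (V - S) r v u"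
        using Suc.IH by blast
    qed
  qed
qed

lemma rk_antimono: "i \<le> j \<Longrightarrow> rk adj N r V j \<subseteq> rk adj N r V i"
  by (rule lift_Suc_antimono_le[of "rk adj N r V"]) (rule rk_Suc_subset)

lemma near_cut:
  "near adj A n x u \<Longrightarrow> near adj (A - S) n x u \<or> (\<exists>s\<in>S \<inter> A. near adj A n s u)"
proof (induction n arbitrary: x)
  case 0
  then show ?case by auto
next
  case (Suc n)
  show ?case
  proof (cases "x \<in> S")
    case True
    then show ?thesis using Suc.prems near_in by fast
  next
    case False
    from Suc.prems consider "near adj A n x u" | z where "x \<in> A" "adj x z" "near adj A n z u"
      unfolding near.simps by blast
    then show ?thesis using Suc.IH False unfolding near.simps by (metis DiffI)
  qed
qed

text \<open>A walk from outside \<open>S\<close> has spent a step before it meets \<open>S\<close>.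
  The smaller remaining radius drives the recursive count of
  \<open>level_bounded_rank_level\<close>.\<close>

lemma near_cut_Suc:
  assumes "near adj A (Suc n) x u" "x \<notin> S"
  shows "near adj (A - S) (Suc n) x u \<or> (\<exists>s\<in>S \<inter> A. near adj A n s u)"
proof -
  from assms(1) consider "near adj A n x u" | z where "x \<in> A" "adj x z" "near adj A n z u"
    unfolding near.simps by blast
  then show ?thesis
    using near_cut[of adj A n _ u S] assms(2) unfolding near.simps by (metis DiffI)
qed

text \<open>As the sets decrease, this is the largest \<open>i\<close> such that \<open>x\<close>
  has rank at least \<open>i\<close>, provided that the ranks are bounded.\<close>

definition rank_level :: "('a \<Rightarrow> 'a \<Rightarrow> bool) \<Rightarrow> nat \<Rightarrow> nat \<Rightarrow> 'a set \<Rightarrow> 'a \<Rightarrow> nat" where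
  "rank_level adj N r V x = (LEAST i. x \<notin> rk adj N r V (Suc i))"

lemma rank_level:
  assumes "rk adj N r V m = {}" "x \<in> V"
  shows "x \<notin> rk adj N r V (Suc (rank_level adj N r V x))"
    and "x \<in> rk adj N r V (rank_level adj N r V x)"
    and "rank_level adj N r V x < m"
proof -
  obtain m' where m: "m = Suc m'" using assms by (cases m) auto
  then have m': "x \<notin> rk adj N r V (Suc m')" using assms by simp
  show "x \<notin> rk adj N r V (Suc (rank_level adj N r V x))"
    unfolding rank_level_def by (rule LeastI[of _ m']) (rule m')
  show "rank_level adj N r V x < m"
    unfolding rank_level_def m using Least_le[of "\<lambda>i. x \<notin> rk adj N r V (Suc i)" m'] m' by simp
  show "x \<in> rk adj N r V (rank_level adj N r V x)"
  proof (cases "rank_level adj N r V x")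
    case 0
    then show ?thesis using assms(2) by simp
  next
    case (Suc i)
    then show ?thesis
      using not_less_Least[of i "\<lambda>i. x \<notin> rk adj N r V (Suc i)"] unfolding rank_level_def by simp
  qed
qed

text \<open>A vertex of level at most \<open>i\<close> has a separator of at most \<open>N\<close>
  vertices. Every short walk to another vertex of level \<open>i\<close> passes through it, with
  less radius left. Iterating over the separators bounds the count by
  \<open>1 + N * Suc N ^ l \<le> Suc N ^ Suc l\<close>.\<close>

lemma level_bounded_rank_level:
  assumes fin: "finite V" and empty: "rk adj N r V m = {}"
    and lev: "\<And>x. x \<in> V \<Longrightarrow> lev x = rank_level adj N r V x"
  shows "level_bounded adj lev m (Suc N ^ r) r V"
  unfolding level_bounded_def
proof (intro conjI ballI allI impI fin)
  fix x assume "x \<in> V"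
  then show "lev x < m" using lev rank_level(3)[OF empty] by simp
next
  fix i x assume i: "i < m" and x: "x \<in> V" "lev x \<le> i"
  define A where "A = {y \<in> V. lev y \<le> i}"
  define B where "B l x = {u. lev u = i \<and> near adj A l x u}" for l x
  have BA: "B l x \<subseteq> A" for l x using near_in[of adj A l x] by (auto simp: B_def)
  have finA: "finite A" using fin by (simp add: A_def)
  have finB: "finite (B l x)" for l x by (rule finite_subset[OF BA finA])
  have "card (B l x) \<le> Suc N ^ l" if "l \<le> r" "x \<in> A" for l x
    using that
  proof (induction l arbitrary: x)
    case 0
    have "B 0 x \<subseteq> {x}" by (auto simp: B_def)
    then show ?case using card_mono[of "{x}" "B 0 x"] by simp
  next
    case (Suc l)
    have xV: "x \<in> V" and "lev x \<le> i" using Suc.prems by (auto simp: A_def)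
    then have "x \<notin> rk adj N r V (Suc i)"
      using rank_level(1)[OF empty xV] rk_antimono[of "Suc (lev x)" "Suc i" adj N r V] lev by auto
    then have "\<exists>S. S \<subseteq> V \<and> finite S \<and> card S \<le> N \<and> x \<notin> S \<and>
        (\<forall>u. u \<in> rk adj N r V i \<longrightarrow> u \<noteq> x \<longrightarrow> \<not> near adj (V - S) r x u)"
      using xV unfolding rk_Suc_iff by meson
    then obtain S where S: "S \<subseteq> V" "finite S" "card S \<le> N" "x \<notin> S"
      and noS: "\<forall>u. u \<in> rk adj N r V i \<longrightarrow> u \<noteq> x \<longrightarrow> \<not> near adj (V - S) r x u"
      by (elim exE conjE)
    have "B (Suc l) x \<subseteq> {x} \<union> (\<Union>s\<in>S \<inter> A. B l s)"
    proof
      fix u assume u: "u \<in> B (Suc l) x"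
      then have lu: "lev u = i" and n: "near adj A (Suc l) x u" by (simp_all add: B_def)
      have uV: "u \<in> V" using near_in[OF n] by (simp add: A_def)
      have ui: "u \<in> rk adj N r V i" using rank_level(2)[OF empty uV] lev[OF uV] lu by simp
      show "u \<in> {x} \<union> (\<Union>s\<in>S \<inter> A. B l s)"
      proof (cases "u = x")
        case False
        have "\<not> near adj (A - S) (Suc l) x u"
          using noS[rule_format, OF ui False] near_mono[of adj "A - S" "Suc l" x u r "V - S"] Suc.prems(1)
          by (auto simp: A_def)
        then show ?thesis using near_cut_Suc[OF n S(4)] lu by (auto simp: B_def)
      qed simp
    qed
    then have "card (B (Suc l) x) \<le> card ({x} \<union> (\<Union>s\<in>S \<inter> A. B l s))"
      by (rule card_mono[rotated]) (use S(2) finB in auto)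
    also have "\<dots> \<le> 1 + card (\<Union>s\<in>S \<inter> A. B l s)" using card_Un_le[of "{x}"] by simp
    also have "card (\<Union>s\<in>S \<inter> A. B l s) \<le> (\<Sum>s\<in>S \<inter> A. card (B l s))"
      by (rule card_UN_le) (use S(2) in simp)
    also have "\<dots> \<le> (\<Sum>s\<in>S \<inter> A. Suc N ^ l)" by (rule sum_mono) (use Suc in auto)
    also have "\<dots> = card (S \<inter> A) * Suc N ^ l" by simp
    also have "card (S \<inter> A) \<le> N" using S(2,3) card_mono[of S "S \<inter> A"] by auto
    finally have "card (B (Suc l) x) \<le> 1 + N * Suc N ^ l" by (simp add: mult_le_mono1)
    also have "\<dots> \<le> Suc N ^ Suc l" by simp
    finally show ?case .
  qed
  from this[of r x] x show "card {u. lev u = i \<and> near adj {y \<in> V. lev y \<le> i} r x u} \<le> Suc N ^ r"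
    by (simp add: A_def B_def)
qed

context
  fixes adj :: "'a \<Rightarrow> 'a \<Rightarrow> bool"
  assumes adj_sym: "adj x y \<Longrightarrow> adj y x"
begin

interpretation lev_graph adj "\<lambda>_. 0" by unfold_locales (rule adj_sym)

text \<open>Each rank costs two rounds. One block mirrors a candidate separator of \<open>y\<close>;
  the next plays a path that avoids the mirrored separator and ends in a vertex of the previous
  rank.\<close>

lemma rk_bf:
  "bf (\<lambda>a b. (adj a b, 0 :: nat)) q (2 * i) X Y P \<Longrightarrow> N \<le> q \<Longrightarrow> r + 1 \<le> q \<Longrightarrow> (x, y) \<in> P \<Longrightarrow> y \<in> Y \<Longrightarrow>
    x \<in> rk adj N r X i \<Longrightarrow> y \<in> rk adj N r Y i"
proof (induction i arbitrary: P x y)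
  case 0
  then show ?case by simp
next
  case (Suc i)
  note N = Suc.prems(2) and r = Suc.prems(3) and xy = Suc.prems(4)
  show ?case
    unfolding rk.simps
  proof (intro CollectI conjI allI impI Suc.prems(5))
    fix S' assume S': "S' \<subseteq> Y" "finite S'" "card S' \<le> N" "y \<notin> S'"
    have "bf lab q (Suc (Suc (2 * i))) Y X (P\<inverse>)" using bf_converse[OF Suc.prems(1)] by simp
    then obtain h where h: "h ` S' \<subseteq> X"
      "bf lab q (Suc (2 * i)) Y X (P\<inverse> \<union> (\<lambda>a. (a, h a)) ` S')"
      by (rule bf_move[OF _ S'(1,2)]) (use S'(3) N in auto)
    define P1 where "P1 = (P\<inverse> \<union> (\<lambda>a. (a, h a)) ` S')\<inverse>"
    have bf1: "bf lab q (Suc (2 * i)) X Y P1" unfolding P1_def by (rule bf_converse[OF h(2)])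
    have hP1: "(h s, s) \<in> P1" if "s \<in> S'" for s using that by (auto simp: P1_def)
    have xyP1: "(x, y) \<in> P1" using xy by (simp add: P1_def)
    have "x \<notin> h ` S'" using pisoD(1)[OF bf_imp_piso[OF bf1] hP1 xyP1] S'(4) by blast
    moreover have "card (h ` S') \<le> N" using card_image_le[OF S'(2), of h] S'(3) by simp
    moreover have "finite (h ` S')" using S'(2) by simp
    ultimately obtain u where u: "u \<in> rk adj N r X i" "u \<noteq> x" "nr (X - h ` S') r x u"
      using Suc.prems(6)[unfolded rk_Suc_iff, THEN conjunct2, rule_format, OF h(1)] by auto
    obtain A where A: "A \<subseteq> X - h ` S'" "finite A" "card A \<le> r + 1" "nr A r x u"
      using near_path[OF u(3)] by blast
    have AX: "A \<subseteq> X" and Aq: "card A \<le> q" using A r by auto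
    obtain g where g: "g ` A \<subseteq> Y" "bf lab q (2 * i) X Y (P1 \<union> (\<lambda>a. (a, g a)) ` A)"
      by (rule bf_move[OF bf1 AX A(2) Aq])
    define P2 where "P2 = P1 \<union> (\<lambda>a. (a, g a)) ` A"
    have bf2: "bf lab q (2 * i) X Y P2" using g(2) by (simp add: P2_def)
    have p2: "piso lab P2" by (rule bf_imp_piso[OF bf2])
    have gP2: "(a, g a) \<in> P2" if "a \<in> A" for a using that by (simp add: P2_def)
    have hP2: "(h s, s) \<in> P2" if "s \<in> S'" for s using hP1[OF that] by (simp add: P2_def)
    have xA: "x \<in> A" "u \<in> A" using near_in[OF A(4)] by auto
    have gx: "g x = y" using pisoD(1)[OF p2 gP2[OF xA(1)], of x y] xyP1 by (simp add: P2_def)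
    have gS: "g ` A \<subseteq> Y - S'"
    proof
      fix b assume "b \<in> g ` A"
      then obtain a where a: "a \<in> A" "b = g a" by blast
      have "b \<notin> S'"
      proof
        assume "b \<in> S'"
        then have "h b = a" using pisoD(1)[OF p2 hP2 gP2[OF a(1)]] a(2) by simp
        then show False using A(1) a(1) \<open>b \<in> S'\<close> by blast
      qed
      then show "b \<in> Y - S'" using g(1) a by blast
    qed
    have "nr (Y - S') r (g x) (g u)" by (rule nr_map[OF A(4) p2 gP2 gS])
    moreover have "g u \<in> rk adj N r Y i"
      by (rule Suc.IH[OF bf2 N r gP2[OF xA(2)] _ u(1)]) (use g(1) xA(2) in blast)
    moreover have "g u \<noteq> y" using pisoD(1)[OF p2 gP2[OF xA(1)] gP2[OF xA(2)]] gx u(2) by metis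
    ultimately show "\<exists>u\<in>rk adj N r Y i. u \<noteq> y \<and> nr (Y - S') r y u" using gx by auto
  qed
qed

text \<open>The last \<open>2 * m\<close> rounds are held in reserve: by \<open>rk_bf\<close> they
  force matched elements to have equal ranks, so levels may be added to the labels.\<close>

lemma bf_relabel:
  assumes q: "N \<le> q" "r + 1 \<le> q" and empty: "rk adj N r X m = {}" "rk adj N r Y m = {}"
    and lev: "\<And>x. x \<in> X \<Longrightarrow> lev x = rank_level adj N r X x"
      "\<And>y. y \<in> Y \<Longrightarrow> lev y = rank_level adj N r Y y"
  shows "bf (\<lambda>a b. (adj a b, 0 :: nat)) q (n + 2 * m) X Y P \<Longrightarrow> P \<subseteq> X \<times> Y \<Longrightarrow>
    bf (\<lambda>a b. (adj a b, lev a)) q n X Y P"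
proof (induction n arbitrary: P)
  case 0
  have bf: "bf lab q (2 * m) X Y P" using 0 by simp
  have p: "piso lab P" by (rule bf_imp_piso[OF bf])
  have "lev x = lev y" if xy: "(x, y) \<in> P" for x y
  proof -
    have XY: "x \<in> X" "y \<in> Y" using xy 0 by auto
    have "x \<in> rk adj N r X i \<longleftrightarrow> y \<in> rk adj N r Y i" for i
    proof (cases "i \<le> m")
      case True
      then have bi: "bf lab q (2 * i) X Y P" by (intro bf_le_rounds[OF bf]) simp
      show ?thesis
        using rk_bf[OF bi q xy XY(2)] rk_bf[OF bf_converse[OF bi] q, of y x] xy XY(1) by blast
    next
      case False
      then show ?thesis
        using rk_antimono[of m i adj N r X] rk_antimono[of m i adj N r Y] empty by auto
    qed
    then show ?thesis using lev XY by (simp add: rank_level_def)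
  qed
  then have "piso (\<lambda>a b. (adj a b, lev a)) P"
    using p unfolding piso_def by (metis (mono_tags, lifting) prod.inject)
  then show ?case by simp
next
  case (Suc n)
  have bf: "bf lab q (Suc (n + 2 * m)) X Y P" using Suc.prems by simp
  show ?case
  proof (rule bf_Suc_transfer[OF bf])
    fix R assume R: "R \<subseteq> X \<times> Y" "bf lab q (n + 2 * m) X Y (P \<union> R)"
    have "bf (\<lambda>a b. (adj a b, lev a)) q n X Y (P \<union> R)"
      by (rule Suc.IH[OF R(2)]) (use R(1) Suc.prems(2) in blast)
    then show "\<exists>R'. R' \<subseteq> X \<times> Y \<and> X \<inter> Domain R \<subseteq> Domain R' \<and> Y \<inter> Range R \<subseteq> Range R' \<and>
        bf (\<lambda>a b. (adj a b, lev a)) q n X Y (P \<union> R')"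
      using R(1) by blast
  qed simp_all
qed

end

lemma bf_forget:
  "bf (\<lambda>a b. (adj a b, lev a)) q n X Y P \<Longrightarrow> bf (\<lambda>a b. (adj a b, 0 :: nat)) q n X Y P"
proof (induction n arbitrary: P)
  case 0
  then show ?case unfolding bf.simps piso_def by simp
next
  case (Suc n)
  show ?case by (rule bf_Suc_transfer[OF Suc.prems]) (use Suc.IH in auto)
qed

text \<open>Equal or disjoint carriers allow one level function to serve both. Of the
  \<open>6 * m\<close> rounds, \<open>2 * m\<close> recover the levels and \<open>4 * m\<close> are
  spent in the game with levels.\<close>

definition ranks_collapse :: "'a itself \<Rightarrow> nat \<Rightarrow> nat \<Rightarrow> nat \<Rightarrow> nat \<Rightarrow> nat \<Rightarrow> bool" where
  "ranks_collapse TYPE('a) m N r q Q \<longleftrightarrow> (\<forall>(adj :: 'a \<Rightarrow> 'a \<Rightarrow> bool) X Y P. (\<forall>x y. adj x y \<longrightarrow> adj y x) \<longrightarrow>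
    finite X \<longrightarrow> finite Y \<longrightarrow> (X = Y \<or> X \<inter> Y = {}) \<longrightarrow>
    rk adj N r X m = {} \<longrightarrow> rk adj N r Y m = {} \<longrightarrow> P \<subseteq> X \<times> Y \<longrightarrow>
    bf (\<lambda>a b. (adj a b, 0 :: nat)) q (6 * m) X Y P \<longrightarrow> bf (\<lambda>a b. (adj a b, 0 :: nat)) 1 Q X Y P)"

lemma rk_bounded_collapse: "\<exists>r. \<forall>N. \<exists>q. ranks_collapse TYPE('a) m N r q Q"
proof -
  obtain r where r: "\<forall>M. \<exists>q. levels_collapse TYPE('a) m M r q Q"
    using level_bounded_collapse[of m Q] by (elim exE)
  have "\<exists>q. ranks_collapse TYPE('a) m N r q Q" for N
  proof -
    obtain q0 where q0: "levels_collapse TYPE('a) m (Suc N ^ r) r q0 Q"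
      using r[rule_format, of "Suc N ^ r"] by (elim exE)
    define q where "q = q0 + N + r + 1"
    show ?thesis
      unfolding ranks_collapse_def
    proof (intro exI[of _ q] allI impI)
      fix adj :: "'a \<Rightarrow> 'a \<Rightarrow> bool" and X Y P
      assume sym: "\<forall>x y. adj x y \<longrightarrow> adj y x" and fin: "finite X" "finite Y"
        and XY: "X = Y \<or> X \<inter> Y = {}"
        and empty: "rk adj N r X m = {}" "rk adj N r Y m = {}" and P: "P \<subseteq> X \<times> Y"
        and bf: "bf (\<lambda>a b. (adj a b, 0 :: nat)) q (6 * m) X Y P"
      define lev where "lev x = rank_level adj N r (if x \<in> X then X else Y) x" for x
      have levX: "lev x = rank_level adj N r X x" if "x \<in> X" for x using that by (simp add: lev_def)
      have levY: "lev x = rank_level adj N r Y x" if "x \<in> Y" for x using that XY by (auto simp: lev_def)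
      have sym': "\<And>x y. adj x y \<Longrightarrow> adj y x" using sym by blast
      interpret lev_graph adj lev by unfold_locales (rule sym')
      have bfq: "bf lab q (4 * m) X Y P"
        by (rule bf_relabel[OF sym' _ _ empty levX levY _ P]) (use bf in \<open>simp_all add: q_def\<close>)
      have bf': "bf lab q0 (4 * m + 0) X Y P"
        using bf_le_size[OF bfq, of q0] by (simp add: q_def)
      \<comment> \<open>Matched elements are recognised without any further round, so the constants
        leave the carriers for free. The levels are still those computed in all of \<open>X\<close>
        and \<open>Y\<close>.\<close>
      have "bf lab q0 (4 * m) (X - Domain P) (Y - Range P) P"
      proof (rule bf_restrict[OF bf'])
        fix x y assume xy: "x \<in> X" "y \<in> Y" "bf lab q0 0 X Y (insert (x, y) P)"
        have p: "piso lab (insert (x, y) P)" using xy(3) by simp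
        have "x = a \<longleftrightarrow> y = b" if "(a, b) \<in> P" for a b
          using pisoD(1)[OF p, of x y a b] that by simp
        then show "x \<in> X - Domain P \<longleftrightarrow> y \<in> Y - Range P" using xy by blast
      qed auto
      moreover have lb: "level_bounded adj lev m (Suc N ^ r) r X" "level_bounded adj lev m (Suc N ^ r) r Y"
        by (rule level_bounded_rank_level[OF fin(1) empty(1) levX] level_bounded_rank_level[OF fin(2) empty(2) levY], assumption)+
      have lbX: "level_bounded adj lev m (Suc N ^ r) r (X - Domain P)"
        by (rule level_bounded_subset[OF lb(1)]) (use level_boundedD(1)[OF lb(1)] in simp_all)
      have lbY: "level_bounded adj lev m (Suc N ^ r) r (Y - Range P)"
        by (rule level_bounded_subset[OF lb(2)]) (use level_boundedD(1)[OF lb(2)] in simp_all)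
      ultimately have "bf lab 1 Q (X - Domain P) (Y - Range P) P"
        by (intro q0[unfolded levels_collapse_def, rule_format, OF lev_graph_axioms lbX lbY]) auto
      from bf_extend[OF this subset_refl]
      have "bf lab 1 Q (X - Domain P \<union> Domain P) (Y - Range P \<union> Range P) P" .
      moreover have "Domain P \<subseteq> X" "Range P \<subseteq> Y" using P by auto
      ultimately have "bf lab 1 Q X Y P" by (simp add: Un_absorb2)
      then show "bf (\<lambda>a b. (adj a b, 0 :: nat)) 1 Q X Y P" by (rule bf_forget)
    qed
  qed
  then show ?thesis by (rule exI[of _ r, OF allI])
qed

section \<open>Trees embed at vertices of large rank\<close>

lemma pair_graph_iff:
  "pair_graph G \<longleftrightarrow> finite (pverts G) \<and>
    (\<forall>u v. (u, v) \<in> parcs G \<longrightarrow> u \<in> pverts G \<and> v \<in> pverts G \<and> u \<noteq> v \<and> (v, u) \<in> parcs G)"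
proof
  assume "pair_graph G"
  then interpret pair_graph G .
  show "finite (pverts G) \<and>
    (\<forall>u v. (u, v) \<in> parcs G \<longrightarrow> u \<in> pverts G \<and> v \<in> pverts G \<and> u \<noteq> v \<and> (v, u) \<in> parcs G)"
    using pair_finite_verts in_arcsD1 in_arcsD2 no_loops' arcs_symmetric by blast
next
  assume G: "finite (pverts G) \<and>
    (\<forall>u v. (u, v) \<in> parcs G \<longrightarrow> u \<in> pverts G \<and> v \<in> pverts G \<and> u \<noteq> v \<and> (v, u) \<in> parcs G)"
  then have "parcs G \<subseteq> pverts G \<times> pverts G" by auto
  then have "finite (parcs G)" using G finite_subset by blast
  moreover have "symmetric (with_proj G)" using G by (auto simp: symmetric_def sym_def)
  ultimately show "pair_graph G" using G by unfold_locales auto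
qed

lemma vpath_iff:
  "vpath p (with_proj G) \<longleftrightarrow>
    p \<noteq> [] \<and> distinct p \<and> set p \<subseteq> pverts G \<and> set (vwalk_arcs p) \<subseteq> parcs G"
  by (auto simp: vpath_def vwalk_def)

lemma subgraph_iff:
  assumes "pair_graph G" "pair_graph H"
  shows "subgraph (with_proj H) (with_proj G) \<longleftrightarrow> pverts H \<subseteq> pverts G \<and> parcs H \<subseteq> parcs G"
proof -
  interpret G: pair_graph G by (rule assms)
  interpret H: pair_graph H by (rule assms)
  show ?thesis
    unfolding subgraph_def using G.wf_digraph_axioms H.wf_digraph_axioms by auto
qed

lemma vwalk_arcs_in_set: "(a, b) \<in> set (vwalk_arcs p) \<Longrightarrow> a \<in> set p \<and> b \<in> set p"
  by (induction p rule: vwalk_arcs.induct) auto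

lemma set_vwalk_arcs_rev: "set (vwalk_arcs (rev p)) = (set (vwalk_arcs p))\<inverse>"
proof (induction p rule: vwalk_arcs.induct)
  case (3 x y xs)
  have "set (vwalk_arcs (rev (y # xs) @ [x])) =
      insert (last (rev (y # xs)), x) (set (vwalk_arcs (rev (y # xs))))"
    by (rule set_vwalk_arcs_snoc) simp
  then show ?case using 3 by (auto simp: last_rev)
qed auto

lemma internal_verts_rev: "internal_verts (rev p) = rev (internal_verts p)"
proof -
  have "tl (rev p) = rev (butlast p)" by (metis butlast_rev rev_rev_ident)
  then show ?thesis by (simp add: internal_verts_def butlast_rev butlast_tl)
qed

lemma set_internal_verts: "distinct p \<Longrightarrow> set (internal_verts p) \<subseteq> set p - {hd p, last p}"
  by (cases p; cases "tl p" rule: rev_cases) (auto simp: internal_verts_def)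

lemma set_subset_internal_verts: "p \<noteq> [] \<Longrightarrow> set p \<subseteq> {hd p, last p} \<union> set (internal_verts p)"
  by (cases p; cases "tl p" rule: rev_cases) (auto simp: internal_verts_def)

lemma near_imp_path:
  "near adj A n x y \<Longrightarrow> \<exists>p. p \<noteq> [] \<and> hd p = x \<and> last p = y \<and> set p \<subseteq> A \<and> distinct p \<and>
    length p \<le> n + 1 \<and> set (vwalk_arcs p) \<subseteq> {(a, b). adj a b}"
proof (induction n arbitrary: x)
  case 0
  then show ?case by (intro exI[of _ "[x]"]) auto
next
  case (Suc n)
  from Suc.prems consider "near adj A n x y" | z where "x \<in> A" "adj x z" "near adj A n z y"
    unfolding near.simps by blast
  then show ?case
  proof cases
    case 1
    then obtain p where "p \<noteq> [] \<and> hd p = x \<and> last p = y \<and> set p \<subseteq> A \<and> distinct p \<and>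
      length p \<le> n + 1 \<and> set (vwalk_arcs p) \<subseteq> {(a, b). adj a b}" using Suc.IH by blast
    then show ?thesis by (intro exI[of _ p]) auto
  next
    case 2
    then obtain p where p: "p \<noteq> []" "hd p = z" "last p = y" "set p \<subseteq> A" "distinct p"
      "length p \<le> n + 1" "set (vwalk_arcs p) \<subseteq> {(a, b). adj a b}" using Suc.IH by blast
    show ?thesis
    proof (cases "x \<in> set p")
      case True
      then obtain ys zs where "p = ys @ x # zs" using split_list by metis
      then show ?thesis using p set_vwalk_arcs_append2[of "x # zs" ys]
        by (intro exI[of _ "x # zs"]) auto
    next
      case False
      then show ?thesis using p 2 by (intro exI[of _ "x # p"]) auto
    qed
  qed
qed

text \<open>A neighbour of the end must lie on the path, for otherwise the path could be extended,
  and it must be the predecessor of the end, for otherwise it closes a cycle.\<close>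

lemma undirected_tree_neighbour_of_longest:
  assumes T: "undirected_tree T" and p: "vpath p (with_proj T)"
    and max: "\<And>u. \<not> vpath (p @ [u]) (with_proj T)"
    and y: "(last p, y) \<in> parcs T"
  shows "\<exists>as. p = as @ [y, last p]"
proof -
  have G: "pair_graph T" and acyc: "\<And>c. \<not> undirected_cycle T c"
    using T by (auto simp: undirected_tree_def)
  have pne: "p \<noteq> []" using p by (simp add: vpath_iff)
  have yV: "y \<in> pverts T" and ne: "y \<noteq> last p" using G y unfolding pair_graph_iff by blast+
  have yp: "y \<in> set p"
  proof (rule ccontr)
    assume "y \<notin> set p"
    then have "vpath (p @ [y]) (with_proj T)"
      using p y yV pne by (auto simp: vpath_iff set_vwalk_arcs_snoc)
    then show False using max by blast
  qed
  then obtain as bs where ab: "p = as @ y # bs" using split_list by metis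
  have bs: "bs \<noteq> []" using ab ne by auto
  have "length bs = 1"
  proof (rule ccontr)
    assume "length bs \<noteq> 1"
    then have "length (y # bs) \<ge> 3" using bs by (cases bs; cases "tl bs") auto
    moreover have "vpath (y # bs) (with_proj T)"
      using p ab set_vwalk_arcs_append2[of "y # bs" as] by (auto simp: vpath_iff)
    moreover have "(last (y # bs), hd (y # bs)) \<in> parcs T" using y ab by simp
    ultimately show False using acyc unfolding undirected_cycle_def by blast
  qed
  then obtain b where "bs = [b]" by (cases bs) auto
  then show ?thesis using ab by (intro exI[of _ as]) simp
qed

text \<open>\<open>rooted_depth\<close> measures only paths that end in a leaf. A longest path from
  the root does end in one.\<close>

lemma vpath_length_le_rooted_depth:
  assumes T: "undirected_tree T" and p: "vpath p (with_proj T)" "hd p = r"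
  shows "length p \<le> rooted_depth T r"
proof -
  have G: "pair_graph T" using T by (auto simp: undirected_tree_def)
  then have fin: "finite (pverts T)" by (simp add: pair_graph_iff)
  have bound: "length q \<le> card (pverts T)" if "vpath q (with_proj T)" for q
    using that fin by (metis vpath_iff distinct_card card_mono)
  obtain q where q: "vpath q (with_proj T) \<and> hd q = r"
    and max: "\<And>q'. vpath q' (with_proj T) \<and> hd q' = r \<Longrightarrow> length q' \<le> length q"
    using ex_has_greatest_nat[of "\<lambda>q. vpath q (with_proj T) \<and> hd q = r" p length "Suc (card (pverts T))"]
      p bound by (metis less_Suc_eq_le)
  have qne: "q \<noteq> []" using q by (simp add: vpath_iff)
  have max': "\<not> vpath (q @ [u]) (with_proj T)" for u
    using max[of "q @ [u]"] q qne by auto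
  note nb = undirected_tree_neighbour_of_longest[OF T conjunct1[OF q] max']
  have "tree_leaf T r (last q)"
    unfolding tree_leaf_def
  proof (intro conjI notI)
    show "last q \<in> pverts T" using q qne by (auto simp: vpath_iff)
    assume "\<exists>u. tree_child T r (last q) u"
    then obtain u s where s: "vpath (s @ [last q, u]) (with_proj T)" "hd (s @ [last q, u]) = r"
      unfolding tree_child_def by blast
    have "(last q, u) \<in> parcs T"
      using s(1) set_vwalk_arcs_append2[of "[last q, u]" s] by (auto simp: vpath_iff)
    then obtain as where as: "q = as @ [u, last q]" using nb by blast
    have "s \<noteq> []"
    proof
      assume "s = []"
      then have "hd q = last q" using s(2) q by simp
      moreover have "hd q \<in> set (as @ [u])" by (subst as) (cases as; simp)
      moreover have "distinct (as @ [u, last q])" using q as by (metis vpath_iff)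
      ultimately show False by auto
    qed
    then obtain s' x where sx: "s = s' @ [x]" by (cases s rule: rev_cases) auto
    have "(x, last q) \<in> parcs T"
      using s(1) set_vwalk_arcs_append2[of "[x, last q, u]" s'] by (auto simp: vpath_iff sx)
    then have "(last q, x) \<in> parcs T" using G unfolding pair_graph_iff by blast
    then obtain bs where "q = bs @ [x, last q]" using nb by blast
    \<comment> \<open>The child \<open>u\<close> of the end and the vertex \<open>x\<close> before
      the end on the path to \<open>u\<close> are both neighbours of the end, hence both equal its
      predecessor on \<open>q\<close>.\<close>
    then have "x = u" using as by (metis append1_eq_conv append.assoc append_Cons append_Nil)
    then show False using s(1) by (auto simp: vpath_iff sx)
  qed
  then have "length q \<in> {length p | p. root_leaf_path T r p}"
    using q by (auto simp: root_leaf_path_def)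
  moreover have "finite {length p | p. root_leaf_path T r p}"
    by (rule finite_subset[of _ "{..card (pverts T)}"]) (use bound in \<open>auto simp: root_leaf_path_def\<close>)
  ultimately have "length q \<le> rooted_depth T r" unfolding rooted_depth_def by (rule Max_ge[rotated])
  then show ?thesis using max[of p] p by simp
qed

section \<open>Greedy embedding of a tree along the ranks\<close>

lemma connected_boundary:
  assumes G: "pair_graph T" and conn: "Digraph_Component.connected (with_proj T)"
    and W: "W \<subseteq> pverts T" "r \<in> W" "W \<noteq> pverts T"
  shows "\<exists>v\<in>W. \<exists>w\<in>pverts T - W. (v, w) \<in> parcs T"
proof (rule ccontr)
  assume none: "\<not> ?thesis"
  obtain x where x: "x \<in> pverts T" "x \<notin> W" using W by blast
  have "(r, x) \<in> rtrancl_on (pverts T) (parcs (mk_symmetric (with_proj T)))"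
    using conn x(1) W unfolding connected_def strongly_connected_def reachable_def by auto
  moreover have "parcs (mk_symmetric (with_proj T)) = parcs T"
    using G unfolding parcs_mk_symmetric pair_graph_iff by auto
  ultimately have "(r, x) \<in> rtrancl_on (pverts T) (parcs T)" by simp
  then have "x \<in> W"
  proof (induction rule: rtrancl_on_induct)
    case base
    then show ?case using W by simp
  next
    case (step y z)
    then show ?case using none by blast
  qed
  then show False using x by simp
qed

text \<open>\<open>U\<close> is the set of vertices used so far, at most \<open>R + 1\<close> for
  each embedded tree vertex. The rank \<open>d - length p\<close> is what the levels below still
  require. Connectedness of \<open>W\<close> is recorded because it leaves a new vertex only one
  neighbour in \<open>W\<close>.\<close>

definition partial_embedding ::
  "'b pair_pre_digraph \<Rightarrow> 'b \<Rightarrow> ('a \<Rightarrow> 'a \<Rightarrow> bool) \<Rightarrow> nat \<Rightarrow> nat \<Rightarrow> 'a set \<Rightarrow> nat \<Rightarrow>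
    'b set \<Rightarrow> ('b \<Rightarrow> 'a) \<Rightarrow> ('b \<Rightarrow> 'b \<Rightarrow> 'a list) \<Rightarrow> 'a set \<Rightarrow> bool" where
  "partial_embedding T r0 adj N R V d W f P U \<longleftrightarrow>
     r0 \<in> W \<and> W \<subseteq> pverts T \<and> finite U \<and> U \<subseteq> V \<and> card U \<le> card W * (R + 1) \<and>
     f ` W \<subseteq> U \<and> inj_on f W \<and>
     (\<forall>v\<in>W. \<exists>p. vpath p (with_proj T) \<and> hd p = r0 \<and> last p = v \<and> set p \<subseteq> W \<and>
        f v \<in> rk adj N R V (d - length p)) \<and>
     (\<forall>u\<in>W. \<forall>v\<in>W. \<exists>p. vpath p (with_proj T) \<and> hd p = u \<and> last p = v \<and> set p \<subseteq> W) \<and>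
     (\<forall>u\<in>W. \<forall>v\<in>W. (u, v) \<in> parcs T \<longrightarrow>
        P u v \<noteq> [] \<and> distinct (P u v) \<and> set (P u v) \<subseteq> U \<and>
        set (vwalk_arcs (P u v)) \<subseteq> {(a, b). adj a b} \<and> hd (P u v) = f u \<and> last (P u v) = f v \<and>
        P v u = rev (P u v) \<and> length (internal_verts (P u v)) \<le> R \<and>
        set (internal_verts (P u v)) \<inter> f ` W = {}) \<and>
     (\<forall>u\<in>W. \<forall>v\<in>W. \<forall>x\<in>W. \<forall>y\<in>W. (u, v) \<in> parcs T \<longrightarrow> (x, y) \<in> parcs T \<longrightarrow> {u, v} \<noteq> {x, y} \<longrightarrow>
        set (internal_verts (P u v)) \<inter> set (internal_verts (P x y)) = {})"

text \<open>The used vertices other than \<open>f v\<close> form a set too small to separate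
  \<open>f v\<close> from the vertices of the next lower rank, so a short path that avoids them
  leads to an image for \<open>w\<close>.\<close>

lemma partial_embedding_step:
  assumes T: "undirected_tree T" and sym: "\<And>x y. adj x y \<Longrightarrow> adj y x"
    and emb: "partial_embedding T r0 adj N R V d W f P U"
    and depth: "\<And>p. vpath p (with_proj T) \<Longrightarrow> hd p = r0 \<Longrightarrow> length p \<le> d"
    and N: "card (pverts T) * (R + 1) \<le> N"
    and vw: "v \<in> W" "w \<in> pverts T" "w \<notin> W" "(v, w) \<in> parcs T"
  shows "\<exists>f P U. partial_embedding T r0 adj N R V d (insert w W) f P U"
proof -
  have G: "pair_graph T" and acyc: "\<And>c. \<not> undirected_cycle T c"
    using T by (auto simp: undirected_tree_def)
  have finT: "finite (pverts T)" and
    Tsym: "\<And>a b. (a, b) \<in> parcs T \<Longrightarrow> (b, a) \<in> parcs T" and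
    Tirr: "\<And>a. (a, a) \<notin> parcs T"
    using G unfolding pair_graph_iff by blast+
  note D = emb[unfolded partial_embedding_def]
  note r0 = D[THEN conjunct1]
  note W = D[THEN conjunct2, THEN conjunct1]
  note U1 = D[THEN conjunct2, THEN conjunct2, THEN conjunct1]
  note U2 = D[THEN conjunct2, THEN conjunct2, THEN conjunct2, THEN conjunct1]
  note U3 = D[THEN conjunct2, THEN conjunct2, THEN conjunct2, THEN conjunct2, THEN conjunct1]
  note fU = D[THEN conjunct2, THEN conjunct2, THEN conjunct2, THEN conjunct2, THEN conjunct2, THEN conjunct1]
  note inj = D[THEN conjunct2, THEN conjunct2, THEN conjunct2, THEN conjunct2, THEN conjunct2, THEN conjunct2, THEN conjunct1]
  note root = D[THEN conjunct2, THEN conjunct2, THEN conjunct2, THEN conjunct2, THEN conjunct2, THEN conjunct2, THEN conjunct2, THEN conjunct1]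
  note conn = D[THEN conjunct2, THEN conjunct2, THEN conjunct2, THEN conjunct2, THEN conjunct2, THEN conjunct2, THEN conjunct2, THEN conjunct2, THEN conjunct1]
  note PP = D[THEN conjunct2, THEN conjunct2, THEN conjunct2, THEN conjunct2, THEN conjunct2, THEN conjunct2, THEN conjunct2, THEN conjunct2, THEN conjunct2, THEN conjunct1]
  note disj = D[THEN conjunct2, THEN conjunct2, THEN conjunct2, THEN conjunct2, THEN conjunct2, THEN conjunct2, THEN conjunct2, THEN conjunct2, THEN conjunct2, THEN conjunct2]
  note U = U1 U2 U3
  have finW: "finite W" using W finT finite_subset by blast
  \<comment> \<open>A second neighbour of \<open>w\<close> in \<open>W\<close> would close a cycle
    with a path inside \<open>W\<close>.\<close>
  have only_v: "v' = v" if v': "v' \<in> W" "(v', w) \<in> parcs T \<or> (w, v') \<in> parcs T" for v'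
  proof (rule ccontr)
    assume ne: "v' \<noteq> v"
    obtain q where q: "vpath q (with_proj T)" "hd q = v'" "last q = v" "set q \<subseteq> W"
      using conn[rule_format, OF v'(1) vw(1)] by (elim exE conjE)
    have qne: "q \<noteq> []" using q by (simp add: vpath_iff)
    have "length q \<ge> 2" using q(2,3) ne qne by (cases q; cases "tl q") auto
    then have "length (q @ [w]) \<ge> 3" by simp
    moreover have "w \<notin> set q" using q(4) vw(3) by blast
    then have "vpath (q @ [w]) (with_proj T)"
      using q(1,3) vw(2,4) qne by (simp add: vpath_iff set_vwalk_arcs_snoc)
    moreover have "(w, v') \<in> parcs T" using v'(2) Tsym by blast
    then have "(last (q @ [w]), hd (q @ [w])) \<in> parcs T" using q(2) qne by simp
    ultimately have "undirected_cycle T (q @ [w])" unfolding undirected_cycle_def by blast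
    then show False using acyc by blast
  qed
  obtain pv where pv: "vpath pv (with_proj T)" "hd pv = r0" "last pv = v" "set pv \<subseteq> W"
    "f v \<in> rk adj N R V (d - length pv)"
    using root[rule_format, OF vw(1)] by (elim exE conjE)
  have pvne: "pv \<noteq> []" using pv by (simp add: vpath_iff)
  have "w \<notin> set pv" using pv(4) vw(3) by blast
  then have pvw: "vpath (pv @ [w]) (with_proj T)"
    using pv(1,3) vw(2,4) pvne by (simp add: vpath_iff set_vwalk_arcs_snoc)
  then have "length (pv @ [w]) \<le> d" by (rule depth) (use pv(2) pvne in simp)
  \<comment> \<open>The path to \<open>w\<close> still fits into the depth, so the rank recorded for
    \<open>f v\<close> is positive.\<close>
  then have dl: "d - length pv = Suc (d - length (pv @ [w]))" by simp
  define S where "S = U - {f v}"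
  have "card S \<le> N"
  proof -
    have "card S \<le> card U" using U(1) by (auto simp: S_def intro: card_mono)
    also have "\<dots> \<le> card W * (R + 1)" by (rule U(3))
    also have "\<dots> \<le> card (pverts T) * (R + 1)" by (rule mult_le_mono1[OF card_mono[OF finT W]])
    finally show ?thesis using N by simp
  qed
  moreover have "S \<subseteq> V" "finite S" "f v \<notin> S" using U by (auto simp: S_def)
  ultimately obtain u where u: "u \<in> rk adj N R V (d - length (pv @ [w]))" "u \<noteq> f v"
    "near adj (V - S) R (f v) u"
    using pv(5)[unfolded dl rk_Suc_iff, THEN conjunct2, rule_format] by metis
  obtain p where p: "p \<noteq> []" "hd p = f v" "last p = u" "set p \<subseteq> V - S" "distinct p"
    "length p \<le> R + 1" "set (vwalk_arcs p) \<subseteq> {(a, b). adj a b}"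
    using near_imp_path[OF u(3)] by blast
  have fvU: "f v \<in> U" using fU vw(1) by blast
  have up: "u \<in> set p" using p(1,3) by auto
  have uU: "u \<notin> U" using up p(4) u(2) by (auto simp: S_def)
  have pU: "set p \<inter> U \<subseteq> {f v}" using p(4) by (auto simp: S_def)
  have intp: "set (internal_verts p) \<subseteq> set p - {f v, u}" using set_internal_verts[OF p(5)] p(2,3) by simp
  have lenp: "length (internal_verts p) \<le> R" using p(6) by (simp add: internal_verts_def)
  define f' where "f' = f(w := u)"
  define P' where "P' a b = (if a = v \<and> b = w then p else if a = w \<and> b = v then rev p else P a b)" for a b
  define U' where "U' = U \<union> set p"
  have vneqw: "v \<noteq> w" using vw by blast
  have f'W: "f' a = f a" if "a \<in> W" for a using that vw(3) by (auto simp: f'_def)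
  have f'w: "f' w = u" by (simp add: f'_def)
  have imf': "f' ` insert w W = insert u (f ` W)" 
    using image_cong[OF refl f'W, of W "\<lambda>a. a"] by (simp add: f'w)
  have P'old: "P' a b = P a b" if "a \<in> W" "b \<in> W" for a b
  proof -
    have "a \<noteq> w" "b \<noteq> w" using that vw(3) by auto
    then show ?thesis by (simp add: P'_def)
  qed
  have P'new: "P' v w = p" "P' w v = rev p" using vneqw by (auto simp: P'_def)
  have arcs: "(a \<in> W \<and> b \<in> W) \<or> (a = v \<and> b = w) \<or> (a = w \<and> b = v)"
    if ab: "(a, b) \<in> parcs T" "a \<in> insert w W" "b \<in> insert w W" for a b
  proof (cases "a = w")
    case True
    then have "b \<in> W" using ab Tirr[of w] by auto
    then show ?thesis using only_v[of b] ab(1) True by simp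
  next
    case False
    then have "a \<in> W" using ab(2) by simp
    then show ?thesis using only_v[of a] ab(1,3) by auto
  qed
  have intP: "set (internal_verts (P a b)) \<subseteq> U" if "a \<in> W" "b \<in> W" "(a, b) \<in> parcs T" for a b
    using set_internal_verts[of "P a b"] PP[rule_format, OF that] by blast
  have intpU: "set (internal_verts p) \<inter> U = {}" using intp pU by blast
  have intrev: "set (internal_verts (rev p)) = set (internal_verts p)" by (simp add: internal_verts_rev)
  have "partial_embedding T r0 adj N R V d (insert w W) f' P' U'"
    unfolding partial_embedding_def
  proof (intro conjI ballI impI)
    show "r0 \<in> insert w W" using r0 by simp
    show "insert w W \<subseteq> pverts T" using W vw by simp
    show "finite U'" using U by (simp add: U'_def)
    show "U' \<subseteq> V" using U p(4) by (auto simp: U'_def)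
    have "card U' \<le> card U + card (set p)" unfolding U'_def by (rule card_Un_le)
    also have "\<dots> \<le> card W * (R + 1) + (R + 1)" using U(3) p(6) distinct_card[OF p(5)] by simp
    finally show "card U' \<le> card (insert w W) * (R + 1)" using finW vw(3) by simp
    show "f' ` insert w W \<subseteq> U'" unfolding imf' using fU up by (auto simp: U'_def)
    show "inj_on f' (insert w W)"
      using inj f'W f'w uU fU unfolding inj_on_def by (metis image_subset_iff insertE)
  next
    fix a assume a: "a \<in> insert w W"
    show "\<exists>p. vpath p (with_proj T) \<and> hd p = r0 \<and> last p = a \<and> set p \<subseteq> insert w W \<and>
        f' a \<in> rk adj N R V (d - length p)"
    proof (cases "a = w")
      case True
      then show ?thesis using pvw pv(2,4) pvne u(1) f'w by (intro exI[of _ "pv @ [w]"]) auto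
    next
      case False
      then have aW: "a \<in> W" using a by simp
      show ?thesis using root[rule_format, OF aW] f'W[OF aW] by (metis subset_insertI2)
    qed
  next
    fix a b assume ab: "a \<in> insert w W" "b \<in> insert w W"
    show "\<exists>p. vpath p (with_proj T) \<and> hd p = a \<and> last p = b \<and> set p \<subseteq> insert w W"
    proof (cases "a = w")
      case True
      show ?thesis
      proof (cases "b = w")
        case True
        then show ?thesis using \<open>a = w\<close> vw by (intro exI[of _ "[w]"]) (auto simp: vpath_iff)
      next
        case False
        then have bW: "b \<in> W" using ab(2) by simp
        obtain q where q: "vpath q (with_proj T)" "hd q = v" "last q = b" "set q \<subseteq> W"
          using conn[rule_format, OF vw(1) bW] by (elim exE conjE)
        have "w \<notin> set q" using q(4) vw(3) by blast
        then have "vpath (w # q) (with_proj T)"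
          using q(1,2) Tsym[OF vw(4)] vw(2) by (simp add: vpath_iff)
        then show ?thesis using \<open>a = w\<close> q by (intro exI[of _ "w # q"]) (auto simp: vpath_iff)
      qed
    next
      case False
      then have aW: "a \<in> W" using ab by simp
      show ?thesis
      proof (cases "b = w")
        case True
        obtain q where q: "vpath q (with_proj T)" "hd q = a" "last q = v" "set q \<subseteq> W"
          using conn[rule_format, OF aW vw(1)] by (elim exE conjE)
        have "w \<notin> set q" using q(4) vw(3) by blast
        then have "vpath (q @ [w]) (with_proj T)"
          using q(1,3) vw(2,4) by (simp add: vpath_iff set_vwalk_arcs_snoc)
        then show ?thesis using True q by (intro exI[of _ "q @ [w]"]) (auto simp: vpath_iff)
      next
        case False
        then have bW: "b \<in> W" using ab by simp
        show ?thesis using conn[rule_format, OF aW bW] by (metis subset_insertI2)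
      qed
    qed
  next
    fix a b assume ab: "a \<in> insert w W" "b \<in> insert w W" "(a, b) \<in> parcs T"
    let ?ok = "P' a b \<noteq> [] \<and> distinct (P' a b) \<and> set (P' a b) \<subseteq> U' \<and>
      set (vwalk_arcs (P' a b)) \<subseteq> {(a, b). adj a b} \<and> hd (P' a b) = f' a \<and> last (P' a b) = f' b \<and>
      P' b a = rev (P' a b) \<and> length (internal_verts (P' a b)) \<le> R \<and>
      set (internal_verts (P' a b)) \<inter> f' ` insert w W = {}"
    from arcs[OF ab(3,1,2)] consider "a \<in> W" "b \<in> W" | "a = v" "b = w" | "a = w" "b = v" by blast
    then have ok: ?ok
    proof cases
      case 1
      have "u \<notin> set (internal_verts (P a b))" using intP[OF 1 ab(3)] uU by blast
      then show ?thesis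
        using PP[rule_format, OF 1 ab(3)] unfolding imf' P'old[OF 1] P'old[OF 1(2,1)] f'W[OF 1(1)] f'W[OF 1(2)] U'_def
        by auto
    next
      case 2
      have "set (internal_verts p) \<inter> insert u (f ` W) = {}" using intp intpU fU by blast
      then show ?thesis
        unfolding 2 P'new imf' f'w f'W[OF vw(1)] U'_def using p lenp by auto
    next
      case 3
      have "set (internal_verts p) \<inter> insert u (f ` W) = {}" using intp intpU fU by blast
      moreover have "set (vwalk_arcs (rev p)) \<subseteq> {(a, b). adj a b}"
        unfolding set_vwalk_arcs_rev using p(7) sym by auto
      ultimately show ?thesis
        unfolding 3 P'new imf' f'w f'W[OF vw(1)] U'_def intrev
        using p lenp by (auto simp: hd_rev last_rev internal_verts_rev)
    qed
    show "P' a b \<noteq> []" "distinct (P' a b)" "set (P' a b) \<subseteq> U'"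
      "set (vwalk_arcs (P' a b)) \<subseteq> {(a, b). adj a b}" "hd (P' a b) = f' a" "last (P' a b) = f' b"
      "P' b a = rev (P' a b)" "length (internal_verts (P' a b)) \<le> R"
      "set (internal_verts (P' a b)) \<inter> f' ` insert w W = {}"
      using ok by blast+
  next
    fix a b c d'
    assume ab: "a \<in> insert w W" "b \<in> insert w W" "(a, b) \<in> parcs T"
      and cd: "c \<in> insert w W" "d' \<in> insert w W" "(c, d') \<in> parcs T"
      and ne: "{a, b} \<noteq> {c, d'}"
    have key: "set (internal_verts (P' a b)) = set (internal_verts p) \<and> {a, b} = {v, w} \<or>
        a \<in> W \<and> b \<in> W \<and> P' a b = P a b" if "a \<in> insert w W" "b \<in> insert w W" "(a, b) \<in> parcs T" for a b
      using arcs[OF that(3,1,2)] P'old P'new intrev by auto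
    from key[OF ab] key[OF cd] ne
    consider "a \<in> W" "b \<in> W" "P' a b = P a b" "c \<in> W" "d' \<in> W" "P' c d' = P c d'"
      | "a \<in> W" "b \<in> W" "P' a b = P a b" "set (internal_verts (P' c d')) = set (internal_verts p)"
      | "c \<in> W" "d' \<in> W" "P' c d' = P c d'" "set (internal_verts (P' a b)) = set (internal_verts p)"
      by metis
    then show "set (internal_verts (P' a b)) \<inter> set (internal_verts (P' c d')) = {}"
    proof cases
      case 1
      then show ?thesis using disj[rule_format, OF 1(1,2,4,5) ab(3) cd(3) ne] by simp
    next
      case 2
      then show ?thesis using intP[OF 2(1,2) ab(3)] intpU by auto
    next
      case 3
      then show ?thesis using intP[OF 3(1,2) cd(3)] intpU by auto
    qed
  qed
  then show ?thesis by blast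
qed

text \<open>Depth counts vertices, so the image of the root of a tree of depth \<open>d\<close>
  needs rank \<open>d - 1\<close>. The tree is then embedded by repeatedly adding a boundary vertex
  of the part already placed.\<close>

lemma rk_imp_shallow_top_minor:
  assumes T: "undirected_tree T" and r0: "r0 \<in> pverts T" and G: "pair_graph G"
    and x0: "x0 \<in> rk (\<lambda>x y. (x, y) \<in> parcs G) N R (pverts G) (rooted_depth T r0 - 1)"
    and N: "card (pverts T) * (R + 1) \<le> N"
  shows "shallow_top_minor R T G"
proof -
  define adj where "adj x y \<longleftrightarrow> (x, y) \<in> parcs G" for x y
  define V where "V = pverts G"
  define d where "d = rooted_depth T r0"
  have sym: "adj x y \<Longrightarrow> adj y x" for x y using G unfolding pair_graph_iff adj_def by blast
  have TG: "pair_graph T" and conn: "Digraph_Component.connected (with_proj T)"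
    using T by (auto simp: undirected_tree_def)
  have finT: "finite (pverts T)" using TG by (simp add: pair_graph_iff)
  have depth: "length p \<le> d" if "vpath p (with_proj T)" "hd p = r0" for p
    unfolding d_def by (rule vpath_length_le_rooted_depth[OF T that])
  have x0': "x0 \<in> rk adj N R V (d - 1)" using x0 by (simp add: adj_def[abs_def] V_def d_def)
  then have x0V: "x0 \<in> V" using rk_antimono[of 0 "d - 1" adj N R V] by auto
  have start: "partial_embedding T r0 adj N R V d {r0} (\<lambda>_. x0) (\<lambda>_ _. []) {x0}"
    unfolding partial_embedding_def
  proof (intro conjI)
    show "\<forall>v\<in>{r0}. \<exists>p. vpath p (with_proj T) \<and> hd p = r0 \<and> last p = v \<and> set p \<subseteq> {r0} \<and>
        x0 \<in> rk adj N R V (d - length p)"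
      using r0 x0' by (intro ballI exI[of _ "[r0]"]) (auto simp: vpath_iff)
    show "\<forall>u\<in>{r0}. \<forall>v\<in>{r0}. \<exists>p. vpath p (with_proj T) \<and> hd p = u \<and> last p = v \<and> set p \<subseteq> {r0}"
      using r0 by (intro ballI exI[of _ "[r0]"]) (auto simp: vpath_iff)
    have "(r0, r0) \<notin> parcs T" using TG unfolding pair_graph_iff by blast
    then show "\<forall>u\<in>{r0}. \<forall>v\<in>{r0}. (u, v) \<in> parcs T \<longrightarrow> [] \<noteq> [] \<and> distinct [] \<and> set [] \<subseteq> {x0} \<and>
        set (vwalk_arcs []) \<subseteq> {(a, b). adj a b} \<and> hd [] = x0 \<and> last [] = x0 \<and> [] = rev [] \<and>
        length (internal_verts []) \<le> R \<and> set (internal_verts []) \<inter> (\<lambda>_. x0) ` {r0} = {}" by simp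
  qed (use r0 x0V in \<open>auto simp: internal_verts_def\<close>)
  have "\<exists>W f P U. partial_embedding T r0 adj N R V d W f P U \<and> card W = Suc k"
    if "Suc k \<le> card (pverts T)" for k
    using that
  proof (induction k)
    case 0
    show ?case using start by (intro exI[of _ "{r0}"] exI conjI) auto
  next
    case (Suc k)
    then obtain W f P U where emb: "partial_embedding T r0 adj N R V d W f P U" and cW: "card W = Suc k"
      by auto
    note D = emb[unfolded partial_embedding_def]
    have W: "W \<subseteq> pverts T" "r0 \<in> W" by (rule D[THEN conjunct2, THEN conjunct1]) (rule D[THEN conjunct1])
    have "W \<noteq> pverts T" using cW Suc.prems by auto
    then obtain v w where "v \<in> W" "w \<in> pverts T" "w \<notin> W" "(v, w) \<in> parcs T"
      using connected_boundary[OF TG conn W] by blast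
    moreover from this obtain f P U where "partial_embedding T r0 adj N R V d (insert w W) f P U"
      using partial_embedding_step[OF T sym emb depth N] by blast
    moreover have "finite W" using W(1) finT finite_subset by blast
    ultimately show ?case using cW by (metis card_insert_disjoint)
  qed
  moreover have "card (pverts T) > 0" using r0 finT card_gt_0_iff by blast
  ultimately obtain W f P U where emb: "partial_embedding T r0 adj N R V d W f P U"
    and cW: "card W = card (pverts T)" by (metis Suc_pred order_refl)
  have "W \<subseteq> pverts T" by (rule emb[unfolded partial_embedding_def, THEN conjunct2, THEN conjunct1])
  then have W: "W = pverts T" using cW card_subset_eq[OF finT] by blast
  note D = emb[unfolded partial_embedding_def W V_def]
  note U1 = D[THEN conjunct2, THEN conjunct2, THEN conjunct1]
  note U2 = D[THEN conjunct2, THEN conjunct2, THEN conjunct2, THEN conjunct1]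
  note fU = D[THEN conjunct2, THEN conjunct2, THEN conjunct2, THEN conjunct2, THEN conjunct2, THEN conjunct1]
  note inj = D[THEN conjunct2, THEN conjunct2, THEN conjunct2, THEN conjunct2, THEN conjunct2, THEN conjunct2, THEN conjunct1]
  note PP = D[THEN conjunct2, THEN conjunct2, THEN conjunct2, THEN conjunct2, THEN conjunct2, THEN conjunct2, THEN conjunct2, THEN conjunct2, THEN conjunct2, THEN conjunct1]
  note disj = D[THEN conjunct2, THEN conjunct2, THEN conjunct2, THEN conjunct2, THEN conjunct2, THEN conjunct2, THEN conjunct2, THEN conjunct2, THEN conjunct2, THEN conjunct2]
  note U = U2 U1
  have Tarc: "u \<in> pverts T \<and> v \<in> pverts T \<and> (v, u) \<in> parcs T" if "(u, v) \<in> parcs T" for u v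
    using TG that unfolding pair_graph_iff by blast
  have P: "P u v \<noteq> []" "distinct (P u v)" "set (P u v) \<subseteq> U" "set (vwalk_arcs (P u v)) \<subseteq> parcs G"
    "hd (P u v) = f u" "last (P u v) = f v" "P v u = rev (P u v)" "length (internal_verts (P u v)) \<le> R"
    "set (internal_verts (P u v)) \<inter> f ` pverts T = {}" if "(u, v) \<in> parcs T" for u v
    using PP[rule_format, OF _ _ that] Tarc[OF that] unfolding adj_def by auto
  define S where "S = \<lparr>pverts = f ` pverts T \<union> (\<Union>(u, v) \<in> parcs T. set (internal_verts (P u v))),
    parcs = (\<Union>(u, v) \<in> parcs T. set (vwalk_arcs (P u v)))\<rparr>"
  have PS: "set (P u v) \<subseteq> pverts S" "set (vwalk_arcs (P u v)) \<subseteq> parcs S" if "(u, v) \<in> parcs T" for u v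
  proof -
    have "set (P u v) \<subseteq> {f u, f v} \<union> set (internal_verts (P u v))"
      using set_subset_internal_verts[OF P(1)[OF that]] P(5,6)[OF that] by simp
    then show "set (P u v) \<subseteq> pverts S" using that Tarc[OF that] by (fastforce simp: S_def)
    show "set (vwalk_arcs (P u v)) \<subseteq> parcs S" using that by (auto simp: S_def)
  qed
  have intU: "set (internal_verts (P u v)) \<subseteq> U" if "(u, v) \<in> parcs T" for u v
    using set_internal_verts[OF P(2)[OF that]] P(3)[OF that] by blast
  have SU: "pverts S \<subseteq> U" using fU by (auto simp: S_def dest!: subsetD[OF intU])
  have SG: "parcs S \<subseteq> parcs G" using P(4) by (fastforce simp: S_def)
  have S: "pair_graph S"
    unfolding pair_graph_iff
  proof (intro conjI allI impI)
    show "finite (pverts S)" using SU U(2) finite_subset by blast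
    fix a b assume "(a, b) \<in> parcs S"
    then obtain u v where uv: "(u, v) \<in> parcs T" "(a, b) \<in> set (vwalk_arcs (P u v))"
      by (auto simp: S_def)
    show "a \<in> pverts S" "b \<in> pverts S" using vwalk_arcs_in_set[OF uv(2)] PS(1)[OF uv(1)] by auto
    show "a \<noteq> b" using P(4)[OF uv(1)] uv(2) G unfolding pair_graph_iff by blast
    have vu: "(v, u) \<in> parcs T" using Tarc[OF uv(1)] by blast
    have "(b, a) \<in> set (vwalk_arcs (P v u))"
      unfolding P(7)[OF uv(1)] set_vwalk_arcs_rev using uv(2) by simp
    then show "(b, a) \<in> parcs S" using PS(2)[OF vu] by blast
  qed
  moreover have "subgraph (with_proj S) (with_proj G)"
    unfolding subgraph_iff[OF G S] using SU U(1) SG by blast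
  moreover have "shallow_subdivision R T S"
    unfolding shallow_subdivision_def
  proof (intro exI conjI)
    show "inj_on f (pverts T)" by (rule inj)
    show "\<forall>(u, v)\<in>parcs T. vpath (P u v) (with_proj S) \<and> hd (P u v) = f u \<and> last (P u v) = f v \<and>
        P v u = rev (P u v) \<and> length (internal_verts (P u v)) \<le> R \<and>
        set (internal_verts (P u v)) \<inter> f ` pverts T = {}"
    proof (clarify, intro conjI)
      fix u v assume uv: "(u, v) \<in> parcs T"
      show "vpath (P u v) (with_proj S)" unfolding vpath_iff using P(1,2)[OF uv] PS[OF uv] by simp
    qed (fact P)+
    show "\<forall>(u, v)\<in>parcs T. \<forall>(x, y)\<in>parcs T. {u, v} \<noteq> {x, y} \<longrightarrow>
        set (internal_verts (P u v)) \<inter> set (internal_verts (P x y)) = {}"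
      using disj Tarc by blast
  qed (simp_all add: S_def)
  ultimately show ?thesis unfolding shallow_top_minor_def by blast
qed

section \<open>Games and formulas\<close>

text \<open>
  All graphs live in one structure, so that a game between two graphs is a game between two subsets.
  The condition \<^const>\<open>pair_graph\<close> makes the relation symmetric on the whole type.
\<close>

definition gadj :: "'a pair_pre_digraph \<times> 'a \<Rightarrow> 'a pair_pre_digraph \<times> 'a \<Rightarrow> bool" where
  "gadj x y \<longleftrightarrow> fst x = fst y \<and> pair_graph (fst x) \<and> (snd x, snd y) \<in> parcs (fst x)"

lemma gadj_sym: "gadj x y \<Longrightarrow> gadj y x"
  by (auto simp: gadj_def pair_graph_iff)

abbreviation gverts :: "'a pair_pre_digraph \<Rightarrow> ('a pair_pre_digraph \<times> 'a) set" where
  "gverts G \<equiv> {G} \<times> pverts G"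

abbreviation glab :: "'a pair_pre_digraph \<times> 'a \<Rightarrow> 'a pair_pre_digraph \<times> 'a \<Rightarrow> bool \<times> nat" where
  "glab \<equiv> \<lambda>x y. (gadj x y, 0)"

primrec qdepth :: "fo \<Rightarrow> nat" where
  "qdepth (Eq x y) = 0"
| "qdepth (Adj x y) = 0"
| "qdepth (Neg \<phi>) = qdepth \<phi>"
| "qdepth (Conj \<phi> \<psi>) = max (qdepth \<phi>) (qdepth \<psi>)"
| "qdepth (Disj \<phi> \<psi>) = max (qdepth \<phi>) (qdepth \<psi>)"
| "qdepth (Exi x \<phi>) = Suc (qdepth \<phi>)"
| "qdepth (Uni x \<phi>) = Suc (qdepth \<phi>)"

text \<open>The predicates are arbitrary, so that the universal quantifier can be treated through
  its negation.\<close>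

lemma bf_ex_iff:
  assumes bf: "bf glab 1 (Suc k) (gverts G) (gverts H) P"
    and step: "\<And>v w. bf glab 1 k (gverts G) (gverts H) (insert ((G, v), (H, w)) P) \<Longrightarrow> A v = B w"
  shows "(\<exists>v\<in>pverts G. A v) = (\<exists>w\<in>pverts H. B w)"
proof
  assume "\<exists>v\<in>pverts G. A v"
  then obtain v where v: "v \<in> pverts G" "A v" by blast
  then have "(G, v) \<in> gverts G" by simp
  then obtain y where "y \<in> gverts H" "bf glab 1 k (gverts G) (gverts H) (insert ((G, v), y) P)"
    by (rule bf_move_one[OF bf]) simp
  then show "\<exists>w\<in>pverts H. B w" using step v(2) by auto
next
  assume "\<exists>w\<in>pverts H. B w"
  then obtain w where w: "w \<in> pverts H" "B w" by blast
  then have "(H, w) \<in> gverts H" by simp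
  then obtain y where y: "y \<in> gverts G" "bf glab 1 k (gverts H) (gverts G) (insert ((H, w), y) (P\<inverse>))"
    by (rule bf_move_one[OF bf_converse[OF bf]]) simp
  obtain v where v: "y = (G, v)" "v \<in> pverts G" using y(1) by auto
  then show "\<exists>v\<in>pverts G. A v" using step[of v w] bf_converse_insert[OF y(2)] w(2) by auto
qed

lemma sat_bf:
  assumes "pair_graph G" "pair_graph H"
  shows "bf glab 1 (qdepth \<phi>) (gverts G) (gverts H) P \<Longrightarrow> (\<And>x. x \<in> fv \<phi> \<Longrightarrow> ((G, s x), (H, t x)) \<in> P) \<Longrightarrow>
    sat G s \<phi> = sat H t \<phi>"
proof (induction \<phi> arbitrary: s t P)
  case (Eq x y)
  then show ?case
    using pisoD(1)[OF bf_imp_piso[OF Eq(1)], of "(G, s x)" "(H, t x)" "(G, s y)" "(H, t y)"] by simp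
next
  case (Adj x y)
  then show ?case
    using pisoD(2)[OF bf_imp_piso[OF Adj(1)], of "(G, s x)" "(H, t x)" "(G, s y)" "(H, t y)"]
    by (simp add: gadj_def assms)
next
  case (Neg \<phi>)
  then show ?case by simp
next
  case (Conj \<phi> \<psi>)
  have "bf glab 1 (qdepth \<phi>) (gverts G) (gverts H) P" "bf glab 1 (qdepth \<psi>) (gverts G) (gverts H) P"
    by (rule bf_le_rounds[OF Conj.prems(1)], simp)+
  then show ?case using Conj.IH(1)[of P s t] Conj.IH(2)[of P s t] Conj.prems(2) by simp
next
  case (Disj \<phi> \<psi>)
  have "bf glab 1 (qdepth \<phi>) (gverts G) (gverts H) P" "bf glab 1 (qdepth \<psi>) (gverts G) (gverts H) P"
    by (rule bf_le_rounds[OF Disj.prems(1)], simp)+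
  then show ?case using Disj.IH(1)[of P s t] Disj.IH(2)[of P s t] Disj.prems(2) by simp
next
  case (Exi x \<phi>)
  have "bf glab 1 (Suc (qdepth \<phi>)) (gverts G) (gverts H) P" using Exi.prems(1) by simp
  then show ?case
    unfolding sat.simps by (rule bf_ex_iff) (rule Exi.IH, use Exi.prems(2) in auto)
next
  case (Uni x \<phi>)
  have "bf glab 1 (Suc (qdepth \<phi>)) (gverts G) (gverts H) P" using Uni.prems(1) by simp
  then have "(\<exists>v\<in>pverts G. \<not> sat G (s(x := v)) \<phi>) = (\<exists>w\<in>pverts H. \<not> sat H (t(x := w)) \<phi>)"
    by (rule bf_ex_iff) (rule arg_cong[of _ _ Not], rule Uni.IH, use Uni.prems(2) in auto)
  then show ?case by auto
qed

lemma near_gadj: "near gadj ({G} \<times> A) n (G, x) p \<Longrightarrow> \<exists>y. p = (G, y) \<and> near (\<lambda>x y. (x, y) \<in> parcs G) A n x y"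
proof (induction n arbitrary: x)
  case 0
  then show ?case by auto
next
  case (Suc n)
  from Suc.prems consider "near gadj ({G} \<times> A) n (G, x) p"
    | z where "x \<in> A" "gadj (G, x) (G, z)" "near gadj ({G} \<times> A) n (G, z) p"
    unfolding near.simps by (auto simp: gadj_def)
  then show ?case
  proof cases
    case 1
    then show ?thesis using Suc.IH unfolding near.simps by blast
  next
    case 2
    then show ?thesis using Suc.IH[OF 2(3)] unfolding near.simps gadj_def by auto
  qed
qed

lemma rk_gadj: "rk gadj N r (gverts G) i \<subseteq> {G} \<times> rk (\<lambda>x y. (x, y) \<in> parcs G) N r (pverts G) i"
proof (induction i)
  case 0
  then show ?case by simp
next
  case (Suc i)
  show ?case
  proof
    fix p assume p: "p \<in> rk gadj N r (gverts G) (Suc i)"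
    then obtain v where v: "p = (G, v)" "v \<in> pverts G" unfolding rk_Suc_iff by blast
    have "v \<in> rk (\<lambda>x y. (x, y) \<in> parcs G) N r (pverts G) (Suc i)"
      unfolding rk_Suc_iff
    proof (intro conjI allI impI v(2))
      fix S assume S: "S \<subseteq> pverts G" "finite S" "card S \<le> N" "v \<notin> S"
      have "{G} \<times> S \<subseteq> gverts G" "finite ({G} \<times> S)" "card ({G} \<times> S) \<le> N" "p \<notin> {G} \<times> S"
        using S v by (auto simp: card_cartesian_product)
      then obtain u where u: "u \<in> rk gadj N r (gverts G) i" "u \<noteq> p"
        "near gadj (gverts G - {G} \<times> S) r p u"
        using p[unfolded rk_Suc_iff, THEN conjunct2, rule_format] by metis
      have "gverts G - {G} \<times> S = {G} \<times> (pverts G - S)" by auto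
      then obtain y where "u = (G, y)" "near (\<lambda>x y. (x, y) \<in> parcs G) (pverts G - S) r v y"
        using near_gadj u(3) v(1) by metis
      then show "\<exists>u. u \<in> rk (\<lambda>x y. (x, y) \<in> parcs G) N r (pverts G) i \<and> u \<noteq> v \<and>
          near (\<lambda>x y. (x, y) \<in> parcs G) (pverts G - S) r v u"
        using Suc.IH u(1,2) v(1) by auto
    qed
    then show "p \<in> {G} \<times> rk (\<lambda>x y. (x, y) \<in> parcs G) N r (pverts G) (Suc i)" using v by simp
  qed
qed

section \<open>Hintikka formulas for the block game\<close>

primrec exs :: "nat \<Rightarrow> nat \<Rightarrow> fo \<Rightarrow> fo" where
  "exs 0 n \<phi> = \<phi>"
| "exs (Suc q) n \<phi> = Exi n (exs q (Suc n) \<phi>)"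

definition assign :: "(nat \<Rightarrow> 'a) \<Rightarrow> nat \<Rightarrow> 'a list \<Rightarrow> nat \<Rightarrow> 'a" where
  "assign s n vs i = (if n \<le> i \<and> i < n + length vs then vs ! (i - n) else s i)"

lemma assign_Cons: "assign (s(n := v)) (Suc n) vs = assign s n (v # vs)"
  by (rule ext) (auto simp: assign_def nth_Cons')

lemma sat_exs:
  "sat G s (exs q n \<phi>) \<longleftrightarrow> (\<exists>vs. length vs = q \<and> set vs \<subseteq> pverts G \<and> sat G (assign s n vs) \<phi>)"
proof (induction q arbitrary: s n)
  case 0
  have "assign s n [] = s" by (rule ext) (auto simp: assign_def)
  then show ?case by simp
next
  case (Suc q)
  have "sat G s (exs (Suc q) n \<phi>) \<longleftrightarrow> (\<exists>v\<in>pverts G. \<exists>vs. length vs = q \<and> set vs \<subseteq> pverts G \<and>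
      sat G (assign s n (v # vs)) \<phi>)"
    unfolding exs.simps sat.simps Suc.IH assign_Cons by (rule refl)
  also have "\<dots> \<longleftrightarrow> (\<exists>vs. length vs = Suc q \<and> set vs \<subseteq> pverts G \<and> sat G (assign s n vs) \<phi>)"
  proof
    assume "\<exists>v\<in>pverts G. \<exists>vs. length vs = q \<and> set vs \<subseteq> pverts G \<and> sat G (assign s n (v # vs)) \<phi>"
    then obtain v vs where "v \<in> pverts G" "length vs = q" "set vs \<subseteq> pverts G"
      "sat G (assign s n (v # vs)) \<phi>" by blast
    then show "\<exists>vs. length vs = Suc q \<and> set vs \<subseteq> pverts G \<and> sat G (assign s n vs) \<phi>"
      by (intro exI[of _ "v # vs"]) simp
  next
    assume "\<exists>vs. length vs = Suc q \<and> set vs \<subseteq> pverts G \<and> sat G (assign s n vs) \<phi>"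
    then obtain vs where vs: "length vs = Suc q" "set vs \<subseteq> pverts G" "sat G (assign s n vs) \<phi>" by blast
    then obtain v ws where "vs = v # ws" by (cases vs) auto
    then show "\<exists>v\<in>pverts G. \<exists>vs. length vs = q \<and> set vs \<subseteq> pverts G \<and> sat G (assign s n (v # vs)) \<phi>"
      using vs by (intro bexI[of _ v] exI[of _ ws]) auto
  qed
  finally show ?case .
qed

definition type_formula :: "fo list \<Rightarrow> fo set \<Rightarrow> fo" where
  "type_formula \<Phi> Z = foldr (\<lambda>\<phi>. Conj (if \<phi> \<in> Z then \<phi> else Neg \<phi>)) \<Phi> (Eq 0 0)"

lemma sat_type_formula: "sat G s (type_formula \<Phi> Z) \<longleftrightarrow> (\<forall>\<phi>\<in>set \<Phi>. sat G s \<phi> \<longleftrightarrow> \<phi> \<in> Z)"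
  unfolding type_formula_def by (induction \<Phi>) auto

text \<open>A formula of the next level says that some values of the fresh variables
  \<open>n\<close>, ..., \<open>n + q - 1\<close> realise a prescribed complete type of the previous
  level. Universal blocks arise when such a formula is negated inside a type.\<close>

primrec hintikka :: "nat \<Rightarrow> nat \<Rightarrow> nat \<Rightarrow> fo list" where
  "hintikka q 0 n = map (\<lambda>(x, y). Eq x y) (List.product [0..<n] [0..<n]) @
    map (\<lambda>(x, y). Adj x y) (List.product [0..<n] [0..<n])"
| "hintikka q (Suc k) n =
    map (\<lambda>zs. exs q n (type_formula (hintikka q k (n + q)) (set zs))) (subseqs (hintikka q k (n + q)))"

lemma hintikka_step:
  assumes agree: "\<forall>\<phi>\<in>set (hintikka q (Suc k) n). sat G s \<phi> = sat H t \<phi>"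
    and n: "0 < n" and s: "\<forall>i<n. s i \<in> pverts G"
    and A: "A \<subseteq> gverts G" "finite A" "card A \<le> q"
  shows "\<exists>vs ws. length vs = q \<and> length ws = q \<and> set vs \<subseteq> pverts G \<and> set ws \<subseteq> pverts H \<and>
    A \<subseteq> {G} \<times> set vs \<and>
    (\<forall>\<phi>\<in>set (hintikka q k (n + q)). sat G (assign s n vs) \<phi> = sat H (assign t n ws) \<phi>)"
proof -
  obtain us where us: "set us = snd ` A" "distinct us"
    using finite_distinct_list[OF finite_imageI[OF A(2)], of snd] by blast
  have "length us \<le> q" using distinct_card[OF us(2)] us(1) card_image_le[OF A(2), of snd] A(3) by simp
  \<comment> \<open>Exactly \<open>q\<close> variables are quantified, so a smaller set is padded
    with \<open>s 0\<close>, which is a vertex because \<open>0 < n\<close>.\<close>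
  define vs where "vs = us @ replicate (q - length us) (s 0)"
  have "set vs \<subseteq> insert (s 0) (snd ` A)" unfolding vs_def us(1)[symmetric] by auto
  also have "\<dots> \<subseteq> pverts G" using A(1) s n by auto
  finally have vsG: "set vs \<subseteq> pverts G" .
  have "A \<subseteq> {G} \<times> snd ` A" using A(1) by force
  also have "\<dots> \<subseteq> {G} \<times> set vs" unfolding vs_def us(1)[symmetric] by auto
  finally have Avs: "A \<subseteq> {G} \<times> set vs" .
  have "length vs = q" using \<open>length us \<le> q\<close> by (simp add: vs_def)
  note vs = this vsG Avs
  let ?\<Phi> = "hintikka q k (n + q)"
  define Z where "Z = {\<phi> \<in> set ?\<Phi>. sat G (assign s n vs) \<phi>}"
  have "Z \<in> set ` set (subseqs ?\<Phi>)" unfolding subseqs_powset by (auto simp: Z_def)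
  then obtain zs where zs: "zs \<in> set (subseqs ?\<Phi>)" "Z = set zs" by blast
  have "sat G s (exs q n (type_formula ?\<Phi> Z))"
    unfolding sat_exs sat_type_formula using vs by (intro exI[of _ vs]) (simp add: Z_def)
  moreover have "exs q n (type_formula ?\<Phi> Z) \<in> set (hintikka q (Suc k) n)" using zs by auto
  ultimately have "sat H t (exs q n (type_formula ?\<Phi> Z))" using agree by blast
  then obtain ws where ws: "length ws = q" "set ws \<subseteq> pverts H"
    "\<forall>\<phi>\<in>set ?\<Phi>. sat H (assign t n ws) \<phi> \<longleftrightarrow> \<phi> \<in> Z"
    unfolding sat_exs sat_type_formula by blast
  then show ?thesis using vs by (intro exI[of _ vs] exI[of _ ws]) (auto simp: Z_def)
qed

lemma hintikka_bf:
  assumes "pair_graph G" "pair_graph H"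
  shows "\<forall>\<phi>\<in>set (hintikka q k n). sat G s \<phi> = sat H t \<phi> \<Longrightarrow> 0 < n \<Longrightarrow>
    \<forall>i<n. s i \<in> pverts G \<Longrightarrow> \<forall>i<n. t i \<in> pverts H \<Longrightarrow>
    bf glab q k (gverts G) (gverts H) ((\<lambda>i. ((G, s i), (H, t i))) ` {..<n})"
proof (induction k arbitrary: n s t)
  case 0
  have "(s x = s y) = (t x = t y)" "((s x, s y) \<in> parcs G) = ((t x, t y) \<in> parcs H)"
    if xy: "x < n" "y < n" for x y
  proof -
    have "Eq x y \<in> set (hintikka q 0 n)" "Adj x y \<in> set (hintikka q 0 n)"
      using xy by (simp_all add: image_iff)
    then show "(s x = s y) = (t x = t y)" "((s x, s y) \<in> parcs G) = ((t x, t y) \<in> parcs H)"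
      using 0(1)[rule_format, of "Eq x y"] 0(1)[rule_format, of "Adj x y"] by simp_all
  qed
  then show ?case unfolding bf.simps piso_def by (auto simp: gadj_def assms)
next
  case (Suc k)
  have IH: "bf glab q k (gverts G) (gverts H) ((\<lambda>i. ((G, s i), (H, t i))) ` {..<n} \<union>
      (\<lambda>i. ((G, vs ! i), (H, ws ! i))) ` {..<q})"
    if "length vs = q" "length ws = q" "set vs \<subseteq> pverts G" "set ws \<subseteq> pverts H"
      "\<forall>\<phi>\<in>set (hintikka q k (n + q)). sat G (assign s n vs) \<phi> = sat H (assign t n ws) \<phi>" for vs ws
  proof -
    have in_verts: "assign r n us i \<in> V" if "i < n + q" "length us = q" "set us \<subseteq> V" "\<And>i. i < n \<Longrightarrow> r i \<in> V"
      for r :: "nat \<Rightarrow> 'a" and us V i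
      using that by (auto simp: assign_def)
    have "bf glab q k (gverts G) (gverts H) ((\<lambda>i. ((G, assign s n vs i), (H, assign t n ws i))) ` {..<n + q})"
      by (rule Suc.IH) (use that Suc.prems in_verts in auto)
    moreover have "((\<lambda>i. ((G, s i), (H, t i))) ` {..<n} \<union> (\<lambda>i. ((G, vs ! i), (H, ws ! i))) ` {..<q}) \<subseteq>
        (\<lambda>i. ((G, assign s n vs i), (H, assign t n ws i))) ` {..<n + q}" (is "?A \<union> ?B \<subseteq> ?C")
    proof (rule Un_least)
      show "?A \<subseteq> ?C"
      proof (rule image_subsetI)
        fix i assume "i \<in> {..<n}"
        then show "((G, s i), (H, t i)) \<in> ?C" by (intro image_eqI[of _ _ i]) (auto simp: assign_def)
      qed
      show "?B \<subseteq> ?C"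
      proof (rule image_subsetI)
        fix i assume "i \<in> {..<q}"
        then show "((G, vs ! i), (H, ws ! i)) \<in> ?C"
          using that(1,2) by (intro image_eqI[of _ _ "n + i"]) (auto simp: assign_def)
      qed
    qed
    ultimately show ?thesis by (rule bf_antimono)
  qed
  show ?case
  proof (rule bf_SucI)
    fix A assume A: "A \<subseteq> gverts G" "finite A \<and> card A \<le> q"
    obtain vs ws where vw: "length vs = q" "length ws = q" "set vs \<subseteq> pverts G" "set ws \<subseteq> pverts H"
      "A \<subseteq> {G} \<times> set vs"
      "\<forall>\<phi>\<in>set (hintikka q k (n + q)). sat G (assign s n vs) \<phi> = sat H (assign t n ws) \<phi>"
      using hintikka_step[OF Suc.prems(1-3) A(1) conjunct1[OF A(2)] conjunct2[OF A(2)]]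
      by (elim exE conjE)
    let ?R = "(\<lambda>i. ((G, vs ! i), (H, ws ! i))) ` {..<q}"
    have "?R \<subseteq> gverts G \<times> gverts H" using vw(1-4) by (auto simp: subset_eq)
    moreover have "A \<subseteq> Domain ?R"
    proof
      fix a assume "a \<in> A"
      then obtain v where "a = (G, v)" "v \<in> set vs" using vw(5) by blast
      then obtain i where "i < q" "a = (G, vs ! i)" using vw(1) by (auto simp: in_set_conv_nth)
      then show "a \<in> Domain ?R" by blast
    qed
    ultimately show "\<exists>R. R \<subseteq> gverts G \<times> gverts H \<and> A \<subseteq> Domain R \<and>
        bf glab q k (gverts G) (gverts H) ((\<lambda>i. ((G, s i), (H, t i))) ` {..<n} \<union> R)"
      using IH[OF vw(1-4,6)] by blast
  next
    fix A assume A: "A \<subseteq> gverts H" "finite A \<and> card A \<le> q"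
    have sym: "\<forall>\<phi>\<in>set (hintikka q (Suc k) n). sat H t \<phi> = sat G s \<phi>" using Suc.prems(1) by simp
    obtain ws vs where vw: "length ws = q" "length vs = q" "set ws \<subseteq> pverts H" "set vs \<subseteq> pverts G"
      "A \<subseteq> {H} \<times> set ws"
      "\<forall>\<phi>\<in>set (hintikka q k (n + q)). sat H (assign t n ws) \<phi> = sat G (assign s n vs) \<phi>"
      using hintikka_step[OF sym Suc.prems(2,4) A(1) conjunct1[OF A(2)] conjunct2[OF A(2)]]
      by (elim exE conjE)
    let ?R = "(\<lambda>i. ((G, vs ! i), (H, ws ! i))) ` {..<q}"
    have vw6: "\<forall>\<phi>\<in>set (hintikka q k (n + q)). sat G (assign s n vs) \<phi> = sat H (assign t n ws) \<phi>"
      using vw(6) by simp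
    have "?R \<subseteq> gverts G \<times> gverts H" using vw(1-4) by (auto simp: subset_eq)
    moreover have "A \<subseteq> Range ?R"
    proof
      fix a assume "a \<in> A"
      then obtain w where "a = (H, w)" "w \<in> set ws" using vw(5) by blast
      then obtain i where "i < q" "a = (H, ws ! i)" using vw(1) by (auto simp: in_set_conv_nth)
      then show "a \<in> Range ?R" by blast
    qed
    ultimately show "\<exists>R. R \<subseteq> gverts G \<times> gverts H \<and> A \<subseteq> Range R \<and>
        bf glab q k (gverts G) (gverts H) ((\<lambda>i. ((G, s i), (H, t i))) ` {..<n} \<union> R)"
      using IH[OF vw(2,1,4,3) vw6] by blast
  qed
qed

section \<open>Quantifier blocks and alternation rank\<close>

primrec block_words :: "nat \<Rightarrow> quantifier list set" where
  "block_words 0 = {[]}"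
| "block_words (Suc k) = {replicate m Q @ w | m Q w. w \<in> block_words k}"

lemma block_words_Suc: "block_words k \<subseteq> block_words (Suc k)"
proof
  fix w assume "w \<in> block_words k"
  moreover have "w = replicate 0 Exists @ w" by simp
  ultimately show "w \<in> block_words (Suc k)" unfolding block_words.simps by blast
qed

lemma block_words_mono: "k \<le> k' \<Longrightarrow> block_words k \<subseteq> block_words k'"
  by (rule lift_Suc_mono_le[of block_words]) (rule block_words_Suc)

lemma alternations_replicate_append: "alternations (replicate m Q @ w) \<le> Suc (alternations w)"
proof (induction m)
  case 0
  then show ?case by simp
next
  case (Suc m)
  show ?case
  proof (cases m)
    case 0
    then show ?thesis by (cases w) auto
  next
    case (Suc m')
    then show ?thesis using Suc.IH by simp
  qed
qed

lemma alternations_block_words: "w \<in> block_words k \<Longrightarrow> alternations w \<le> k"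
proof (induction k arbitrary: w)
  case 0
  then show ?case by simp
next
  case (Suc k)
  then obtain m Q v where w: "w = replicate m Q @ v" "v \<in> block_words k" by auto
  show ?case using alternations_replicate_append[of m Q v] Suc.IH[OF w(2)] w(1) by simp
qed

lemma branches_finite_nonempty: "finite (branches \<phi>) \<and> branches \<phi> \<noteq> {}"
  by (induction \<phi>) auto

text \<open>Types contain formulas both plainly and negated; controlling the negation as well makes
  the condition stable under Boolean combinations.\<close>

definition in_blocks :: "nat \<Rightarrow> fo \<Rightarrow> bool" where
  "in_blocks k \<phi> \<longleftrightarrow> branches (nnf \<phi>) \<subseteq> block_words k \<and> branches (nnf (Neg \<phi>)) \<subseteq> block_words k"

lemma in_blocks_rank: "in_blocks k \<phi> \<Longrightarrow> alternation_rank \<phi> \<le> k"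
  unfolding in_blocks_def alternation_rank_def
  using alternations_block_words branches_finite_nonempty[of "nnf \<phi>"] by (intro Max.boundedI) auto

lemma in_blocks_simps [simp]:
  "in_blocks k (Eq x y)" "in_blocks k (Adj x y)"
  "in_blocks k (Neg \<phi>) \<longleftrightarrow> in_blocks k \<phi>"
  "in_blocks k (Conj \<phi> \<psi>) \<longleftrightarrow> in_blocks k \<phi> \<and> in_blocks k \<psi>"
  "in_blocks k (Disj \<phi> \<psi>) \<longleftrightarrow> in_blocks k \<phi> \<and> in_blocks k \<psi>"
  using block_words_mono[of 0 k] by (auto simp: in_blocks_def)

lemma branches_nnf_exs:
  "branches (nnf (exs q n \<phi>)) = (\<lambda>w. replicate q Exists @ w) ` branches (nnf \<phi>)"
  "branches (nnf (Neg (exs q n \<phi>))) = (\<lambda>w. replicate q Forall @ w) ` branches (nnf (Neg \<phi>))"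
  by (induction q arbitrary: n) (simp_all add: image_image)

lemma in_blocks_exs: "in_blocks k \<phi> \<Longrightarrow> in_blocks (Suc k) (exs q n \<phi>)"
  unfolding in_blocks_def branches_nnf_exs block_words.simps by blast

lemma in_blocks_type_formula: "(\<And>\<phi>. \<phi> \<in> set \<Phi> \<Longrightarrow> in_blocks k \<phi>) \<Longrightarrow> in_blocks k (type_formula \<Phi> Z)"
  unfolding type_formula_def by (induction \<Phi>) auto

lemma in_blocks_hintikka: "\<phi> \<in> set (hintikka q k n) \<Longrightarrow> in_blocks k \<phi>"
proof (induction k arbitrary: n \<phi>)
  case 0
  then show ?case by auto
next
  case (Suc k)
  then show ?case by (auto intro!: in_blocks_exs in_blocks_type_formula)
qed

text \<open>By assumption the Hintikka type of a tuple decides \<open>\<phi>\<close>. There are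
  finitely many types, so \<open>\<phi>\<close> amounts to the disjunction of those realised in
  \<open>C\<close> by a tuple satisfying it.\<close>

lemma bounded_rank_equivalent:
  assumes C: "\<And>G. G \<in> C \<Longrightarrow> pair_graph G" and n: "0 < n"
    and agree: "\<And>G H s t. G \<in> C \<Longrightarrow> H \<in> C \<Longrightarrow> (\<And>i. i < n \<Longrightarrow> s i \<in> pverts G) \<Longrightarrow>
      (\<And>i. i < n \<Longrightarrow> t i \<in> pverts H) \<Longrightarrow>
      bf glab q k (gverts G) (gverts H) ((\<lambda>i. ((G, s i), (H, t i))) ` {..<n}) \<Longrightarrow> sat G s \<phi> = sat H t \<phi>"
  shows "\<exists>\<psi>. equivalent_on C \<phi> \<psi> \<and> alternation_rank \<psi> \<le> k"
proof -
  define \<Phi> where "\<Phi> = hintikka q k n"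
  define realized where "realized zs \<longleftrightarrow> (\<exists>G\<in>C. \<exists>s. (\<forall>i<n. s i \<in> pverts G) \<and> sat G s \<phi> \<and>
    (\<forall>\<chi>\<in>set \<Phi>. sat G s \<chi> \<longleftrightarrow> \<chi> \<in> set zs))" for zs
  \<comment> \<open>The equations \<open>i = i\<close> make all variables below \<open>n\<close> free, so that only assignments
    defined on all of them matter.\<close>
  define \<psi>1 where "\<psi>1 = foldr (\<lambda>i. Conj (Eq i i)) [0..<n] (Eq 0 0)"
  define \<psi>2 where "\<psi>2 = foldr (\<lambda>zs. Disj (type_formula \<Phi> (set zs))) (filter realized (subseqs \<Phi>)) (Neg (Eq 0 0))"
  have fv1: "fv (foldr (\<lambda>i. Conj (Eq i i)) xs (Eq 0 0)) = insert 0 (set xs)" for xs by (induction xs) auto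
  have sat1: "sat G s (foldr (\<lambda>i. Conj (Eq i i)) xs (Eq 0 0))"
    for xs and G :: ngraph and s by (induction xs) auto
  have ib1: "in_blocks k (foldr (\<lambda>i. Conj (Eq i i)) xs (Eq 0 0))" for xs by (induction xs) auto
  have sat2: "sat G s (foldr (\<lambda>zs. Disj (type_formula \<Phi> (set zs))) xs (Neg (Eq 0 0))) \<longleftrightarrow>
      (\<exists>zs\<in>set xs. \<forall>\<chi>\<in>set \<Phi>. sat G s \<chi> \<longleftrightarrow> \<chi> \<in> set zs)" for xs and G :: ngraph and s
    by (induction xs) (auto simp: sat_type_formula)
  have "in_blocks k (type_formula \<Phi> Z)" for Z
    by (rule in_blocks_type_formula) (simp add: \<Phi>_def in_blocks_hintikka)
  then have ib2: "in_blocks k (foldr (\<lambda>zs. Disj (type_formula \<Phi> (set zs))) xs (Neg (Eq 0 0)))" for xs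
    by (induction xs) auto
  have "equivalent_on C \<phi> (Conj \<psi>1 \<psi>2)"
    unfolding equivalent_on_def
  proof (intro ballI allI impI)
    fix H t assume H: "H \<in> C" and t: "\<forall>x\<in>fv \<phi> \<union> fv (Conj \<psi>1 \<psi>2). t x \<in> pverts H"
    have tn: "t i \<in> pverts H" if "i < n" for i
      using t that by (auto simp: \<psi>1_def fv1)
    have sat\<psi>: "sat H t (Conj \<psi>1 \<psi>2) \<longleftrightarrow>
        (\<exists>zs\<in>set (subseqs \<Phi>). realized zs \<and> (\<forall>\<chi>\<in>set \<Phi>. sat H t \<chi> \<longleftrightarrow> \<chi> \<in> set zs))"
      by (auto simp: \<psi>1_def \<psi>2_def sat1 sat2)
    show "sat H t \<phi> = sat H t (Conj \<psi>1 \<psi>2)"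
    proof
      assume \<phi>: "sat H t \<phi>"
      define Z where "Z = {\<chi> \<in> set \<Phi>. sat H t \<chi>}"
      have "Z \<in> set ` set (subseqs \<Phi>)" unfolding subseqs_powset by (auto simp: Z_def)
      then obtain zs where zs: "zs \<in> set (subseqs \<Phi>)" "Z = set zs" by blast
      have "\<forall>\<chi>\<in>set \<Phi>. sat H t \<chi> \<longleftrightarrow> \<chi> \<in> set zs" unfolding zs(2)[symmetric] by (simp add: Z_def)
      moreover from this have "realized zs" unfolding realized_def using H tn \<phi> by blast
      ultimately show "sat H t (Conj \<psi>1 \<psi>2)" unfolding sat\<psi> using zs(1) by blast
    next
      assume "sat H t (Conj \<psi>1 \<psi>2)"
      then obtain zs where zs: "realized zs" "\<forall>\<chi>\<in>set \<Phi>. sat H t \<chi> \<longleftrightarrow> \<chi> \<in> set zs"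
        unfolding sat\<psi> by blast
      then obtain G s where G: "G \<in> C" "\<forall>i<n. s i \<in> pverts G" "sat G s \<phi>"
        "\<forall>\<chi>\<in>set \<Phi>. sat G s \<chi> \<longleftrightarrow> \<chi> \<in> set zs" unfolding realized_def by blast
      have "bf glab q k (gverts G) (gverts H) ((\<lambda>i. ((G, s i), (H, t i))) ` {..<n})"
        by (rule hintikka_bf[OF C[OF G(1)] C[OF H]]) (use G zs(2) tn n in \<open>auto simp: \<Phi>_def\<close>)
      then show "sat H t \<phi>" using agree[OF G(1) H, of s t] G(2,3) tn by blast
    qed
  qed
  moreover have "alternation_rank (Conj \<psi>1 \<psi>2) \<le> k"
    by (rule in_blocks_rank) (simp add: \<psi>1_def \<psi>2_def ib1 ib2)
  ultimately show ?thesis by blast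
qed

lemma finite_fv: "finite (fv \<phi>)"
  by (induction \<phi>) auto

lemma bounded_tree_rank_imp_bounded_alternation:
  assumes C: "graph_class C" and rank: "bounded_tree_rank C"
  shows "\<exists>k. \<forall>\<phi>. \<exists>\<psi>. equivalent_on C \<phi> \<psi> \<and> alternation_rank \<psi> \<le> k"
proof -
  obtain m where m: "\<forall>d\<in>tree_rank_set C. d \<le> m" using rank by (auto simp: bounded_tree_rank_def)
  have "Suc m \<notin> tree_rank_set C" using m by fastforce
  then have notin: "\<exists>T. T \<in> trees_of_depth (Suc m) \<and> T \<notin> TopMinors r C" for r
    unfolding tree_rank_set_def by blast
  have "\<exists>\<psi>. equivalent_on C \<phi> \<psi> \<and> alternation_rank \<psi> \<le> 6 * Suc m" for \<phi>
  proof -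
    obtain r where r: "\<forall>N. \<exists>q. ranks_collapse TYPE(ngraph \<times> nat) (Suc m) N r q (qdepth \<phi>)"
      using rk_bounded_collapse by (elim meta_allE exE)
    \<comment> \<open>The tree is chosen for this particular \<open>r\<close>, and \<open>N\<close>
      is computed from the tree; hence \<open>r\<close> had to work for every
      \<open>N\<close>.\<close>
    obtain T where T: "T \<in> trees_of_depth (Suc m)" "T \<notin> TopMinors r C" using notin by blast
    then obtain r0 where T': "undirected_tree T" "r0 \<in> pverts T" "rooted_depth T r0 = Suc m"
      by (auto simp: trees_of_depth_def)
    define N where "N = card (pverts T) * (r + 1)"
    obtain q where q: "ranks_collapse TYPE(ngraph \<times> nat) (Suc m) N r q (qdepth \<phi>)"
      using r[rule_format, of N] by (elim exE)
    have pg: "pair_graph G" if "G \<in> C" for G using C that by (simp add: graph_class_def)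
    have empty: "rk gadj N r (gverts G) (Suc m) = {}" if G: "G \<in> C" for G
    proof -
      \<comment> \<open>A vertex of rank \<open>m\<close> would be the root of a shallow copy of
        \<open>T\<close>, whose depth is \<open>Suc m\<close>.\<close>
      have "rk (\<lambda>x y. (x, y) \<in> parcs G) N r (pverts G) m = {}"
      proof (rule ccontr)
        assume "rk (\<lambda>x y. (x, y) \<in> parcs G) N r (pverts G) m \<noteq> {}"
        then obtain x0 where "x0 \<in> rk (\<lambda>x y. (x, y) \<in> parcs G) N r (pverts G) (rooted_depth T r0 - 1)"
          unfolding T'(3) diff_Suc_1 by blast
        then have "shallow_top_minor r T G"
          by (rule rk_imp_shallow_top_minor[OF T'(1,2) pg[OF G]]) (simp only: N_def order_refl)
        then show False using T T'(1) G by (auto simp: TopMinors_def undirected_tree_def)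
      qed
      then show ?thesis
        using rk_gadj[of N r G m] rk_antimono[of m "Suc m" gadj N r "gverts G"] by auto
    qed
    define n where "n = Suc (Max (insert 0 (fv \<phi>)))"
    show ?thesis
    proof (rule bounded_rank_equivalent)
      show "pair_graph G" if "G \<in> C" for G by (rule pg[OF that])
      show "0 < n" by (simp add: n_def)
      fix G H s t
      assume GH: "G \<in> C" "H \<in> C" and s: "\<And>i. i < n \<Longrightarrow> s i \<in> pverts G"
        and t: "\<And>i. i < n \<Longrightarrow> t i \<in> pverts H"
        and bf: "bf glab q (6 * Suc m) (gverts G) (gverts H) ((\<lambda>i. ((G, s i), (H, t i))) ` {..<n})"
      have fin: "finite (gverts G)" "finite (gverts H)"
        using pg[OF GH(1)] pg[OF GH(2)] by (auto simp: pair_graph_iff)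
      have disj: "gverts G = gverts H \<or> gverts G \<inter> gverts H = {}" by (cases "G = H") auto
      have sub: "(\<lambda>i. ((G, s i), (H, t i))) ` {..<n} \<subseteq> gverts G \<times> gverts H" using s t by auto
      have sym: "\<forall>x y :: ngraph \<times> nat. gadj x y \<longrightarrow> gadj y x" using gadj_sym by blast
      have "bf glab 1 (qdepth \<phi>) (gverts G) (gverts H) ((\<lambda>i. ((G, s i), (H, t i))) ` {..<n})"
        by (rule q[unfolded ranks_collapse_def, rule_format, OF sym[rule_format] fin disj empty[OF GH(1)] empty[OF GH(2)] sub bf])
      then show "sat G s \<phi> = sat H t \<phi>"
        by (rule sat_bf[OF pg[OF GH(1)] pg[OF GH(2)]]) (use finite_fv[of \<phi>] in \<open>auto simp: n_def less_Suc_eq_le image_iff\<close>)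
    qed
  qed
  then show ?thesis by blast
qed

section \<open>Alternating trees\<close>

text \<open>
  The one-sided game for formulas whose quantifier blocks begin with an existential one: the spoiler
  changes sides after every round, and the duplicator may match more elements than were picked.
\<close>

primrec ag :: "('a \<Rightarrow> 'a \<Rightarrow> 'l) \<Rightarrow> nat \<Rightarrow> nat \<Rightarrow> 'a set \<Rightarrow> 'a set \<Rightarrow> 'a rel \<Rightarrow> bool" where
  "ag e l 0 X Y P \<longleftrightarrow> piso e P"
| "ag e l (Suc n) X Y P \<longleftrightarrow> (\<forall>A\<subseteq>X. finite A \<and> card A \<le> l \<longrightarrow>
    (\<exists>R\<subseteq>X \<times> Y. A \<subseteq> Domain R \<and> ag e l n Y X ((P \<union> R)\<inverse>)))"

declare ag.simps(2) [simp del]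

lemma ag_SucE:
  assumes "ag e l (Suc n) X Y P" "A \<subseteq> X" "finite A \<and> card A \<le> l"
  obtains R where "R \<subseteq> X \<times> Y" "A \<subseteq> Domain R" "ag e l n Y X ((P \<union> R)\<inverse>)"
  using assms(1)[unfolded ag.simps(2)] assms(2,3) by meson

lemma ag_SucI:
  assumes "\<And>A. A \<subseteq> X \<Longrightarrow> finite A \<and> card A \<le> l \<Longrightarrow>
      \<exists>R. R \<subseteq> X \<times> Y \<and> A \<subseteq> Domain R \<and> ag e l n Y X ((P \<union> R)\<inverse>)"
  shows "ag e l (Suc n) X Y P"
  unfolding ag.simps(2) using assms by meson

lemma ag_antimono: "ag e l n X Y P \<Longrightarrow> P' \<subseteq> P \<Longrightarrow> ag e l n X Y P'"
proof (induction n arbitrary: X Y P P')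
  case 0
  then show ?case using piso_antimono[of e P P'] by simp
next
  case (Suc n)
  show ?case
  proof (rule ag_SucI)
    fix A assume A: "A \<subseteq> X" "finite A \<and> card A \<le> l"
    obtain R where R: "R \<subseteq> X \<times> Y" "A \<subseteq> Domain R" "ag e l n Y X ((P \<union> R)\<inverse>)"
      by (rule ag_SucE[OF Suc.prems(1) A])
    have "ag e l n Y X ((P' \<union> R)\<inverse>)" by (rule Suc.IH[OF R(3)]) (use Suc.prems(2) in blast)
    then show "\<exists>R. R \<subseteq> X \<times> Y \<and> A \<subseteq> Domain R \<and> ag e l n Y X ((P' \<union> R)\<inverse>)" using R by blast
  qed
qed

lemma ag_imp_piso: "ag e l n X Y P \<Longrightarrow> piso e P"
proof (induction n arbitrary: X Y P)
  case (Suc n)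
  obtain R where "ag e l n Y X ((P \<union> R)\<inverse>)" by (rule ag_SucE[OF Suc.prems, of "{}"]) auto
  then have "piso e (P \<union> R)" using Suc.IH by fastforce
  then show ?case by (rule piso_antimono) blast
qed simp

text \<open>The game on \<open>X\<close> and \<open>Y\<close> is carried into larger carriers whose
  remaining parts are matched once and for all by \<open>K\<close>. Picks in those parts are
  answered by \<open>K\<close>, which is added to every answer; the other picks are pulled back to
  the small game.\<close>

lemma ag_context:
  assumes "ag e l n X Y P" "P \<subseteq> X \<times> Y"
    and "\<And>P'. P \<subseteq> P' \<Longrightarrow> P' \<subseteq> X \<times> Y \<Longrightarrow> piso e P' \<Longrightarrow> piso e' ((\<lambda>(x, y). (g x, h y)) ` P' \<union> K)"
  shows "ag e' l n (g ` X \<union> Domain K) (h ` Y \<union> Range K) ((\<lambda>(x, y). (g x, h y)) ` P \<union> K)"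
  using assms
proof (induction n arbitrary: X Y P g h K)
  case 0
  then show ?case by simp
next
  case (Suc n)
  show ?case
  proof (rule ag_SucI)
    fix A assume A: "A \<subseteq> g ` X \<union> Domain K" "finite A \<and> card A \<le> l"
    define A' where "A' = inv_into X g ` (A \<inter> g ` X)"
    have A'X: "A' \<subseteq> X" by (auto simp: A'_def inv_into_into)
    have "card A' \<le> card (A \<inter> g ` X)" unfolding A'_def using A(2) by (intro card_image_le) blast
    also have "\<dots> \<le> card A" using A(2) by (intro card_mono) auto
    finally have cA': "finite A' \<and> card A' \<le> l" using A(2) by (simp add: A'_def)
    obtain R where R: "R \<subseteq> X \<times> Y" "A' \<subseteq> Domain R" "ag e l n Y X ((P \<union> R)\<inverse>)"
      by (rule ag_SucE[OF Suc.prems(1) A'X cA'])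
    let ?m = "\<lambda>(x, y). (g x, h y)"
    have conv: "(\<lambda>(y, x). (h y, g x)) ` S\<inverse> \<union> K\<inverse> = (?m ` S \<union> K)\<inverse>" for S by force
    have "ag e' l n (h ` Y \<union> Domain (K\<inverse>)) (g ` X \<union> Range (K\<inverse>))
        ((\<lambda>(y, x). (h y, g x)) ` ((P \<union> R)\<inverse>) \<union> K\<inverse>)"
    proof (rule Suc.IH[OF R(3)])
      show "(P \<union> R)\<inverse> \<subseteq> Y \<times> X" using R(1) Suc.prems(2) by auto
      fix P' assume P': "(P \<union> R)\<inverse> \<subseteq> P'" "P' \<subseteq> Y \<times> X" "piso e P'"
      have "piso e' (?m ` (P'\<inverse>) \<union> K)"
        by (rule Suc.prems(3)) (use P' in auto)
      then show "piso e' ((\<lambda>(y, x). (h y, g x)) ` P' \<union> K\<inverse>)" using conv[of "P'\<inverse>"] by simp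
    qed
    then have ag': "ag e' l n (h ` Y \<union> Range K) (g ` X \<union> Domain K) ((?m ` (P \<union> R) \<union> K)\<inverse>)"
      unfolding conv by simp
    have eq: "?m ` P \<union> K \<union> (?m ` R \<union> K) = ?m ` (P \<union> R) \<union> K" by blast
    show "\<exists>S. S \<subseteq> (g ` X \<union> Domain K) \<times> (h ` Y \<union> Range K) \<and> A \<subseteq> Domain S \<and>
        ag e' l n (h ` Y \<union> Range K) (g ` X \<union> Domain K) ((?m ` P \<union> K \<union> S)\<inverse>)"
    proof (intro exI[of _ "?m ` R \<union> K"] conjI)
      show "?m ` R \<union> K \<subseteq> (g ` X \<union> Domain K) \<times> (h ` Y \<union> Range K)" using R(1) by auto
      show "A \<subseteq> Domain (?m ` R \<union> K)"
      proof
        fix a assume a: "a \<in> A"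
        show "a \<in> Domain (?m ` R \<union> K)"
        proof (cases "a \<in> Domain K")
          case True
          then show ?thesis by blast
        next
          case False
          then have ag: "a \<in> g ` X" using a A(1) by blast
          then have "inv_into X g a \<in> Domain R" using R(2) a unfolding A'_def by blast
          then obtain y where "(inv_into X g a, y) \<in> R" by blast
          then have "(g (inv_into X g a), h y) \<in> ?m ` R" by force
          then show ?thesis using f_inv_into_f[OF ag] by auto
        qed
      qed
      show "ag e' l n (h ` Y \<union> Range K) (g ` X \<union> Domain K) ((?m ` P \<union> K \<union> (?m ` R \<union> K))\<inverse>)"
        unfolding eq by (rule ag')
    qed
  qed
qed

section \<open>Quantifier words by blocks, and preservation of formulas by the one-sided
  game\<close>

primrec flip :: "quantifier \<Rightarrow> quantifier" where
  "flip Exists = Forall"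
| "flip Forall = Exists"

lemma flip_flip [simp]: "flip (flip Q) = Q"
  by (cases Q) auto

lemma neq_iff_flip: "p \<noteq> q \<longleftrightarrow> q = flip p"
  by (cases p; cases q) auto

text \<open>Blocks may be empty, so a word may begin with the other quantifier at the expense of one
  block.\<close>

primrec qwords :: "nat \<Rightarrow> quantifier \<Rightarrow> quantifier list set" where
  "qwords 0 Q = {[]}"
| "qwords (Suc n) Q = {replicate m Q @ w | m w. w \<in> qwords n (flip Q)}"

lemma qwords_Nil: "[] \<in> qwords n Q"
proof (induction n arbitrary: Q)
  case (Suc n)
  then show ?case by (auto intro!: exI[of _ 0] exI[of _ "[]"])
qed simp

lemma qwords_Cons: "w \<in> qwords (Suc n) Q \<Longrightarrow> Q # w \<in> qwords (Suc n) Q"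
  unfolding qwords.simps by (clarsimp, metis append_Cons replicate_Suc)

lemma qwords_skip: "w \<in> qwords n (flip Q) \<Longrightarrow> w \<in> qwords (Suc n) Q"
  unfolding qwords.simps by (clarsimp, metis append_Nil replicate_0)

lemma qwords_Suc: "w \<in> qwords n Q \<Longrightarrow> w \<in> qwords (Suc n) Q"
proof (induction n arbitrary: Q w)
  case 0
  then show ?case using qwords_Nil[of "Suc 0" Q] by simp
next
  case (Suc n)
  then obtain m v where w: "w = replicate m Q @ v" "v \<in> qwords n (flip Q)" by auto
  have "v \<in> qwords (Suc n) (flip Q)" by (rule Suc.IH[OF w(2)])
  then show ?case unfolding qwords.simps(2)[of "Suc n"] using w(1) by blast
qed

lemma qwords_mono: "w \<in> qwords n Q \<Longrightarrow> n \<le> n' \<Longrightarrow> w \<in> qwords n' Q"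
  by (induction n') (auto simp: le_Suc_eq intro: qwords_Suc simp del: qwords.simps(2))

lemma qwords_Cons_flip:
  assumes "flip Q # w \<in> qwords (Suc n) Q"
  shows "flip Q # w \<in> qwords n (flip Q)"
proof -
  obtain m v where v: "flip Q # w = replicate m Q @ v" "v \<in> qwords n (flip Q)"
    using assms by auto
  have "m = 0" using v(1) by (cases m; cases Q) auto
  then show ?thesis using v by simp
qed

text \<open>If the first block is empty, the second must be empty as well since it has the wrong
  quantifier, and the word already needs two blocks fewer.\<close>

lemma qwords_ConsD: "Q # w \<in> qwords n Q \<Longrightarrow> w \<in> qwords n Q"
proof (induction n rule: less_induct)
  case (less n)
  then obtain k where n: "n = Suc k" by (cases n) auto
  obtain m v where v: "Q # w = replicate m Q @ v" "v \<in> qwords k (flip Q)" using less.prems n by auto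
  show ?case
  proof (cases m)
    case 0
    then have Qw: "Q # w \<in> qwords k (flip Q)" using v by simp
    then obtain k' where k: "k = Suc k'" by (cases k) auto
    have "Q # w \<in> qwords k' Q" using qwords_Cons_flip[of "flip Q" w k'] Qw k by simp
    then have "w \<in> qwords k' Q" using less.IH[of k'] n k by simp
    then show ?thesis by (rule qwords_mono) (simp add: n k)
  next
    case (Suc m')
    then show ?thesis using v n by auto
  qed
qed

lemma alternations_qwords: "alternations w \<le> k \<Longrightarrow> w \<noteq> [] \<Longrightarrow> w \<in> qwords (Suc k) (hd w)"
proof (induction w arbitrary: k rule: alternations.induct)
  case (1 p q qs)
  show ?case
  proof (cases "p = q")
    case True
    then have "q # qs \<in> qwords (Suc k) q" using 1(1)[of k] 1(2) by simp
    then show ?thesis using qwords_Cons True by fastforce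
  next
    case False
    then obtain k' where k: "k = Suc k'" using 1(2) by (cases k) auto
    have "q # qs \<in> qwords (Suc k') q" using 1(1)[of k'] 1(2) k False by simp
    moreover have "q = flip p" using False neq_iff_flip by simp
    ultimately have "q # qs \<in> qwords (Suc k) p" using qwords_skip[of "q # qs" k p] k by simp
    then show ?thesis using qwords_Cons by fastforce
  qed
next
  case ("2_1" )
  then show ?case by simp
next
  case ("2_2" v)
  then show ?case by (simp del: qwords.simps add: qwords_Cons qwords_Nil)
qed

lemma map_flip_qwords: "w \<in> qwords n Q \<Longrightarrow> map flip w \<in> qwords n (flip Q)"
proof (induction n arbitrary: w Q)
  case (Suc n)
  then obtain m v where w: "w = replicate m Q @ v" "v \<in> qwords n (flip Q)" by auto
  have "map flip w = replicate m (flip Q) @ map flip v" using w(1) by simp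
  then show ?case using Suc.IH[OF w(2)] by (auto simp del: map_append)
qed simp

lemma branches_nnf_Neg: "branches (nnf (Neg \<phi>)) = map flip ` branches (nnf \<phi>)"
proof (induction \<phi>)
  case (Neg \<phi>)
  have "map flip ` map flip ` A = A" for A by (simp add: image_image comp_def)
  then show ?case using Neg by simp
qed (auto simp: image_Un image_image)

text \<open>All quantifiers are counted, not their nesting depth, because one move must provide the
  witnesses of all conjuncts together.\<close>

primrec nquants :: "fo \<Rightarrow> nat" where
  "nquants (Eq x y) = 0"
| "nquants (Adj x y) = 0"
| "nquants (Neg \<phi>) = nquants \<phi>"
| "nquants (Conj \<phi> \<psi>) = nquants \<phi> + nquants \<psi>"
| "nquants (Disj \<phi> \<psi>) = nquants \<phi> + nquants \<psi>"
| "nquants (Exi x \<phi>) = Suc (nquants \<phi>)"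
| "nquants (Uni x \<phi>) = Suc (nquants \<phi>)"

lemma nnf_idem: "nnf (nnf \<phi>) = nnf \<phi>"
  by (induction \<phi> rule: nnf.induct) auto

lemma nnf_neq_Neg_Neg: "nnf \<phi> \<noteq> Neg (Neg \<chi>)"
  by (induction \<phi> rule: nnf.induct) auto

lemma nquants_nnf: "nquants (nnf \<phi>) = nquants \<phi>"
  by (induction \<phi> rule: nnf.induct) auto

lemma fv_nnf: "fv (nnf \<phi>) = fv \<phi>"
  by (induction \<phi> rule: nnf.induct) auto

lemma sat_nnf: "sat G s (nnf \<phi>) = sat G s \<phi>"
  by (induction \<phi> arbitrary: s rule: nnf.induct) auto

definition rel_graph :: "('a \<Rightarrow> 'a \<Rightarrow> bool) \<Rightarrow> 'a set \<Rightarrow> 'a pair_pre_digraph" where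
  "rel_graph e X = \<lparr>pverts = X, parcs = {(x, y). x \<in> X \<and> y \<in> X \<and> e x y}\<rparr>"

lemma rel_graph_simps [simp]:
  "pverts (rel_graph e X) = X"
  "(x, y) \<in> parcs (rel_graph e X) \<longleftrightarrow> x \<in> X \<and> y \<in> X \<and> e x y"
  by (simp_all add: rel_graph_def)

lemma sat_quantifier_free:
  "branches \<phi> \<subseteq> {[]} \<Longrightarrow> piso e P \<Longrightarrow> P \<subseteq> X \<times> Y \<Longrightarrow> \<forall>x\<in>fv \<phi>. (s x, t x) \<in> P \<Longrightarrow>
    sat (rel_graph e X) s \<phi> = sat (rel_graph e Y) t \<phi>"
proof (induction \<phi>)
  case (Eq x y)
  then show ?case using pisoD(1)[of e P "s x" "t x" "s y" "t y"] by simp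
next
  case (Adj x y)
  then have "(s x, t x) \<in> P" "(s y, t y) \<in> P" by auto
  moreover from this have "s x \<in> X" "t x \<in> Y" "s y \<in> X" "t y \<in> Y" using Adj(3) by auto
  ultimately show ?case using pisoD(2)[OF Adj(2), of "s x" "t x" "s y" "t y"] by simp
next
  case (Exi x \<phi>)
  then show ?case using branches_finite_nonempty[of \<phi>] by auto
next
  case (Uni x \<phi>)
  then show ?case using branches_finite_nonempty[of \<phi>] by auto
qed auto

text \<open>The witnesses for the first existential block are gathered over the whole formula: a
  conjunction unites two sets, a disjunction keeps the set of a true part. At a universal quantifier
  the remaining words start with \<open>Forall\<close>, and the game with exchanged sides takes
  over.\<close>

lemma existential_witnesses:
  assumes dual: "\<And>\<phi> P s t. branches (nnf \<phi>) \<subseteq> qwords n Forall \<Longrightarrow> nquants \<phi> \<le> l \<Longrightarrow> P \<subseteq> X \<times> Y \<Longrightarrow>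
      ag e l n Y X (P\<inverse>) \<Longrightarrow> \<forall>x\<in>fv \<phi>. (s x, t x) \<in> P \<Longrightarrow>
      sat (rel_graph e X) s \<phi> \<Longrightarrow> sat (rel_graph e Y) t \<phi>"
  shows "nnf \<theta> = \<theta> \<Longrightarrow> branches \<theta> \<subseteq> qwords (Suc n) Exists \<Longrightarrow> nquants \<theta> \<le> l \<Longrightarrow>
    sat (rel_graph e X) s \<theta> \<Longrightarrow>
    \<exists>A\<subseteq>X. finite A \<and> card A \<le> nquants \<theta> \<and> (\<forall>P t. P \<subseteq> X \<times> Y \<longrightarrow> A \<subseteq> Domain P \<longrightarrow>
      ag e l n Y X (P\<inverse>) \<longrightarrow> (\<forall>x\<in>fv \<theta>. (s x, t x) \<in> P) \<longrightarrow> sat (rel_graph e Y) t \<theta>)"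
proof (induction \<theta> arbitrary: s)
  case (Eq x y)
  have "sat (rel_graph e Y) t (Eq x y)"
    if "P \<subseteq> X \<times> Y" "ag e l n Y X (P\<inverse>)" "\<forall>z\<in>fv (Eq x y). (s z, t z) \<in> P" for P t
    using sat_quantifier_free[of "Eq x y" e P X Y s t] ag_imp_piso[OF that(2)] that(1,3) Eq(4) by simp
  then show ?case by (intro exI[of _ "{}"]) auto
next
  case (Adj x y)
  have "sat (rel_graph e Y) t (Adj x y)"
    if "P \<subseteq> X \<times> Y" "ag e l n Y X (P\<inverse>)" "\<forall>z\<in>fv (Adj x y). (s z, t z) \<in> P" for P t
    using sat_quantifier_free[of "Adj x y" e P X Y s t] ag_imp_piso[OF that(2)] that(1,3) Adj(4) by simp
  then show ?case by (intro exI[of _ "{}"]) auto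
next
  case (Neg \<theta>)
  have b: "branches (Neg \<theta>) \<subseteq> {[]}"
  proof (cases \<theta>)
    case (Neg \<chi>)
    then show ?thesis using Neg.prems(1) nnf_neq_Neg_Neg[of \<chi> \<chi>] by simp
  qed (use Neg.prems(1) in simp_all)
  have "sat (rel_graph e Y) t (Neg \<theta>)"
    if "P \<subseteq> X \<times> Y" "ag e l n Y X (P\<inverse>)" "\<forall>z\<in>fv (Neg \<theta>). (s z, t z) \<in> P" for P t
    using sat_quantifier_free[OF b _ that(1,3)] ag_imp_piso[OF that(2)] Neg.prems(4) by simp
  then show ?case by (intro exI[of _ "{}"]) auto
next
  case (Conj \<theta>1 \<theta>2)
  obtain A1 where A1: "A1 \<subseteq> X" "finite A1" "card A1 \<le> nquants \<theta>1"
    "\<forall>P t. P \<subseteq> X \<times> Y \<longrightarrow> A1 \<subseteq> Domain P \<longrightarrow>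
      ag e l n Y X (P\<inverse>) \<longrightarrow> (\<forall>x\<in>fv \<theta>1. (s x, t x) \<in> P) \<longrightarrow> sat (rel_graph e Y) t \<theta>1"
    using Conj.IH(1)[of s] Conj.prems by auto
  obtain A2 where A2: "A2 \<subseteq> X" "finite A2" "card A2 \<le> nquants \<theta>2"
    "\<forall>P t. P \<subseteq> X \<times> Y \<longrightarrow> A2 \<subseteq> Domain P \<longrightarrow>
      ag e l n Y X (P\<inverse>) \<longrightarrow> (\<forall>x\<in>fv \<theta>2. (s x, t x) \<in> P) \<longrightarrow> sat (rel_graph e Y) t \<theta>2"
    using Conj.IH(2)[of s] Conj.prems by auto
  show ?case
  proof (intro exI[of _ "A1 \<union> A2"] conjI allI impI)
    show "card (A1 \<union> A2) \<le> nquants (Conj \<theta>1 \<theta>2)" using card_Un_le[of A1 A2] A1(3) A2(3) by simp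
    fix P t
    assume P: "P \<subseteq> X \<times> Y" "A1 \<union> A2 \<subseteq> Domain P" "ag e l n Y X (P\<inverse>)" "\<forall>x\<in>fv (Conj \<theta>1 \<theta>2). (s x, t x) \<in> P"
    have "sat (rel_graph e Y) t \<theta>1" by (rule A1(4)[rule_format, OF P(1) _ P(3)]) (use P(2,4) in auto)
    moreover have "sat (rel_graph e Y) t \<theta>2" by (rule A2(4)[rule_format, OF P(1) _ P(3)]) (use P(2,4) in auto)
    ultimately show "sat (rel_graph e Y) t (Conj \<theta>1 \<theta>2)" by simp
  qed (use A1 A2 in auto)
next
  case (Disj \<theta>1 \<theta>2)
  have "\<exists>\<theta>. (\<theta> = \<theta>1 \<or> \<theta> = \<theta>2) \<and> (\<exists>A\<subseteq>X. finite A \<and> card A \<le> nquants \<theta> \<and> (\<forall>P t. P \<subseteq> X \<times> Y \<longrightarrow> A \<subseteq> Domain P \<longrightarrow>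
      ag e l n Y X (P\<inverse>) \<longrightarrow> (\<forall>x\<in>fv \<theta>. (s x, t x) \<in> P) \<longrightarrow> sat (rel_graph e Y) t \<theta>))"
  proof (cases "sat (rel_graph e X) s \<theta>1")
    case True
    then show ?thesis using Disj.IH(1)[of s] Disj.prems by (intro exI[of _ \<theta>1]) auto
  next
    case False
    then show ?thesis using Disj.IH(2)[of s] Disj.prems by (intro exI[of _ \<theta>2]) auto
  qed
  then obtain \<theta> A where \<theta>: "\<theta> = \<theta>1 \<or> \<theta> = \<theta>2" and A: "A \<subseteq> X" "finite A" "card A \<le> nquants \<theta>"
    "\<forall>P t. P \<subseteq> X \<times> Y \<longrightarrow> A \<subseteq> Domain P \<longrightarrow>
      ag e l n Y X (P\<inverse>) \<longrightarrow> (\<forall>x\<in>fv \<theta>. (s x, t x) \<in> P) \<longrightarrow> sat (rel_graph e Y) t \<theta>"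
    by (elim exE conjE)
  show ?case
  proof (intro exI[of _ A] conjI allI impI A)
    show "card A \<le> nquants (Disj \<theta>1 \<theta>2)" using A(3) \<theta> by auto
    fix P t
    assume P: "P \<subseteq> X \<times> Y" "A \<subseteq> Domain P" "ag e l n Y X (P\<inverse>)" "\<forall>x\<in>fv (Disj \<theta>1 \<theta>2). (s x, t x) \<in> P"
    have "sat (rel_graph e Y) t \<theta>" by (rule A(4)[rule_format, OF P(1,2,3)]) (use P(4) \<theta> in auto)
    then show "sat (rel_graph e Y) t (Disj \<theta>1 \<theta>2)" using \<theta> by auto
  qed
next
  case (Exi x \<theta>)
  obtain v where v: "v \<in> X" "sat (rel_graph e X) (s(x := v)) \<theta>" using Exi.prems(4) by auto
  have b: "branches \<theta> \<subseteq> qwords (Suc n) Exists"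
  proof
    fix w assume "w \<in> branches \<theta>"
    then have "Exists # w \<in> qwords (Suc n) Exists" using Exi.prems(2) by (auto simp del: qwords.simps)
    then show "w \<in> qwords (Suc n) Exists" by (rule qwords_ConsD)
  qed
  have nnf: "nnf \<theta> = \<theta>" and le: "nquants \<theta> \<le> l" using Exi.prems(1,3) by simp_all
  from Exi.IH[OF nnf b le v(2)] obtain A where A: "A \<subseteq> X" "finite A" "card A \<le> nquants \<theta>"
    "\<forall>P t. P \<subseteq> X \<times> Y \<longrightarrow> A \<subseteq> Domain P \<longrightarrow>
      ag e l n Y X (P\<inverse>) \<longrightarrow> (\<forall>y\<in>fv \<theta>. ((s(x := v)) y, t y) \<in> P) \<longrightarrow> sat (rel_graph e Y) t \<theta>"
    by (elim exE conjE)
  show ?case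
  proof (intro exI[of _ "insert v A"] conjI allI impI)
    show "card (insert v A) \<le> nquants (Exi x \<theta>)" using A(2,3) by (simp add: card_insert_if)
    fix P t
    assume P: "P \<subseteq> X \<times> Y" "insert v A \<subseteq> Domain P" "ag e l n Y X (P\<inverse>)" "\<forall>y\<in>fv (Exi x \<theta>). (s y, t y) \<in> P"
    obtain w where w: "(v, w) \<in> P" using P(2) by blast
    have "sat (rel_graph e Y) (t(x := w)) \<theta>"
      by (rule A(4)[rule_format, OF P(1) _ P(3)]) (use P(2,4) w in auto)
    moreover have "w \<in> Y" using w P(1) by blast
    ultimately show "sat (rel_graph e Y) t (Exi x \<theta>)" by auto
  qed (use A v in auto)
next
  case (Uni x \<theta>)
  have b: "branches (nnf (Uni x \<theta>)) \<subseteq> qwords n Forall"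
  proof
    fix w assume w: "w \<in> branches (nnf (Uni x \<theta>))"
    then have "w \<in> qwords (Suc n) Exists" using Uni.prems(1,2) by (auto simp del: qwords.simps)
    moreover obtain w' where "w = Forall # w'" using w by auto
    ultimately show "w \<in> qwords n Forall" using qwords_Cons_flip[of Exists w' n] by simp
  qed
  show ?case
  proof (intro exI[of _ "{}"] conjI allI impI)
    fix P t
    assume P: "P \<subseteq> X \<times> Y" "ag e l n Y X (P\<inverse>)" "\<forall>y\<in>fv (Uni x \<theta>). (s y, t y) \<in> P"
    show "sat (rel_graph e Y) t (Uni x \<theta>)" by (rule dual[OF b Uni.prems(3) P Uni.prems(4)])
  qed simp_all
qed

lemma ag_sat:
  "ag e l n X Y P \<Longrightarrow> P \<subseteq> X \<times> Y \<Longrightarrow> branches (nnf \<phi>) \<subseteq> qwords n Exists \<Longrightarrow> nquants \<phi> \<le> l \<Longrightarrow>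
    \<forall>x\<in>fv \<phi>. (s x, t x) \<in> P \<Longrightarrow> sat (rel_graph e X) s \<phi> \<Longrightarrow> sat (rel_graph e Y) t \<phi>"
proof (induction n arbitrary: X Y P \<phi> s t)
  case 0
  have "sat (rel_graph e X) s (nnf \<phi>) = sat (rel_graph e Y) t (nnf \<phi>)"
    by (rule sat_quantifier_free[of _ e P]) (use 0 in \<open>simp_all add: fv_nnf\<close>)
  then show ?case using 0 by (simp add: sat_nnf)
next
  case (Suc n)
  \<comment> \<open>The negation of a formula that starts universally starts existentially, and the
    induction hypothesis preserves it in the opposite direction.\<close>
  have dual: "sat (rel_graph e Y) t \<chi>"
    if "branches (nnf \<chi>) \<subseteq> qwords n Forall" "nquants \<chi> \<le> l" "P \<subseteq> X \<times> Y"
      "ag e l n Y X (P\<inverse>)" "\<forall>x\<in>fv \<chi>. (s x, t x) \<in> P" "sat (rel_graph e X) s \<chi>" for \<chi> P s t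
  proof (rule ccontr)
    assume "\<not> sat (rel_graph e Y) t \<chi>"
    then have n: "sat (rel_graph e Y) t (Neg \<chi>)" by simp
    have b: "branches (nnf (Neg \<chi>)) \<subseteq> qwords n Exists"
      unfolding branches_nnf_Neg using that(1) map_flip_qwords[of _ n Forall] by auto
    have "P\<inverse> \<subseteq> Y \<times> X" using that(3) by auto
    from Suc.IH[OF that(4) this b _ _ n, of s] show False using that(2,5,6) by simp
  qed
  have "nquants (nnf \<phi>) \<le> l" "sat (rel_graph e X) s (nnf \<phi>)"
    using Suc.prems(4,6) by (simp_all add: nquants_nnf sat_nnf)
  then have "\<exists>A\<subseteq>X. finite A \<and> card A \<le> nquants (nnf \<phi>) \<and> (\<forall>P t. P \<subseteq> X \<times> Y \<longrightarrow> A \<subseteq> Domain P \<longrightarrow>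
      ag e l n Y X (P\<inverse>) \<longrightarrow> (\<forall>x\<in>fv (nnf \<phi>). (s x, t x) \<in> P) \<longrightarrow> sat (rel_graph e Y) t (nnf \<phi>))"
    by (intro existential_witnesses[OF _ nnf_idem Suc.prems(3)]) (rule dual; assumption)
  then obtain A where A: "A \<subseteq> X" "finite A" "card A \<le> nquants (nnf \<phi>)"
    "\<forall>P t. P \<subseteq> X \<times> Y \<longrightarrow> A \<subseteq> Domain P \<longrightarrow>
      ag e l n Y X (P\<inverse>) \<longrightarrow> (\<forall>x\<in>fv (nnf \<phi>). (s x, t x) \<in> P) \<longrightarrow> sat (rel_graph e Y) t (nnf \<phi>)"
    by (elim exE conjE)
  have "finite A \<and> card A \<le> l" using A(2,3) Suc.prems(4) by (simp add: nquants_nnf)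
  then obtain R where R: "R \<subseteq> X \<times> Y" "A \<subseteq> Domain R" "ag e l n Y X ((P \<union> R)\<inverse>)"
    by (rule ag_SucE[OF Suc.prems(1) A(1)])
  have "sat (rel_graph e Y) t (nnf \<phi>)"
    by (rule A(4)[rule_format, OF _ _ R(3)]) (use R Suc.prems(2,5) in \<open>auto simp: fv_nnf\<close>)
  then show ?case by (simp add: sat_nnf)
qed

section \<open>Trees of lists, and the pairs that few alternations cannot separate\<close>

fun ladj :: "nat list \<Rightarrow> nat list \<Rightarrow> bool" where
  "ladj [] [] = False"
| "ladj [] (b # y) = (y = [])"
| "ladj (a # x) [] = (x = [])"
| "ladj (a # x) (b # y) = (a = b \<and> ladj x y)"

lemma ladj_iff: "ladj x y \<longleftrightarrow> (\<exists>a. y = x @ [a]) \<or> (\<exists>a. x = y @ [a])"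
  by (induction x y rule: ladj.induct) auto

text \<open>
  The list \<open>pr\<close> says at which levels the tree branches; the other levels come from subdivided edges.
  At a branching node all children carry the flag \<open>True\<close>, except that below a node with flag \<open>True\<close>
  child \<open>0\<close> carries \<open>False\<close>.
\<close>

primrec alt_tree :: "nat \<Rightarrow> bool list \<Rightarrow> bool \<Rightarrow> nat list set" where
  "alt_tree N [] s = (if s then {[], [0]} else {[]})"
| "alt_tree N (b # pr) s =
    insert [] (\<Union>j<(if b then N else 1). (#) j ` alt_tree N pr (if b then \<not> s \<or> j \<noteq> 0 else s))"

primrec full_tree :: "nat \<Rightarrow> bool list \<Rightarrow> nat list set" where
  "full_tree N [] = {[]}"
| "full_tree N (b # pr) = insert [] (\<Union>j<(if b then N else 1). (#) j ` full_tree N pr)"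

lemma Nil_in_alt_tree [simp]: "[] \<in> alt_tree N pr s"
  by (cases pr) auto

lemma Nil_in_full_tree [simp]: "[] \<in> full_tree N pr"
  by (cases pr) auto

lemma Cons_in_alt_tree:
  "j # x \<in> alt_tree N (b # pr) s \<longleftrightarrow>
    j < (if b then N else 1) \<and> x \<in> alt_tree N pr (if b then \<not> s \<or> j \<noteq> 0 else s)"
  by auto

lemma Cons_in_full_tree:
  "j # x \<in> full_tree N (b # pr) \<longleftrightarrow> j < (if b then N else 1) \<and> x \<in> full_tree N pr"
  by auto

declare alt_tree.simps(2) [simp del] full_tree.simps(2) [simp del]

text \<open>The additional level makes room for the child \<open>[0]\<close> that marks a node with
  flag \<open>True\<close> at the bottom.\<close>

lemma alt_tree_subset: "0 < N \<Longrightarrow> alt_tree N pr s \<subseteq> full_tree N (pr @ [False])"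
proof (induction pr arbitrary: s)
  case Nil
  then show ?case by (auto simp: Cons_in_full_tree)
next
  case (Cons b pr)
  note IH = Cons.IH[OF Cons.prems]
  show ?case
  proof
    fix x assume x: "x \<in> alt_tree N (b # pr) s"
    show "x \<in> full_tree N ((b # pr) @ [False])"
    proof (cases x)
      case Nil
      then show ?thesis by simp
    next
      case (Cons j y)
      have "j < (if b then N else 1)" "y \<in> full_tree N (pr @ [False])"
        using x IH unfolding Cons Cons_in_alt_tree by blast+
      then show ?thesis unfolding Cons append_Cons Cons_in_full_tree by simp
    qed
  qed
qed

lemma full_tree_mono: "N \<le> N' \<Longrightarrow> full_tree N pr \<subseteq> full_tree N' pr"
proof (induction pr)
  case (Cons b pr)
  show ?case
  proof
    fix x assume "x \<in> full_tree N (b # pr)"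
    then show "x \<in> full_tree N' (b # pr)" using Cons by (cases x) (auto simp: Cons_in_full_tree)
  qed
qed simp

lemma full_tree_append: "0 < N \<Longrightarrow> full_tree N (pr @ [False]) \<subseteq> full_tree N (pr @ [b])"
proof (induction pr)
  case Nil
  then show ?case by (auto simp: full_tree.simps)
next
  case (Cons c pr)
  show ?case
  proof
    fix x assume "x \<in> full_tree N ((c # pr) @ [False])"
    then show "x \<in> full_tree N ((c # pr) @ [b])" using Cons by (cases x) (auto simp: Cons_in_full_tree)
  qed
qed

text \<open>All children in the tree with flag \<open>False\<close> carry \<open>True\<close>, and
  with at most \<open>l < N\<close> picks some child \<open>c\<close> is untouched. The other
  children are matched with the nonzero children on the opposite side, by equal subtrees. What
  remains is the \<open>True\<close> subtree at \<open>c\<close> against the \<open>False\<close>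
  subtree at \<open>0\<close>, and the spoiler moves next in the latter: this is the induction
  hypothesis. Levels without branching cost no round.\<close>

lemma alt_tree_game:
  assumes "l < N"
  shows "ag ladj l (count_list pr True) (alt_tree N pr False) (alt_tree N pr True) {([], [])}"
proof (induction pr)
  case Nil
  then show ?case by (simp add: piso_def)
next
  case (Cons b pr)
  define A where "A = alt_tree N pr False"
  define B where "B = alt_tree N pr True"
  let ?i = "count_list pr True"
  have IH: "ag ladj l ?i A B {([], [])}" using Cons by (simp add: A_def B_def)
  have nil: "{([], [])} \<subseteq> A \<times> B" by (simp add: A_def B_def)
  show ?case
  proof (cases b)
    case False
    let ?K = "{([], [])} :: nat list rel"
    have "ag ladj l ?i ((#) 0 ` A \<union> Domain ?K) ((#) 0 ` B \<union> Range ?K)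
        ((\<lambda>(x, y). (0 # x, 0 # y)) ` {([], [])} \<union> ?K)"
    proof (rule ag_context[OF IH nil, where g = "(#) 0" and h = "(#) 0" and K = ?K and e' = ladj])
      fix P' assume P': "{([], [])} \<subseteq> P'" "piso ladj P'"
      have nilP: "x = [] \<longleftrightarrow> y = []" if "(x, y) \<in> P'" for x y
        using pisoD(1)[OF P'(2) that, of "[]" "[]"] P'(1) by auto
      show "piso ladj ((\<lambda>(x, y). (0 # x, 0 # y)) ` P' \<union> {([], [])})"
      proof (rule piso_Un)
        show "piso ladj ((\<lambda>(x, y). (0 # x, 0 # y)) ` P')"
          using P'(2) unfolding piso_def by auto
        show "piso ladj {([], [])}" by (simp add: piso_def)
      qed (use nilP in auto)
    qed
    then have "ag ladj l ?i (alt_tree N (b # pr) False) (alt_tree N (b # pr) True)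
        ((\<lambda>(x, y). (0 # x, 0 # y)) ` {([], [])} \<union> {([], [])})"
      using False by (simp add: A_def B_def lessThan_Suc alt_tree.simps)
    then show ?thesis using False by (auto elim: ag_antimono)
  next
    case True
    let ?X = "alt_tree N (b # pr) False" and ?Y = "alt_tree N (b # pr) True"
    have XC: "j # x \<in> ?X \<longleftrightarrow> j < N \<and> x \<in> B" for j x
      using True unfolding Cons_in_alt_tree B_def by simp
    have YC: "j # x \<in> ?Y \<longleftrightarrow> j < N \<and> (if j = 0 then x \<in> A else x \<in> B)" for j x
      using True unfolding Cons_in_alt_tree A_def B_def by simp
    have "ag ladj l (Suc ?i) ?X ?Y {([], [])}"
    proof (rule ag_SucI)
      fix S assume S: "S \<subseteq> ?X" "finite S \<and> card S \<le> l"
      have "\<not> {..<N} \<subseteq> hd ` S"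
      proof
        assume "{..<N} \<subseteq> hd ` S"
        then have "N \<le> card (hd ` S)" using card_mono[of "hd ` S" "{..<N}"] S(2) by simp
        also have "\<dots> \<le> l" using card_image_le[of S hd] S(2) by simp
        finally show False using assms by simp
      qed
      then obtain c where c: "c < N" "c \<notin> hd ` S" by auto
      \<comment> \<open>In the tree with flag \<open>True\<close> the child \<open>0\<close> is
        exceptional, so the partner of child \<open>0\<close> is moved to the free position
        \<open>c\<close>.\<close>
      define \<pi> where "\<pi> j = (if j = 0 then c else j)" for j :: nat
      define K where "K = insert ([], []) {(j # x, \<pi> j # x) | j x. j < N \<and> j \<noteq> c \<and> x \<in> B}"
      have \<pi>: "\<pi> j < N" "\<pi> j \<noteq> 0" if "j < N" "j \<noteq> c" for j using that c by (auto simp: \<pi>_def)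
      have \<pi>inj: "\<pi> j = \<pi> j' \<longleftrightarrow> j = j'" if "j \<noteq> c" "j' \<noteq> c" for j j' using that by (auto simp: \<pi>_def)
      have KXY: "K \<subseteq> ?X \<times> ?Y"
      proof
        fix p assume "p \<in> K"
        then consider "p = ([], [])" | j x where "p = (j # x, \<pi> j # x)" "j < N" "j \<noteq> c" "x \<in> B"
          by (auto simp: K_def)
        then show "p \<in> ?X \<times> ?Y"
        proof cases
          case 2
          then show ?thesis using \<pi>[OF 2(2,3)] by (simp add: XC YC)
        qed simp
      qed
      have SK: "S \<subseteq> Domain K"
      proof
        fix x assume x: "x \<in> S"
        show "x \<in> Domain K"
        proof (cases x)
          case Nil
          then show ?thesis by (auto simp: K_def)
        next
          case (Cons j y)
          then have "j < N" "y \<in> B" using x S(1) XC by auto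
          moreover have "j \<noteq> c" using c(2) x Cons by force
          ultimately have "(x, \<pi> j # y) \<in> K" using Cons by (auto simp: K_def)
          then show ?thesis by blast
        qed
      qed
      have dom: "(#) 0 ` A \<union> Domain (K\<inverse>) = ?Y"
      proof (intro equalityI subsetI)
        fix y assume "y \<in> (#) 0 ` A \<union> Domain (K\<inverse>)"
        then show "y \<in> ?Y" using KXY YC c(1) by auto
      next
        fix y assume y: "y \<in> ?Y"
        show "y \<in> (#) 0 ` A \<union> Domain (K\<inverse>)"
        proof (cases y)
          case Nil
          then show ?thesis by (auto simp: K_def)
        next
          case (Cons j x)
          show ?thesis
          proof (cases "j = 0")
            case True
            then show ?thesis using y Cons YC by auto
          next
            case False
            define j' where "j' = (if j = c then 0 else j)"
            have "j' < N" "j' \<noteq> c" "\<pi> j' = j" "x \<in> B"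
              using y Cons YC False c(1) by (auto simp: j'_def \<pi>_def)
            then have "(j' # x, y) \<in> K" using Cons by (auto simp: K_def)
            then show ?thesis by blast
          qed
        qed
      qed
      have ran: "(#) c ` B \<union> Range (K\<inverse>) = ?X"
      proof (intro equalityI subsetI)
        fix y assume "y \<in> (#) c ` B \<union> Range (K\<inverse>)"
        then show "y \<in> ?X" using KXY XC c(1) by auto
      next
        fix y assume y: "y \<in> ?X"
        show "y \<in> (#) c ` B \<union> Range (K\<inverse>)"
        proof (cases y)
          case Nil
          then show ?thesis by (auto simp: K_def)
        next
          case (Cons j x)
          have jx: "j < N" "x \<in> B" using y Cons XC by auto
          show ?thesis
          proof (cases "j = c")
            case True
            then show ?thesis using jx Cons by auto
          next
            case False
            then have "(y, \<pi> j # x) \<in> K" using Cons jx by (auto simp: K_def)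
            then show ?thesis by blast
          qed
        qed
      qed
      have "ag ladj l ?i ((#) 0 ` A \<union> Domain (K\<inverse>)) ((#) c ` B \<union> Range (K\<inverse>))
          ((\<lambda>(x, y). (0 # x, c # y)) ` {([], [])} \<union> K\<inverse>)"
      proof (rule ag_context[OF IH nil, where g = "(#) 0" and h = "(#) c" and K = "K\<inverse>" and e' = ladj])
        fix P' assume P': "{([], [])} \<subseteq> P'" "piso ladj P'"
        have nilP: "x = [] \<longleftrightarrow> y = []" if "(x, y) \<in> P'" for x y
          using pisoD(1)[OF P'(2) that, of "[]" "[]"] P'(1) by auto
        have Kc: "(u, v) \<in> K\<inverse> \<longleftrightarrow> (u = [] \<and> v = []) \<or> (\<exists>j x. u = \<pi> j # x \<and> v = j # x \<and> j < N \<and> j \<noteq> c \<and> x \<in> B)"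
          for u v by (auto simp: K_def)
        show "piso ladj ((\<lambda>(x, y). (0 # x, c # y)) ` P' \<union> K\<inverse>)"
        proof (rule piso_Un)
          show "piso ladj ((\<lambda>(x, y). (0 # x, c # y)) ` P')"
            using P'(2) unfolding piso_def by auto
          show "piso ladj (K\<inverse>)"
            unfolding piso_def Kc using \<pi>inj by fastforce
          fix u v u' v'
          assume "(u, v) \<in> (\<lambda>(x, y). (0 # x, c # y)) ` P'"
          then obtain x y where xy: "u = 0 # x" "v = c # y" "(x, y) \<in> P'" by auto
          assume "(u', v') \<in> K\<inverse>"
          then consider "u' = []" "v' = []" | j z where "u' = \<pi> j # z" "v' = j # z" "j < N" "j \<noteq> c"
            unfolding Kc by blast
          then show "(u = u') = (v = v') \<and> ladj u u' = ladj v v' \<and> ladj u' u = ladj v' v"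
          proof cases
            case 1
            then show ?thesis using xy nilP[OF xy(3)] by simp
          next
            case 2
            then show ?thesis using xy \<pi>(2)[OF 2(3,4)] by auto
          qed
        qed
      qed
      then have "ag ladj l ?i ?Y ?X (({([], [])} \<union> K)\<inverse>)"
        unfolding dom ran by (rule ag_antimono) (auto simp: K_def)
      then show "\<exists>R. R \<subseteq> ?X \<times> ?Y \<and> S \<subseteq> Domain R \<and> ag ladj l ?i ?Y ?X (({([], [])} \<union> R)\<inverse>)"
        using KXY SK by blast
    qed
    then show ?thesis using True by simp
  qed
qed

text \<open>Variable \<open>n\<close> holds the previous vertex and \<open>n + 1\<close> the current
  one, so excluding the former forces a step downwards. At the root both hold the root, and no
  neighbour is excluded.\<close>

definition next_vertex :: "nat \<Rightarrow> fo \<Rightarrow> fo" where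
  "next_vertex n \<phi> = Exi (n + 2) (Conj (Adj (n + 1) (n + 2)) (Conj (Neg (Eq (n + 2) n)) \<phi>))"

primrec alt_formula :: "bool list \<Rightarrow> nat \<Rightarrow> fo" where
  "alt_formula [] n = next_vertex n (Eq n n)"
| "alt_formula (b # pr) n =
    next_vertex n (if b then Neg (alt_formula pr (Suc n)) else alt_formula pr (Suc n))"

lemma sat_next_vertex:
  assumes u: "u \<in> T" "s (Suc n) = u" and p: "u = [] \<and> s n = u \<or> (\<exists>a. u = s n @ [a])"
  shows "sat (rel_graph ladj T) s (next_vertex n \<phi>) \<longleftrightarrow>
    (\<exists>a. u @ [a] \<in> T \<and> sat (rel_graph ladj T) (s(n + 2 := u @ [a])) \<phi>)"
proof -
  have "ladj u z \<and> z \<noteq> s n \<longleftrightarrow> (\<exists>a. z = u @ [a])" for z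
    using p unfolding ladj_iff by auto
  moreover have "sat (rel_graph ladj T) s (next_vertex n \<phi>) \<longleftrightarrow>
      (\<exists>v\<in>T. (ladj u v \<and> v \<noteq> s n) \<and> sat (rel_graph ladj T) (s(n + 2 := v)) \<phi>)"
    using u by (auto simp: next_vertex_def)
  ultimately show ?thesis by auto
qed

text \<open>The formula computes the flag: at a branching level a node has flag \<open>True\<close>
  iff some child has flag \<open>False\<close>, a single child inherits the flag, and at the bottom
  the flag is the existence of a further child.\<close>

lemma sat_alt_formula:
  "u \<in> T \<Longrightarrow> (\<And>x. u @ x \<in> T \<longleftrightarrow> x \<in> alt_tree N pr b) \<Longrightarrow> 0 < N \<Longrightarrow> s (Suc n) = u \<Longrightarrow>
    u = [] \<and> s n = u \<or> (\<exists>a. u = s n @ [a]) \<Longrightarrow> sat (rel_graph ladj T) s (alt_formula pr n) \<longleftrightarrow> b"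
proof (induction pr arbitrary: u b s n)
  case Nil
  show ?case
    unfolding alt_formula.simps sat_next_vertex[OF Nil(1,4,5)] Nil(2) by simp
next
  case (Cons c pr)
  have step: "sat (rel_graph ladj T) (s(n + 2 := u @ [a])) (alt_formula pr (Suc n)) \<longleftrightarrow>
      (if c then \<not> b \<or> a \<noteq> 0 else b)" if "u @ [a] \<in> T" for a
  proof (rule Cons.IH[OF that _ Cons.prems(3)])
    have "a < (if c then N else 1)" using that Cons.prems(2)[of "[a]"] unfolding Cons_in_alt_tree by simp
    then show "(u @ [a]) @ x \<in> T \<longleftrightarrow> x \<in> alt_tree N pr (if c then \<not> b \<or> a \<noteq> 0 else b)" for x
      using Cons.prems(2)[of "a # x"] unfolding Cons_in_alt_tree by simp
  qed (use Cons.prems(4) in auto)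
  have ex: "u @ [a] \<in> T \<longleftrightarrow> a < (if c then N else 1)" for a
    using Cons.prems(2)[of "[a]"] unfolding Cons_in_alt_tree by simp
  have "sat (rel_graph ladj T) s (alt_formula (c # pr) n) \<longleftrightarrow>
      (\<exists>a. u @ [a] \<in> T \<and> (if c then \<not> (\<not> b \<or> a \<noteq> 0) else b))"
    unfolding alt_formula.simps sat_next_vertex[OF Cons.prems(1,4,5)] using step by auto
  also have "\<dots> \<longleftrightarrow> b" unfolding ex using Cons.prems(3) by auto
  finally show ?case .
qed

definition image_graph :: "('a \<Rightarrow> 'b) \<Rightarrow> ('a \<Rightarrow> 'a \<Rightarrow> bool) \<Rightarrow> 'a set \<Rightarrow> 'b pair_pre_digraph" where
  "image_graph g e X = \<lparr>pverts = g ` X, parcs = {(g x, g y) | x y. x \<in> X \<and> y \<in> X \<and> e x y}\<rparr>"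

lemma image_graph_simps:
  "pverts (image_graph g e X) = g ` X"
  "parcs (image_graph g e X) = {(g x, g y) | x y. x \<in> X \<and> y \<in> X \<and> e x y}"
  by (simp_all add: image_graph_def)

lemma sat_image_graph:
  "inj_on g X \<Longrightarrow> \<forall>x\<in>fv \<phi>. s x \<in> X \<Longrightarrow> sat (image_graph g e X) (g \<circ> s) \<phi> = sat (rel_graph e X) s \<phi>"
proof (induction \<phi> arbitrary: s)
  case (Eq x y)
  then show ?case by (auto dest: inj_onD)
next
  case (Adj x y)
  then have xy: "s x \<in> X" "s y \<in> X" by auto
  have "(g (s x), g (s y)) \<in> parcs (image_graph g e X) \<longleftrightarrow> e (s x) (s y)"
  proof
    assume "(g (s x), g (s y)) \<in> parcs (image_graph g e X)"
    then obtain a b where "a \<in> X" "b \<in> X" "e a b" "g (s x) = g a" "g (s y) = g b"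
      by (auto simp: image_graph_simps)
    then show "e (s x) (s y)" using inj_onD[OF Adj(1)] xy by metis
  qed (use xy in \<open>auto simp: image_graph_simps\<close>)
  then show ?case using xy by simp
next
  case (Exi x \<phi>)
  have "sat (image_graph g e X) ((g \<circ> s)(x := g v)) \<phi> = sat (rel_graph e X) (s(x := v)) \<phi>" if "v \<in> X" for v
    unfolding fun_upd_comp[symmetric] by (rule Exi.IH[OF Exi.prems(1)]) (use Exi.prems(2) that in auto)
  then show ?case unfolding sat.simps image_graph_simps(1) rel_graph_simps(1) by blast
next
  case (Uni x \<phi>)
  have "sat (image_graph g e X) ((g \<circ> s)(x := g v)) \<phi> = sat (rel_graph e X) (s(x := v)) \<phi>" if "v \<in> X" for v
    unfolding fun_upd_comp[symmetric] by (rule Uni.IH[OF Uni.prems(1)]) (use Uni.prems(2) that in auto)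
  then show ?case unfolding sat.simps image_graph_simps(1) rel_graph_simps(1) by blast
qed auto

text \<open>At most \<open>k\<close> alternations make at most \<open>k + 1\<close> blocks, and a
  word that begins with \<open>Forall\<close> needs an empty existential block in front.\<close>

lemma branches_in_qwords:
  assumes "alternation_rank \<psi> \<le> k" "k + 2 \<le> n"
  shows "branches (nnf \<psi>) \<subseteq> qwords n Exists"
proof
  fix w assume w: "w \<in> branches (nnf \<psi>)"
  then have "alternations w \<le> alternation_rank \<psi>"
    unfolding alternation_rank_def using branches_finite_nonempty[of "nnf \<psi>"] by (intro Max_ge) auto
  then have alt: "alternations w \<le> k" using assms(1) by simp
  show "w \<in> qwords n Exists"
  proof (cases "w = []")
    case True
    then show ?thesis using qwords_Nil by simp
  next
    case False
    have wk: "w \<in> qwords (Suc k) (hd w)" by (rule alternations_qwords[OF alt False])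
    have "w \<in> qwords (k + 2) Exists"
    proof (cases "hd w")
      case Exists
      then show ?thesis using qwords_Suc[of w "Suc k" Exists] wk by (simp del: qwords.simps)
    next
      case Forall
      then show ?thesis using qwords_skip[of w "Suc k" Exists] wk by (simp del: qwords.simps)
    qed
    then show ?thesis using assms(2) by (rule qwords_mono)
  qed
qed

text \<open>The game carries truth from the tree with flag \<open>False\<close> to that with flag
  \<open>True\<close>, whence the negation: it holds on the first tree only. The branching
  \<open>N\<close> exceeds the number of quantifiers of \<open>\<psi>\<close>, and monotonicity puts
  both trees into \<open>C\<close>.\<close>

lemma no_alternation_bound:
  assumes C: "graph_class C" "monotone_class C" and pr: "k + 2 \<le> count_list pr True"
    and emb: "\<And>N. \<exists>G\<in>C. \<exists>g. inj_on g (full_tree N (pr @ [False])) \<and> g ` full_tree N (pr @ [False]) \<subseteq> pverts G \<and>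
      (\<forall>x\<in>full_tree N (pr @ [False]). \<forall>y\<in>full_tree N (pr @ [False]). ladj x y \<longrightarrow> (g x, g y) \<in> parcs G)"
    and eq: "equivalent_on C (Neg (alt_formula pr 0)) \<psi>"
  shows "k < alternation_rank \<psi>"
proof (rule ccontr)
  assume "\<not> k < alternation_rank \<psi>"
  then have b: "branches (nnf \<psi>) \<subseteq> qwords (count_list pr True) Exists"
    by (intro branches_in_qwords[OF _ pr]) simp
  define l where "l = nquants \<psi>"
  define N where "N = Suc l"
  let ?F = "full_tree N (pr @ [False])"
  obtain G g where G: "G \<in> C" and g: "inj_on g ?F" "g ` ?F \<subseteq> pverts G"
    "\<forall>x\<in>?F. \<forall>y\<in>?F. ladj x y \<longrightarrow> (g x, g y) \<in> parcs G"
    using emb[of N] by (elim bexE exE conjE)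
  have pG: "pair_graph G" using C(1) G by (simp add: graph_class_def)
  let ?X = "alt_tree N pr" and ?s = "\<lambda>_ :: nat. [] :: nat list"
  have XF: "?X t \<subseteq> ?F" for t by (rule alt_tree_subset) (simp add: N_def)
  define H where "H t = image_graph g ladj (?X t)" for t
  have HC: "H t \<in> C" for t
  proof -
    have "parcs (H t) \<subseteq> parcs G" using g(3) XF[of t] by (auto simp: H_def image_graph_simps)
    moreover have HV: "pverts (H t) \<subseteq> pverts G" using g(2) XF[of t] by (auto simp: H_def image_graph_simps)
    moreover have "pair_graph (H t)"
      unfolding pair_graph_iff
    proof (intro conjI allI impI)
      show "finite (pverts (H t))" using HV pG finite_subset unfolding pair_graph_iff by blast
      fix u v assume uv: "(u, v) \<in> parcs (H t)"
      then show "u \<in> pverts (H t)" "v \<in> pverts (H t)" by (auto simp: H_def image_graph_simps)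
      show "u \<noteq> v" using calculation(1) uv pG unfolding pair_graph_iff by blast
      have "ladj x y \<Longrightarrow> ladj y x" for x y unfolding ladj_iff by blast
      then show "(v, u) \<in> parcs (H t)" using uv by (auto simp: H_def image_graph_simps)
    qed
    ultimately show ?thesis using C(2) G subgraph_iff[OF pG, of "H t"] unfolding monotone_class_def by blast
  qed
  have inj: "inj_on g (?X t)" for t using g(1) XF inj_on_subset by blast
  have trans: "sat (H t) (g \<circ> ?s) \<phi> = sat (rel_graph ladj (?X t)) ?s \<phi>" for t \<phi>
    unfolding H_def by (rule sat_image_graph[OF inj]) simp
  have eqH: "sat (H t) (g \<circ> ?s) (Neg (alt_formula pr 0)) = sat (H t) (g \<circ> ?s) \<psi>" for t
    using eq HC[of t] unfolding equivalent_on_def by (auto simp: H_def image_graph_simps)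
  have val: "sat (rel_graph ladj (?X t)) ?s (alt_formula pr 0) \<longleftrightarrow> t" for t
    by (rule sat_alt_formula[of "[]" _ N]) (simp_all add: N_def)
  have "sat (rel_graph ladj (?X False)) ?s \<psi>" using eqH[of False] val[of False] trans by simp
  moreover have "ag ladj l (count_list pr True) (?X False) (?X True) {([], [])}"
    by (rule alt_tree_game) (simp add: N_def)
  ultimately have "sat (rel_graph ladj (?X True)) ?s \<psi>"
    by (intro ag_sat[of ladj l "count_list pr True" "?X False" "?X True" "{([], [])}" \<psi> ?s ?s])
      (use b in \<open>simp_all add: l_def\<close>)
  then show False using eqH[of True] val[of True] trans by simp
qed

section \<open>Complete trees and their subdivisions\<close>

lemma set_vwalk_arcs_conv_nth: "set (vwalk_arcs p) = {(p ! i, p ! Suc i) | i. Suc i < length p}"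
proof (induction p rule: vwalk_arcs.induct)
  case (3 x y xs)
  have "{(( x # y # xs) ! i, (x # y # xs) ! Suc i) | i. Suc i < length (x # y # xs)} =
      insert (x, y) {((y # xs) ! i, (y # xs) ! Suc i) | i. Suc i < length (y # xs)}" (is "?L = insert _ ?R")
  proof (intro equalityI subsetI)
    fix e assume "e \<in> ?L"
    then obtain i where "e = ((x # y # xs) ! i, (x # y # xs) ! Suc i)" "Suc i < length (x # y # xs)" by blast
    then show "e \<in> insert (x, y) ?R" by (cases i) auto
  next
    fix e assume "e \<in> insert (x, y) ?R"
    then consider "e = (x, y)" | i where "e = ((y # xs) ! i, (y # xs) ! Suc i)" "Suc i < length (y # xs)"
      by blast
    then show "e \<in> ?L"
    proof cases
      case 1
      then show ?thesis by (intro CollectI exI[of _ 0]) simp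
    next
      case 2
      then show ?thesis by (intro CollectI exI[of _ "Suc i"]) simp
    qed
  qed
  then show ?case using 3 by simp
qed auto

lemma ladj_sym: "ladj x y \<Longrightarrow> ladj y x"
  unfolding ladj_iff by blast

section \<open>Paths and depth in complete trees of lists\<close>

definition lpath :: "nat list set \<Rightarrow> nat list list \<Rightarrow> bool" where
  "lpath X q \<longleftrightarrow> q \<noteq> [] \<and> distinct q \<and> set q \<subseteq> X \<and> (\<forall>i. Suc i < length q \<longrightarrow> ladj (q ! i) (q ! Suc i))"

lemma vpath_image_graph:
  assumes "inj c"
  shows "vpath p (with_proj (image_graph c ladj X)) \<longleftrightarrow> (\<exists>q. p = map c q \<and> lpath X q)"
proof
  assume p: "vpath p (with_proj (image_graph c ladj X))"
  define q where "q = map (inv c) p"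
  have pX: "set p \<subseteq> c ` X" using p by (simp add: vpath_iff image_graph_simps)
  have pq: "p = map c q" unfolding q_def map_map
    by (rule map_idI[symmetric]) (use pX in \<open>auto simp: f_inv_into_f\<close>)
  have "ladj (q ! i) (q ! Suc i)" if "Suc i < length q" for i
  proof -
    have "(p ! i, p ! Suc i) \<in> parcs (image_graph c ladj X)"
      using p that unfolding vpath_iff set_vwalk_arcs_conv_nth by (auto simp: q_def)
    then obtain x y where "p ! i = c x" "p ! Suc i = c y" "ladj x y" by (auto simp: image_graph_simps)
    then show ?thesis using that by (simp add: q_def inv_f_f[OF assms])
  qed
  moreover have "set q \<subseteq> X" using pX by (auto simp: q_def inv_f_f[OF assms])
  moreover have "distinct q" "q \<noteq> []" using p pq by (auto simp: vpath_iff distinct_map)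
  ultimately show "\<exists>q. p = map c q \<and> lpath X q" using pq unfolding lpath_def by blast
next
  assume "\<exists>q. p = map c q \<and> lpath X q"
  then obtain q where q: "p = map c q" "lpath X q" by blast
  have "set (vwalk_arcs p) \<subseteq> parcs (image_graph c ladj X)"
    unfolding set_vwalk_arcs_conv_nth
  proof clarify
    fix i assume i: "Suc i < length p"
    then have "q ! i \<in> X" "q ! Suc i \<in> X" "ladj (q ! i) (q ! Suc i)"
      using q unfolding lpath_def by (auto simp: subset_eq)
    then show "(p ! i, p ! Suc i) \<in> parcs (image_graph c ladj X)"
      using q(1) i by (auto simp: image_graph_simps)
  qed
  then show "vpath p (with_proj (image_graph c ladj X))"
    using q assms unfolding vpath_iff lpath_def
    by (auto simp: image_graph_simps distinct_map intro: inj_on_subset)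
qed

text \<open>A path from the root never turns back: the only neighbour closer to the root is the
  parent, which the path has just left.\<close>

lemma lpath_root_length:
  assumes q: "lpath X q" "hd q = []"
  shows "i < length q \<Longrightarrow> length (q ! i) = i"
proof (induction i rule: less_induct)
  case (less i)
  show ?case
  proof (cases i)
    case 0
    then show ?thesis using q less.prems by (simp add: hd_conv_nth)
  next
    case (Suc j)
    have len: "length (q ! j) = j" using less Suc by simp
    have "ladj (q ! j) (q ! i)" using q(1) less.prems Suc by (simp add: lpath_def)
    then consider a where "q ! i = q ! j @ [a]" | a where "q ! j = q ! i @ [a]" unfolding ladj_iff by blast
    then show ?thesis
    proof cases
      case 1
      then show ?thesis using len Suc by simp
    next
      case 2
      then obtain k where k: "j = Suc k" using len by (cases j) auto
      have lenk: "length (q ! k) = k" using less Suc k by simp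
      have "ladj (q ! k) (q ! j)" using q(1) less.prems Suc k by (simp add: lpath_def)
      then obtain b where "q ! j = q ! k @ [b]" using len lenk k unfolding ladj_iff by auto
      then have "q ! i = q ! k" using 2 by simp
      moreover have "distinct q" using q(1) by (simp add: lpath_def)
      ultimately have "i = k" using less.prems Suc k by (simp add: nth_eq_iff_index_eq)
      then show ?thesis using Suc k by simp
    qed
  qed
qed

text \<open>A list of greatest length on a cycle has two distinct neighbours there, but both would
  have to be its parent.\<close>

lemma lpath_no_cycle:
  assumes q: "lpath X q" "3 \<le> length q"
  shows "\<not> ladj (last q) (hd q)"
proof
  assume cyc: "ladj (last q) (hd q)"
  let ?n = "length q"
  have "\<exists>m. m < ?n \<and> (\<forall>i. i < ?n \<longrightarrow> length (q ! i) \<le> length (q ! m))"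
  proof (rule ex_has_greatest_nat[of "\<lambda>i. i < ?n" 0 "\<lambda>i. length (q ! i)" "Suc (Max (length ` set q))"])
    show "0 < ?n" using q(2) by linarith
    show "\<forall>i. i < ?n \<longrightarrow> length (q ! i) < Suc (Max (length ` set q))"
      by (simp add: less_Suc_eq_le)
  qed
  then obtain m where m: "m < ?n" and max: "\<And>i. i < ?n \<Longrightarrow> length (q ! i) \<le> length (q ! m)" by blast
  have parent: "y = butlast x" if "ladj x y" "length y \<le> length x" for x y
    using that unfolding ladj_iff by auto
  define nx where "nx = (if Suc m = ?n then 0 else Suc m)"
  define pv where "pv = (if m = 0 then ?n - 1 else m - 1)"
  have lt: "nx < ?n" "pv < ?n" "nx \<noteq> pv" using m q(2) by (auto simp: nx_def pv_def)
  have hdlast: "hd q = q ! 0" "last q = q ! (?n - 1)"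
    using q by (auto simp: lpath_def hd_conv_nth last_conv_nth)
  have adj: "ladj (q ! i) (q ! Suc i)" if "Suc i < ?n" for i using q(1) that by (simp add: lpath_def)
  have "ladj (q ! m) (q ! nx)"
  proof (cases "Suc m = ?n")
    case True
    then show ?thesis using cyc hdlast by (simp add: nx_def flip: True)
  next
    case False
    then show ?thesis using adj[of m] m by (simp add: nx_def)
  qed
  moreover have "ladj (q ! m) (q ! pv)"
  proof (cases "m = 0")
    case True
    then show ?thesis using ladj_sym[OF cyc] hdlast by (simp add: pv_def)
  next
    case False
    then show ?thesis using ladj_sym[OF adj[of "m - 1"]] m by (simp add: pv_def)
  qed
  ultimately have "q ! nx = q ! pv" using parent max lt by metis
  moreover have "distinct q" using q(1) by (simp add: lpath_def)
  ultimately show False using lt by (simp add: nth_eq_iff_index_eq)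
qed

definition lists_below :: "nat \<Rightarrow> nat \<Rightarrow> nat list set" where
  "lists_below b d = {u. length u < d \<and> set u \<subseteq> {..<b}}"

text \<open>The lists are coded by \<open>to_nat\<close> because the graphs of a class have natural
  numbers as vertices.\<close>

definition complete_tree :: "nat \<Rightarrow> nat \<Rightarrow> ngraph" where
  "complete_tree b d = image_graph to_nat ladj (lists_below b d)"

lemma undirected_tree_complete_tree:
  assumes "0 < d"
  shows "undirected_tree (complete_tree b d)"
proof -
  let ?c = "to_nat :: nat list \<Rightarrow> nat" and ?X = "lists_below b d" and ?T = "complete_tree b d"
  have fin: "finite ?X"
    by (rule finite_subset[OF _ finite_lists_length_le[of "{..<b}" d]]) (auto simp: lists_below_def)
  have arc: "(?c x, ?c y) \<in> parcs ?T" if "x \<in> ?X" "y \<in> ?X" "ladj x y" for x y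
    using that by (auto simp: complete_tree_def image_graph_simps)
  have pg: "pair_graph ?T"
    unfolding pair_graph_iff
  proof (intro conjI allI impI)
    show "finite (pverts ?T)" using fin by (simp add: complete_tree_def image_graph_simps)
    fix u v assume "(u, v) \<in> parcs ?T"
    then obtain x y where xy: "u = ?c x" "v = ?c y" "x \<in> ?X" "y \<in> ?X" "ladj x y"
      by (auto simp: complete_tree_def image_graph_simps)
    show "u \<in> pverts ?T" "v \<in> pverts ?T" using xy by (auto simp: complete_tree_def image_graph_simps)
    show "u \<noteq> v" using xy by (auto simp: ladj_iff)
    show "(v, u) \<in> parcs ?T" using arc[OF xy(4,3) ladj_sym[OF xy(5)]] xy by simp
  qed
  have V: "pverts ?T = ?c ` ?X" by (simp add: complete_tree_def image_graph_simps)
  have sub: "x \<in> ?X" if "x @ [a] \<in> ?X" for x a using that by (auto simp: lists_below_def)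
  have reach: "(?c [], ?c x) \<in> rtrancl_on (pverts ?T) (parcs ?T) \<and>
      (?c x, ?c []) \<in> rtrancl_on (pverts ?T) (parcs ?T)" if "x \<in> ?X" for x
    using that
  proof (induction x rule: rev_induct)
    case Nil
    then show ?case by (simp add: V)
  next
    case (snoc a x)
    have x: "x \<in> ?X" by (rule sub[OF snoc.prems])
    have "(?c x, ?c (x @ [a])) \<in> parcs ?T" "(?c (x @ [a]), ?c x) \<in> parcs ?T"
      using arc[OF x snoc.prems] arc[OF snoc.prems x] by (simp_all add: ladj_iff)
    moreover have "?c (x @ [a]) \<in> pverts ?T" using snoc.prems by (simp add: V)
    ultimately show ?case
      using snoc.IH[OF x] rtrancl_on_into_rtrancl_on converse_rtrancl_on_into_rtrancl_on by metis
  qed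
  have parcs: "parcs (mk_symmetric (with_proj ?T)) = parcs ?T"
    using pg unfolding parcs_mk_symmetric pair_graph_iff by auto
  have "Digraph_Component.connected (with_proj ?T)"
    unfolding connected_def
  proof (rule strongly_connectedI)
    show "verts (with_proj (mk_symmetric (with_proj ?T))) \<noteq> {}"
      using assms by (auto simp: V lists_below_def intro: exI[of _ "[]"])
    fix u v
    assume "u \<in> verts (with_proj (mk_symmetric (with_proj ?T)))"
      "v \<in> verts (with_proj (mk_symmetric (with_proj ?T)))"
    then obtain x y where xy: "u = ?c x" "v = ?c y" "x \<in> ?X" "y \<in> ?X" by (auto simp: V)
    have "(u, v) \<in> rtrancl_on (pverts ?T) (parcs ?T)"
      unfolding xy(1,2)
      by (rule rtrancl_on_trans[OF conjunct2[OF reach[OF xy(3)]] conjunct1[OF reach[OF xy(4)]]])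
    then show "u \<rightarrow>\<^sup>*\<^bsub>with_proj (mk_symmetric (with_proj ?T))\<^esub> v"
      unfolding reachable_def by (simp add: parcs)
  qed
  moreover have "\<not> undirected_cycle ?T p" for p
  proof
    assume p: "undirected_cycle ?T p"
    then obtain q where q: "p = map ?c q" "lpath ?X q"
      using vpath_image_graph[of ?c p ?X] by (auto simp: undirected_cycle_def complete_tree_def)
    have len: "3 \<le> length q" and "(last p, hd p) \<in> parcs ?T" using p q(1) by (auto simp: undirected_cycle_def)
    moreover have "q \<noteq> []" using q(2) by (simp add: lpath_def)
    ultimately have "(?c (last q), ?c (hd q)) \<in> parcs ?T" using q(1) by (simp add: last_map hd_map)
    then have "ladj (last q) (hd q)" by (auto simp: complete_tree_def image_graph_simps)
    then show False using lpath_no_cycle[OF q(2) len] by simp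
  qed
  ultimately show ?thesis using pg by (simp add: undirected_tree_def)
qed

lemma complete_tree_depth:
  assumes "0 < d" "0 < b"
  shows "complete_tree b d \<in> trees_of_depth d"
proof -
  let ?c = "to_nat :: nat list \<Rightarrow> nat" and ?X = "lists_below b d" and ?T = "complete_tree b d"
  have vp: "vpath p (with_proj ?T) \<longleftrightarrow> (\<exists>q. p = map ?c q \<and> lpath ?X q)" for p
    unfolding complete_tree_def by (rule vpath_image_graph) simp
  have le: "length q \<le> d" if "lpath ?X q" "hd q = []" for q
  proof -
    have "length q - 1 < length q" using that(1) by (simp add: lpath_def)
    then have "length (q ! (length q - 1)) = length q - 1" "q ! (length q - 1) \<in> ?X"
      using lpath_root_length[OF that] that(1) by (auto simp: lpath_def subset_eq)
    then show ?thesis by (auto simp: lists_below_def)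
  qed
  have "length p = d" if p: "root_leaf_path ?T (?c []) p" for p
  proof -
    obtain q where q: "p = map ?c q" "lpath ?X q"
      using p vp by (auto simp: root_leaf_path_def)
    have qne: "q \<noteq> []" using q(2) by (simp add: lpath_def)
    have hd: "hd q = []" using p q qne by (auto simp: root_leaf_path_def hd_map)
    have lq: "length (last q) = length q - 1"
      using lpath_root_length[OF q(2) hd, of "length q - 1"] qne by (simp add: last_conv_nth)
    \<comment> \<open>The end of a shorter path still has the child with last entry
      \<open>0\<close>, so it is no leaf.\<close>
    have "\<not> length q < d"
    proof
      assume lt: "length q < d"
      let ?u = "last q @ [0]"
      have uX: "?u \<in> ?X"
        using q(2) qne lt lq assms(2) by (auto simp: lists_below_def lpath_def subset_eq)
      have "?u \<notin> set q"
      proof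
        assume "?u \<in> set q"
        then obtain i where "i < length q" "q ! i = ?u" by (auto simp: in_set_conv_nth)
        then show False using lpath_root_length[OF q(2) hd, of i] lq qne by (cases q) auto
      qed
      moreover have "ladj ((q @ [?u]) ! i) ((q @ [?u]) ! Suc i)" if i: "Suc i < length (q @ [?u])" for i
      proof (cases "Suc i < length q")
        case True
        then show ?thesis using q(2) by (simp add: lpath_def nth_append)
      next
        case False
        then have "i = length q - 1" "Suc i = length q" using i by auto
        then show ?thesis using qne by (simp add: nth_append ladj_iff last_conv_nth)
      qed
      ultimately have "lpath ?X (q @ [?u])" using q(2) uX by (simp add: lpath_def)
      then have "vpath (map ?c (q @ [?u])) (with_proj ?T)" using vp by blast
      moreover have "map ?c (q @ [?u]) = butlast p @ [last p, ?c ?u]"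
        using q(1) qne by (simp add: append_butlast_last_id[symmetric] del: append_butlast_last_id)
      moreover have "hd (map ?c (q @ [?u])) = ?c []" using qne hd by (simp add: hd_map)
      ultimately have "tree_child ?T (?c []) (last p) (?c ?u)" unfolding tree_child_def by metis
      then show False using p by (auto simp: root_leaf_path_def tree_leaf_def)
    qed
    then show ?thesis using le[OF q(2) hd] q(1) by simp
  qed
  moreover have "\<exists>p. root_leaf_path ?T (?c []) p"
  proof -
    define q where "q = map (\<lambda>i. replicate i (0 :: nat)) [0..<d]"
    have "distinct q" by (auto simp: q_def distinct_map inj_on_def dest: arg_cong[of _ _ length])
    moreover have "set q \<subseteq> ?X" using assms(2) by (auto simp: q_def lists_below_def)
    moreover have "ladj (q ! i) (q ! Suc i)" if "Suc i < length q" for i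
    proof -
      have "replicate (Suc i) (0 :: nat) = replicate i 0 @ [0]" by (simp add: replicate_append_same)
      then have "ladj (replicate i 0) (replicate (Suc i) 0)" unfolding ladj_iff by blast
      then show ?thesis using that by (simp add: q_def)
    qed
    ultimately have q: "lpath ?X q" using assms(1) by (auto simp: lpath_def q_def)
    have hd: "hd q = []" using assms(1) by (simp add: q_def hd_map)
    have last: "last q = replicate (d - 1) 0" using assms(1) by (simp add: q_def last_map)
    have "tree_leaf ?T (?c []) (last (map ?c q))"
      unfolding tree_leaf_def
    proof (intro conjI notI)
      have "last q \<in> ?X" using q by (auto simp: lpath_def)
      then show "last (map ?c q) \<in> pverts ?T"
        using q by (simp add: last_map lpath_def complete_tree_def image_graph_simps)
      assume "\<exists>u. tree_child ?T (?c []) (last (map ?c q)) u"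
      then obtain u s where s: "vpath (s @ [last (map ?c q), u]) (with_proj ?T)"
        "hd (s @ [last (map ?c q), u]) = ?c []" unfolding tree_child_def by blast
      then obtain q' where q': "s @ [last (map ?c q), u] = map ?c q'" "lpath ?X q'" using vp by blast
      have q'ne: "q' \<noteq> []" using q'(2) by (simp add: lpath_def)
      have hd': "hd q' = []" using s(2) q'ne unfolding q'(1) by (simp add: hd_map)
      have lens: "length q' = length s + 2" using arg_cong[OF q'(1), of length] by simp
      have "?c (q' ! length s) = ?c (last q)"
        using arg_cong[OF q'(1), of "\<lambda>l. l ! length s"] lens q by (simp add: nth_append last_map lpath_def)
      then have "q' ! length s = last q" by simp
      then have "length s = d - 1" using lpath_root_length[OF q'(2) hd', of "length s"] lens last by simp
      then have "length (q' ! Suc (length s)) = d"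
        using lpath_root_length[OF q'(2) hd', of "Suc (length s)"] lens assms(1) by simp
      moreover have "q' ! Suc (length s) \<in> ?X" using q'(2) lens by (auto simp: lpath_def subset_eq)
      ultimately show False by (simp add: lists_below_def)
    qed
    moreover have "vpath (map ?c q) (with_proj ?T)" using vp q by blast
    moreover have "hd (map ?c q) = ?c []" using q hd by (simp add: hd_map lpath_def)
    ultimately show ?thesis unfolding root_leaf_path_def by blast
  qed
  ultimately have "{length p | p. root_leaf_path ?T (?c []) p} = {d}" by auto
  then have "rooted_depth ?T (?c []) = d" by (simp add: rooted_depth_def)
  moreover have "?c [] \<in> pverts ?T"
    using assms(1) by (auto simp: complete_tree_def image_graph_simps lists_below_def)
  ultimately show ?thesis using undirected_tree_complete_tree[OF assms(1)] by (auto simp: trees_of_depth_def)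
qed

text \<open>A bounded set of depths has a maximum only if it is nonempty. Depth \<open>0\<close>
  belongs to it vacuously, since the root alone is already a path of length 1.\<close>

lemma zero_in_tree_rank_set: "0 \<in> tree_rank_set C"
proof -
  have "trees_of_depth 0 = {}"
  proof (rule ccontr)
    assume "trees_of_depth 0 \<noteq> {}"
    then obtain T :: ngraph and r where T: "undirected_tree T" "r \<in> pverts T" "rooted_depth T r = 0"
      by (auto simp: trees_of_depth_def)
    have "vpath [r] (with_proj T)" using T(2) by (simp add: vpath_iff)
    then show False using vpath_length_le_rooted_depth[OF T(1), of "[r]" r] T(3) by simp
  qed
  then show ?thesis by (simp add: tree_rank_set_def)
qed

section \<open>Uniformly subdivided trees inside shallow subdivisions\<close>

definition embeds :: "nat \<Rightarrow> bool list \<Rightarrow> 'a rel \<Rightarrow> 'a set \<Rightarrow> 'a \<Rightarrow> bool" where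
  "embeds N pr E Z v \<longleftrightarrow> (\<exists>g. inj_on g (full_tree N pr) \<and> g [] = v \<and> g ` full_tree N pr \<subseteq> Z \<and>
    (\<forall>x\<in>full_tree N pr. \<forall>y\<in>full_tree N pr. ladj x y \<longrightarrow> (g x, g y) \<in> E))"

lemma embeds_mono:
  assumes "embeds N pr E Z v" "Z \<subseteq> Z'" "E \<subseteq> E'"
  shows "embeds N pr E' Z' v"
proof -
  from assms(1) obtain g where g: "inj_on g (full_tree N pr)" "g [] = v" "g ` full_tree N pr \<subseteq> Z"
    "\<forall>x\<in>full_tree N pr. \<forall>y\<in>full_tree N pr. ladj x y \<longrightarrow> (g x, g y) \<in> E"
    unfolding embeds_def by (elim exE conjE)
  show ?thesis
    unfolding embeds_def
  proof (intro exI[of _ g] conjI g(1,2) subset_trans[OF g(3) assms(2)] ballI impI)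
    fix x y assume "x \<in> full_tree N pr" "y \<in> full_tree N pr" "ladj x y"
    then show "(g x, g y) \<in> E'" using g(4) assms(3) by blast
  qed
qed

lemma embeds_Nil: "v \<in> Z \<Longrightarrow> embeds N [] E Z v"
  unfolding embeds_def by (intro exI[of _ "\<lambda>_. v"]) auto

lemma embeds_Cons:
  assumes M: "M = (if b then N else 1)" and sym: "sym E"
    and emb: "\<And>j. j < M \<Longrightarrow> embeds N pr E (Z j) (v j)"
    and w: "\<And>j. j < M \<Longrightarrow> (w, v j) \<in> E" "\<And>j. j < M \<Longrightarrow> w \<notin> Z j"
    and disj: "\<And>j j'. j < M \<Longrightarrow> j' < M \<Longrightarrow> j \<noteq> j' \<Longrightarrow> Z j \<inter> Z j' = {}"
  shows "embeds N (b # pr) E (insert w (\<Union>j<M. Z j)) w"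
proof -
  have "\<exists>g. inj_on g (full_tree N pr) \<and> g [] = v j \<and> g ` full_tree N pr \<subseteq> Z j \<and>
    (\<forall>x\<in>full_tree N pr. \<forall>y\<in>full_tree N pr. ladj x y \<longrightarrow> (g x, g y) \<in> E)" if "j < M" for j
    using emb[OF that] by (simp add: embeds_def)
  then obtain G where G: "\<And>j. j < M \<Longrightarrow> inj_on (G j) (full_tree N pr)" "\<And>j. j < M \<Longrightarrow> G j [] = v j"
    "\<And>j. j < M \<Longrightarrow> G j ` full_tree N pr \<subseteq> Z j"
    "\<And>j x y. j < M \<Longrightarrow> x \<in> full_tree N pr \<Longrightarrow> y \<in> full_tree N pr \<Longrightarrow> ladj x y \<Longrightarrow> (G j x, G j y) \<in> E"
    by metis
  define g where "g x = (case x of [] \<Rightarrow> w | j # y \<Rightarrow> G j y)" for x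
  have g: "g [] = w" "g (j # y) = G j y" for j y by (simp_all add: g_def)
  have C: "j # y \<in> full_tree N (b # pr) \<longleftrightarrow> j < M \<and> y \<in> full_tree N pr" for j y
    unfolding Cons_in_full_tree M by simp
  have Z: "G j y \<in> Z j" if "j < M" "y \<in> full_tree N pr" for j y using G(3)[OF that(1)] that(2) by blast
  have ne: "w \<noteq> G j y" if "j < M" "y \<in> full_tree N pr" for j y using Z[OF that] w(2)[OF that(1)] by metis
  show ?thesis
    unfolding embeds_def
  proof (intro exI[of _ g] conjI ballI impI)
    show "inj_on g (full_tree N (b # pr))"
    proof (rule inj_onI)
      fix x y assume xy: "x \<in> full_tree N (b # pr)" "y \<in> full_tree N (b # pr)" "g x = g y"
      show "x = y"
      proof (cases x)
        case Nil
        then show ?thesis using xy ne by (cases y) (auto simp: g C)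
      next
        case x: (Cons i x')
        show ?thesis
        proof (cases y)
          case Nil
          then show ?thesis using xy ne[of i x'] x by (auto simp: g C)
        next
          case y: (Cons j y')
          have ij: "i < M" "x' \<in> full_tree N pr" "j < M" "y' \<in> full_tree N pr" using xy x y C by auto
          have eq: "G i x' = G j y'" using xy(3) x y by (simp add: g)
          have "i = j"
          proof (rule ccontr)
            assume "i \<noteq> j"
            then have "Z i \<inter> Z j = {}" using disj ij by blast
            then show False using Z[OF ij(1,2)] Z[OF ij(3,4)] eq by auto
          qed
          then show ?thesis using inj_onD[OF G(1)[OF ij(1)]] eq ij x y by auto
        qed
      qed
    qed
    show "g [] = w" by (rule g)
    show "g ` full_tree N (b # pr) \<subseteq> insert w (\<Union>j<M. Z j)"
    proof (rule image_subsetI)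
      fix x assume "x \<in> full_tree N (b # pr)"
      then show "g x \<in> insert w (\<Union>j<M. Z j)" using Z by (cases x) (auto simp: g C)
    qed
    fix x y assume xy: "x \<in> full_tree N (b # pr)" "y \<in> full_tree N (b # pr)" "ladj x y"
    show "(g x, g y) \<in> E"
    proof (cases x)
      case Nil
      then obtain j where "y = [j]" using xy(3) by (cases y) auto
      then show ?thesis using Nil xy(2) G(2)[of j] w(1)[of j] by (auto simp: g C)
    next
      case x: (Cons i x')
      show ?thesis
      proof (cases y)
        case Nil
        then have "x' = []" using xy(3) x by simp
        then show ?thesis using Nil xy(1) x G(2)[of i] w(1)[of i] symD[OF sym] by (auto simp: g C)
      next
        case y: (Cons j y')
        then show ?thesis using xy x G(4)[of i x' y'] by (auto simp: g C)
      qed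
    qed
  qed
qed

text \<open>Each arc of a path leading to the root of an embedded tree becomes a level with a single
  child; this is how a subdivided edge is absorbed.\<close>

lemma embeds_path:
  assumes sym: "sym E"
  shows "q \<noteq> [] \<Longrightarrow> distinct q \<Longrightarrow> embeds N pr E Z (last q) \<Longrightarrow> set (butlast q) \<inter> Z = {} \<Longrightarrow>
    set (vwalk_arcs q) \<subseteq> E \<Longrightarrow>
    embeds N (replicate (length q - 1) False @ pr) E (Z \<union> set (butlast q)) (hd q)"
proof (induction q rule: vwalk_arcs.induct)
  case (3 x y q)
  have IH: "embeds N (replicate (length (y # q) - 1) False @ pr) E (Z \<union> set (butlast (y # q))) y"
    using 3 by auto
  have "set (butlast (y # q)) \<subseteq> set (y # q)" by (meson in_set_butlastD subsetI)
  then have xn: "x \<notin> Z \<union> set (butlast (y # q))" using 3(3,5) by auto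
  have "embeds N (False # replicate (length (y # q) - 1) False @ pr) E
      (insert x (\<Union>j<1 :: nat. Z \<union> set (butlast (y # q)))) x"
    by (rule embeds_Cons[where v = "\<lambda>_. y", OF _ sym]) (use IH xn 3(6) in auto)
  moreover have "insert x (\<Union>j<1 :: nat. Z \<union> set (butlast (y # q))) = Z \<union> set (butlast (x # y # q))"
    by auto
  ultimately show ?case by simp
qed auto

lemma pigeonhole_fibre:
  assumes "finite K" "col ` {..<b} \<subseteq> K" "N * card K < b"
  obtains k \<iota> where "k \<in> K" "inj_on \<iota> {..<N}" "\<And>j. j < N \<Longrightarrow> \<iota> j < (b :: nat) \<and> col (\<iota> j) = k"
proof -
  have "\<exists>k\<in>K. N \<le> card {a. a < b \<and> col a = k}"
  proof (rule ccontr)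
    assume "\<not> ?thesis"
    then have less: "card {a. a < b \<and> col a = k} \<le> N" if "k \<in> K" for k using that by force
    have "{..<b} = (\<Union>k\<in>K. {a. a < b \<and> col a = k})" using assms(2) by auto
    then have "b = card (\<Union>k\<in>K. {a. a < b \<and> col a = k})" by (metis card_lessThan)
    also have "\<dots> \<le> (\<Sum>k\<in>K. card {a. a < b \<and> col a = k})" by (rule card_UN_le[OF assms(1)])
    also have "\<dots> \<le> (\<Sum>k\<in>K. N)" by (rule sum_mono) (rule less)
    also have "\<dots> = N * card K" by simp
    finally show False using assms(3) by simp
  qed
  then obtain k where k: "k \<in> K" "N \<le> card {a. a < b \<and> col a = k}" by blast
  have "card {..<N} \<le> card {a. a < b \<and> col a = k}" using k(2) by simp
  then obtain \<iota> where "\<iota> ` {..<N} \<subseteq> {a. a < b \<and> col a = k}" "inj_on \<iota> {..<N}"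
    using card_le_inj[of "{..<N}" "{a. a < b \<and> col a = k}"] by auto
  then show thesis using that[of k \<iota>] k(1) by blast
qed

text \<open>The shapes of trees with \<open>h\<close> branching levels in which all edges on one
  level are subdivided equally often, at most \<open>r\<close> times. There are finitely many, so
  they can serve as colours.\<close>

primrec profiles :: "nat \<Rightarrow> nat \<Rightarrow> bool list set" where
  "profiles r 0 = {[]}"
| "profiles r (Suc h) = (\<lambda>(t, pr). True # replicate t False @ pr) ` ({..r} \<times> profiles r h)"

lemma finite_profiles: "finite (profiles r h)"
  by (induction h) auto

lemma count_profiles: "pr \<in> profiles r h \<Longrightarrow> count_list pr True = h"
proof (induction h arbitrary: pr)
  case (Suc h)
  have "count_list (replicate t False @ p) True = count_list p True" for t p by (induction t) auto
  then show ?case using Suc by auto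
qed simp

text \<open>
  A subdivision vertex on the edge from \<open>u\<close> to its child \<open>w\<close> is owned by \<open>(w, True)\<close>, and the branch
  vertex of \<open>u\<close> by \<open>(u, False)\<close>. Disjointness of the subtrees becomes disjointness of owners.
\<close>

lemma subdivision_owner:
  assumes "shallow_subdivision r (complete_tree b d) S"
  obtains F Q own where
    "\<And>u. u \<in> lists_below b d \<Longrightarrow> F u \<in> pverts S \<and> own (F u) = (u, False)"
    "\<And>u a. u @ [a] \<in> lists_below b d \<Longrightarrow> vpath (Q u a) (with_proj S) \<and> hd (Q u a) = F u \<and>
      last (Q u a) = F (u @ [a]) \<and> length (internal_verts (Q u a)) \<le> r"
    "\<And>u a z. u @ [a] \<in> lists_below b d \<Longrightarrow> z \<in> set (internal_verts (Q u a)) \<Longrightarrow> own z = (u @ [a], True)"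
proof -
  let ?c = "to_nat :: nat list \<Rightarrow> nat" and ?X = "lists_below b d" and ?T = "complete_tree b d"
  obtain f P where f: "inj_on f (pverts ?T)"
    and P: "\<forall>(u, v) \<in> parcs ?T. vpath (P u v) (with_proj S) \<and> hd (P u v) = f u \<and> last (P u v) = f v \<and>
       P v u = rev (P u v) \<and> length (internal_verts (P u v)) \<le> r \<and>
       set (internal_verts (P u v)) \<inter> f ` pverts ?T = {}"
    and disj: "\<forall>(u, v) \<in> parcs ?T. \<forall>(x, y) \<in> parcs ?T. {u, v} \<noteq> {x, y} \<longrightarrow>
       set (internal_verts (P u v)) \<inter> set (internal_verts (P x y)) = {}"
    and V: "pverts S = f ` pverts ?T \<union> (\<Union>(u, v) \<in> parcs ?T. set (internal_verts (P u v)))"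
    using assms unfolding shallow_subdivision_def by (elim exE conjE)
  define F where "F u = f (?c u)" for u
  define Q where "Q u a = P (?c u) (?c (u @ [a]))" for u a
  have X: "u \<in> ?X" if "u @ [a] \<in> ?X" for u a using that by (auto simp: lists_below_def)
  have cX: "?c u \<in> pverts ?T" if "u \<in> ?X" for u using that by (auto simp: complete_tree_def image_graph_simps)
  have arc: "(?c u, ?c (u @ [a])) \<in> parcs ?T" if "u @ [a] \<in> ?X" for u a
    using that X[OF that] by (auto simp: complete_tree_def image_graph_simps ladj_iff)
  have Finj: "u = v" if "u \<in> ?X" "v \<in> ?X" "F u = F v" for u v
    using inj_onD[OF f that(3)[unfolded F_def]] cX that by simp
  have Q: "vpath (Q u a) (with_proj S)" "hd (Q u a) = F u" "last (Q u a) = F (u @ [a])"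
    "length (internal_verts (Q u a)) \<le> r" "set (internal_verts (Q u a)) \<inter> f ` pverts ?T = {}"
    if "u @ [a] \<in> ?X" for u a
    using bspec[OF P arc[OF that]] by (auto simp: Q_def F_def)
  have Qdisj: "u @ [a] = u' @ [a']"
    if "u @ [a] \<in> ?X" "u' @ [a'] \<in> ?X" "z \<in> set (internal_verts (Q u a))" "z \<in> set (internal_verts (Q u' a'))"
    for u a u' a' z
  proof (rule ccontr)
    assume ne: "u @ [a] \<noteq> u' @ [a']"
    have "{?c u, ?c (u @ [a])} \<noteq> {?c u', ?c (u' @ [a'])}"
    proof
      assume "{?c u, ?c (u @ [a])} = {?c u', ?c (u' @ [a'])}"
      then have "u = u' @ [a']" "u @ [a] = u'" using ne by (auto simp: doubleton_eq_iff)
      then have "length u = Suc (length u')" "length u' = Suc (length u)"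
        by (metis length_append_singleton)+
      then show False by simp
    qed
    then show False using disj arc[OF that(1)] arc[OF that(2)] that(3,4) unfolding Q_def by blast
  qed
  define own where "own z = (if \<exists>u\<in>?X. z = F u then (SOME u. u \<in> ?X \<and> z = F u, False)
    else (SOME w. \<exists>u a. w = u @ [a] \<and> w \<in> ?X \<and> z \<in> set (internal_verts (Q u a)), True))" for z
  show thesis
  proof (rule that[of F own Q])
    fix u assume u: "u \<in> ?X"
    have "(SOME v. v \<in> ?X \<and> F u = F v) = u" by (rule some_equality) (use u Finj in auto)
    then show "F u \<in> pverts S \<and> own (F u) = (u, False)"
      using u cX[OF u] by (auto simp: own_def V F_def)
  next
    fix u a assume "u @ [a] \<in> ?X"
    then show "vpath (Q u a) (with_proj S) \<and> hd (Q u a) = F u \<and>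
      last (Q u a) = F (u @ [a]) \<and> length (internal_verts (Q u a)) \<le> r" using Q by simp
  next
    fix u a z assume ua: "u @ [a] \<in> ?X" and z: "z \<in> set (internal_verts (Q u a))"
    have "\<not> (\<exists>v\<in>?X. z = F v)" using Q(5)[OF ua] z cX by (auto simp: F_def)
    moreover have "(SOME w. \<exists>u a. w = u @ [a] \<and> w \<in> ?X \<and> z \<in> set (internal_verts (Q u a))) = u @ [a]"
      by (rule some_equality) (use ua z Qdisj in blast)+
    ultimately show "own z = (u @ [a], True)" by (simp add: own_def)
  qed
qed

text \<open>The tree is pruned from the leaves upwards. Each child is coloured by the number of
  subdivision vertices on its edge and by the profile found below it; among \<open>b\<close>
  children some \<open>N\<close> have the same colour and are kept.\<close>

lemma uniform_subtree:
  assumes S: "pair_graph S" and sub: "shallow_subdivision r (complete_tree b d) S" and d: "0 < d"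
    and b: "\<And>h. h < d \<Longrightarrow> N * card ({..r} \<times> profiles r h) < b"
  shows "\<exists>pr\<in>profiles r (d - 1). \<exists>v. embeds N pr (parcs S) (pverts S) v"
proof -
  let ?X = "lists_below b d"
  obtain F Q own where
    F: "\<And>u. u \<in> ?X \<Longrightarrow> F u \<in> pverts S \<and> own (F u) = (u, False)"
    and Q: "\<And>u a. u @ [a] \<in> ?X \<Longrightarrow> vpath (Q u a) (with_proj S) \<and> hd (Q u a) = F u \<and>
      last (Q u a) = F (u @ [a]) \<and> length (internal_verts (Q u a)) \<le> r"
    and own: "\<And>u a z. u @ [a] \<in> ?X \<Longrightarrow> z \<in> set (internal_verts (Q u a)) \<Longrightarrow> own z = (u @ [a], True)"
    using subdivision_owner[OF sub] by metis
  have symE: "sym (parcs S)" using S unfolding pair_graph_iff sym_def by blast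
  \<comment> \<open>The branch vertex of \<open>u\<close> and everything strictly below it.
    Subdivision vertices on the edge above \<open>u\<close> are owned by \<open>(u, True)\<close>
    and stay outside.\<close>
  define Reg where "Reg u = {z \<in> pverts S. own z = (u, False) \<or> (\<exists>a x. fst (own z) = u @ a # x)}" for u
  have main: "\<exists>pr\<in>profiles r h. embeds N pr (parcs S) (Reg u) (F u)" if "u \<in> ?X" "length u + h = d - 1" for u h
    using that
  proof (induction h arbitrary: u)
    case 0
    then show ?case using F embeds_Nil[of "F u" "Reg u"] by (simp add: Reg_def)
  next
    case (Suc h)
    have child: "u @ [a] \<in> ?X" if "a < b" for a using Suc.prems that by (auto simp: lists_below_def)
    have "\<exists>pr. pr \<in> profiles r h \<and> embeds N pr (parcs S) (Reg (u @ [a])) (F (u @ [a]))" if "a < b" for a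
      using Suc.IH[OF child[OF that]] Suc.prems(2) by auto
    then obtain pf where pf: "\<And>a. a < b \<Longrightarrow> pf a \<in> profiles r h"
      "\<And>a. a < b \<Longrightarrow> embeds N (pf a) (parcs S) (Reg (u @ [a])) (F (u @ [a]))" by metis
    \<comment> \<open>Without \<open>F u\<close>, the path to the child has one arc for each
      subdivision vertex of the edge, so \<open>length (q a) - 1\<close> counts these
      vertices.\<close>
    define q where "q a = tl (Q u a)" for a
    define Z where "Z a = Reg (u @ [a]) \<union> set (butlast (q a))" for a
    have step: "embeds N (replicate (length (q a) - 1) False @ pf a) (parcs S) (Z a) (hd (q a)) \<and>
        (F u, hd (q a)) \<in> parcs S \<and> length (q a) - 1 \<le> r \<and>
        Z a \<subseteq> {z \<in> pverts S. \<exists>x. fst (own z) = u @ a # x}" if a: "a < b" for a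
    proof -
      note ua = child[OF a]
      have Qp: "Q u a \<noteq> []" "distinct (Q u a)" "set (Q u a) \<subseteq> pverts S"
        "set (vwalk_arcs (Q u a)) \<subseteq> parcs S" using Q[OF ua] by (auto simp: vpath_iff)
      have ne: "F u \<noteq> F (u @ [a])" using F[OF Suc.prems(1)] F[OF ua] by (metis prod.inject append_self_conv not_Cons_self2)
      have Qq: "Q u a = F u # q a" using Qp(1) Q[OF ua] unfolding q_def by (metis list.collapse)
      have qne: "q a \<noteq> []" using Qq Q[OF ua] ne by auto
      have lastq: "last (q a) = F (u @ [a])" using Qq Q[OF ua] qne by simp
      have int: "internal_verts (Q u a) = butlast (q a)" by (simp add: internal_verts_def q_def)
      have own_int: "own z = (u @ [a], True)" if "z \<in> set (butlast (q a))" for z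
        using own[OF ua] that int by simp
      have arcs: "set (vwalk_arcs (q a)) \<subseteq> parcs S" "(F u, hd (q a)) \<in> parcs S"
        using Qp(4) unfolding Qq using qne by simp_all
      have "set (butlast (q a)) \<inter> Reg (u @ [a]) = {}" using own_int by (fastforce simp: Reg_def)
      then have "embeds N (replicate (length (q a) - 1) False @ pf a) (parcs S) (Z a) (hd (q a))"
        unfolding Z_def
        by (intro embeds_path[OF symE qne]) (use Qp(2) Qq lastq pf(2)[OF a] arcs(1) in auto)
      moreover have "length (q a) - 1 \<le> r" using Q[OF ua] int by (simp add: length_butlast)
      moreover have "set (butlast (q a)) \<subseteq> pverts S"
        using Qp(3) unfolding Qq by (auto dest: in_set_butlastD)
      then have "Z a \<subseteq> {z \<in> pverts S. \<exists>x. fst (own z) = u @ a # x}"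
        unfolding Z_def using own_int by (auto simp: Reg_def)
      ultimately show ?thesis using arcs(2) by blast
    qed
    define col where "col a = (length (q a) - 1, pf a)" for a
    have colK: "col ` {..<b} \<subseteq> {..r} \<times> profiles r h" using step pf(1) by (auto simp: col_def)
    have hd: "h < d" using Suc.prems(2) by simp
    obtain k \<iota> where k: "k \<in> {..r} \<times> profiles r h" "inj_on \<iota> {..<N}" "\<And>j. j < N \<Longrightarrow> \<iota> j < b \<and> col (\<iota> j) = k"
      by (rule pigeonhole_fibre[OF _ colK b[OF hd]]) (use finite_profiles in auto)
    obtain t pr where kt: "k = (t, pr)" by (cases k)
    have "embeds N (True # replicate t False @ pr) (parcs S) (insert (F u) (\<Union>j<N. Z (\<iota> j))) (F u)"
    proof (rule embeds_Cons[where v = "\<lambda>j. hd (q (\<iota> j))", OF _ symE])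
      fix j assume j: "j < N"
      then have \<iota>: "\<iota> j < b" "length (q (\<iota> j)) - 1 = t" "pf (\<iota> j) = pr"
        using k(3)[OF j] kt by (auto simp: col_def)
      show "embeds N (replicate t False @ pr) (parcs S) (Z (\<iota> j)) (hd (q (\<iota> j)))"
        "(F u, hd (q (\<iota> j))) \<in> parcs S" using step[OF \<iota>(1)] \<iota>(2,3) by auto
      show "F u \<notin> Z (\<iota> j)" using step[OF \<iota>(1)] F[OF Suc.prems(1)] by auto
      fix j' assume j': "j' < N" "j \<noteq> j'"
      have "\<iota> j' < b" "\<iota> j \<noteq> \<iota> j'" using k(3)[OF j'(1)] inj_onD[OF k(2)] j j' by auto
      then show "Z (\<iota> j) \<inter> Z (\<iota> j') = {}" using step[OF \<iota>(1)] step[of "\<iota> j'"] by fastforce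
    qed simp
    moreover have "insert (F u) (\<Union>j<N. Z (\<iota> j)) \<subseteq> Reg u"
    proof (intro insert_subsetI UN_least)
      show "F u \<in> Reg u" using F[OF Suc.prems(1)] by (simp add: Reg_def)
      fix j assume "j \<in> {..<N}"
      then show "Z (\<iota> j) \<subseteq> Reg u" using step[of "\<iota> j"] k(3)[of j] by (auto simp: Reg_def)
    qed
    ultimately have "embeds N (True # replicate t False @ pr) (parcs S) (Reg u) (F u)"
      by (rule embeds_mono[OF _ _ order_refl])
    moreover have "True # replicate t False @ pr \<in> profiles r (Suc h)" using k(1) kt by force
    ultimately show ?case by blast
  qed
  have "[] \<in> ?X" using d by (simp add: lists_below_def)
  then obtain pr where pr: "pr \<in> profiles r (d - 1)" "embeds N pr (parcs S) (Reg []) (F [])"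
    using main[of "[]" "d - 1"] by auto
  have "Reg [] \<subseteq> pverts S" unfolding Reg_def by (rule Collect_restrict)
  then have "embeds N pr (parcs S) (pverts S) (F [])" by (rule embeds_mono[OF pr(2) _ order_refl])
  then show ?thesis using pr(1) by (intro bexI exI)
qed

text \<open>The profile obtained for \<open>N\<close> may vary with \<open>N\<close>. If each of the
  finitely many profiles failed for some branching, all would fail for the sum of these branchings,
  since larger full trees contain smaller ones.\<close>

lemma uniform_profile:
  assumes C: "graph_class C" and d: "0 < d" and sub: "trees_of_depth d \<subseteq> TopMinors r C"
  shows "\<exists>pr\<in>profiles r (d - 1). \<forall>N. \<exists>G\<in>C. \<exists>v. embeds N pr (parcs G) (pverts G) v"
proof -
  have ex: "\<exists>pr\<in>profiles r (d - 1). \<exists>G\<in>C. \<exists>v. embeds N pr (parcs G) (pverts G) v" for N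
  proof -
    define b where "b = Suc (\<Sum>h<d. N * card ({..r} \<times> profiles r h))"
    have b: "N * card ({..r} \<times> profiles r h) < b" if "h < d" for h
      unfolding b_def less_Suc_eq_le by (rule member_le_sum) (use that in auto)
    have "complete_tree b d \<in> TopMinors r C"
      using complete_tree_depth[OF d, of b] sub by (auto simp: b_def)
    then obtain G S where G: "G \<in> C" "pair_graph S" "subgraph (with_proj S) (with_proj G)"
      "shallow_subdivision r (complete_tree b d) S"
      unfolding TopMinors_def shallow_top_minor_def by blast
    obtain pr v where pr: "pr \<in> profiles r (d - 1)" "embeds N pr (parcs S) (pverts S) v"
      using uniform_subtree[OF G(2,4) d b] by blast
    have "pair_graph G" using C G(1) by (simp add: graph_class_def)
    then have "pverts S \<subseteq> pverts G" "parcs S \<subseteq> parcs G" using subgraph_iff[OF _ G(2)] G(3) by auto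
    then have "embeds N pr (parcs G) (pverts G) v" by (rule embeds_mono[OF pr(2)])
    then show ?thesis using pr(1) G(1) by blast
  qed
  show ?thesis
  proof (rule ccontr)
    assume "\<not> ?thesis"
    then have "\<forall>pr\<in>profiles r (d - 1). \<exists>N. \<forall>G\<in>C. \<forall>v. \<not> embeds N pr (parcs G) (pverts G) v" by blast
    then obtain n where n: "\<And>pr G v. pr \<in> profiles r (d - 1) \<Longrightarrow> G \<in> C \<Longrightarrow>
        \<not> embeds (n pr) pr (parcs G) (pverts G) v" by metis
    define N where "N = (\<Sum>pr\<in>profiles r (d - 1). n pr)"
    obtain pr G v where pr: "pr \<in> profiles r (d - 1)" "G \<in> C" "embeds N pr (parcs G) (pverts G) v"
      using ex by blast
    have "n pr \<le> N" unfolding N_def by (rule member_le_sum) (use pr(1) finite_profiles in auto)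
    then have le: "full_tree (n pr) pr \<subseteq> full_tree N pr" by (rule full_tree_mono)
    obtain g where g: "inj_on g (full_tree N pr)" "g [] = v" "g ` full_tree N pr \<subseteq> pverts G"
      "\<forall>x\<in>full_tree N pr. \<forall>y\<in>full_tree N pr. ladj x y \<longrightarrow> (g x, g y) \<in> parcs G"
      using pr(3) unfolding embeds_def by (elim exE conjE)
    have "embeds (n pr) pr (parcs G) (pverts G) v"
      unfolding embeds_def
      by (intro exI[of _ g] conjI inj_on_subset[OF g(1) le] g(2)) (use g(3,4) le in blast)+
    then show False using n pr(1,2) by blast
  qed
qed

lemma bounded_alternation_imp_bounded_tree_rank:
  assumes C: "graph_class C" "monotone_class C"
    and k: "\<forall>\<phi>. \<exists>\<psi>. equivalent_on C \<phi> \<psi> \<and> alternation_rank \<psi> \<le> k"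
  shows "bounded_tree_rank C"
proof -
  \<comment> \<open>Depth \<open>d\<close> provides \<open>d - 1\<close> branching levels, one of
    them is given up below, and \<open>k + 2\<close> are needed.\<close>
  have bound: "d < k + 4" if d: "d \<in> tree_rank_set C" for d
  proof (rule ccontr)
    assume large: "\<not> d < k + 4"
    obtain r where r: "trees_of_depth d \<subseteq> TopMinors r C" using d by (auto simp: tree_rank_set_def)
    obtain pr where pr: "pr \<in> profiles r (d - 1)"
      and emb: "\<And>N. \<exists>G\<in>C. \<exists>v. embeds N pr (parcs G) (pverts G) v"
      using uniform_profile[OF C(1) _ r] large by auto
    have count: "count_list pr True = d - 1" by (rule count_profiles[OF pr])
    then have "pr \<noteq> []" using large by auto
    \<comment> \<open>The last level is given up as a branching level: only one child is kept there,
      to mark the flag at the bottom of the alternating trees.\<close>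
    then obtain pr0 b where pr0: "pr = pr0 @ [b]" by (cases pr rule: rev_cases) auto
    have "count_list pr True \<le> count_list pr0 True + 1" by (simp add: pr0)
    then have k2: "k + 2 \<le> count_list pr0 True" using count large by simp
    have emb0: "\<exists>G\<in>C. \<exists>g. inj_on g (full_tree N (pr0 @ [False])) \<and> g ` full_tree N (pr0 @ [False]) \<subseteq> pverts G \<and>
      (\<forall>x\<in>full_tree N (pr0 @ [False]). \<forall>y\<in>full_tree N (pr0 @ [False]). ladj x y \<longrightarrow> (g x, g y) \<in> parcs G)" for N
    proof -
      obtain G v where G: "G \<in> C" "embeds (Suc N) pr (parcs G) (pverts G) v" using emb by blast
      obtain g where g: "inj_on g (full_tree (Suc N) pr)" "g [] = v" "g ` full_tree (Suc N) pr \<subseteq> pverts G"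
        "\<forall>x\<in>full_tree (Suc N) pr. \<forall>y\<in>full_tree (Suc N) pr. ladj x y \<longrightarrow> (g x, g y) \<in> parcs G"
        using G(2) unfolding embeds_def by (elim exE conjE)
      have le: "full_tree N (pr0 @ [False]) \<subseteq> full_tree (Suc N) pr"
        unfolding pr0 using full_tree_mono[of N "Suc N" "pr0 @ [False]"] full_tree_append[of "Suc N" pr0 b] by auto
      show ?thesis
        by (intro bexI[OF _ G(1)] exI[of _ g] conjI inj_on_subset[OF g(1) le]) (use g(3,4) le in blast)+
    qed
    obtain \<psi> where \<psi>: "equivalent_on C (Neg (alt_formula pr0 0)) \<psi>" "alternation_rank \<psi> \<le> k"
      using k by blast
    have "k < alternation_rank \<psi>" by (rule no_alternation_bound[OF C k2 emb0 \<psi>(1)])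
    then show False using \<psi>(2) by simp
  qed
  have fin: "finite (tree_rank_set C)" by (rule finite_subset[of _ "{..<k + 4}"]) (use bound in auto)
  have "Max (tree_rank_set C) \<in> tree_rank_set C" by (rule Max_in[OF fin]) (use zero_in_tree_rank_set in auto)
  then show ?thesis unfolding bounded_tree_rank_def using Max_ge[OF fin] by blast
qed

theorem theorem1p9:
  fixes C :: "ngraph set"
  assumes "graph_class C" and "monotone_class C"
  shows "bounded_tree_rank C \<longleftrightarrow>
    (\<exists>k :: nat. \<forall>\<phi> :: fo. \<exists>\<psi> :: fo. equivalent_on C \<phi> \<psi> \<and> alternation_rank \<psi> \<le> k)"
  using bounded_tree_rank_imp_bounded_alternation[OF assms(1)]
    bounded_alternation_imp_bounded_tree_rank[OF assms] by blast

end
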